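(* The worst case power function for Banach spaces satisfies: (1) $\ell^{\,\mathrm{wor}\text{-}B}(r,p)=0$ for all $r\in(0,1]$ and $p\in[1,2]$; (2) $\ell^{\,\mathrm{wor}\text{-}B}(r,p)=0$ for all $r\in\left(0,\tfrac12+\tfrac1p\right]$ and $p\in(2,\infty)$; (3) $\ell^{\,\mathrm{wor}\text{-}B}(r,p)\le 1-\dfrac1r\left(1-\dfrac1p\right)$ for all $r>1$ and $p\in[1,2]$; (4) $\ell^{\,\mathrm{wor}\text{-}B}(r,p)\le 1-\dfrac1{2r}$ for all $r>1$ and $p\in[2,\infty)$; (5) $1-\dfrac1r\le \ell^{\,\mathrm{wor}\text{-}B}(r,\infty)\le 1-\dfrac1{2r}$ for all $r>1$.
   Context: Rate of convergence. For a sequence $(c_n)$ of nonnegative numbers converging to zero, $r(c_n):=\sup\{\beta\ge 0 : \lim_{n\to\infty}c_n n^{\beta}=0\}$; if $(c_n)$ does not converge to zero, $r(c_n):=0$. Setting. Let $p\in[1,\infty]$. $F$ is a (real) Banach space of functions defined on a set $\Omega$ such that for every $x\in\Omega$ the functional $f\mapsto f(x)$ is linear and continuous on $F$; $F\subset L_p=L_p(\Omega,\mu)$ and the embedding $I:F\to L_p$, $I(f)=f$, is continuous. The set $\Omega$ and the underlying measure $\mu$ of $L_p$ are arbitrary. $\|\cdot\|_p$ is the norm of $L_p$. Information and algorithms. $\Lambda^{\rm all}=F^*$ is the class of all continuous linear functionals on $F$, and $\Lambda^{\rm std}\subseteq\Lambda^{\rm all}$ is the class of function evaluations $L_x(f)=f(x)$,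 $x\in\Omega$. For a class $\Lambda\in\{\Lambda^{\rm all},\Lambda^{\rm std}\}$ an algorithm using $n$ functionals from $\Lambda$ is a map $A_n:F\to L_p$ of the form $A_n(f)=\phi_n(L_1(f),\dots,L_n(f))$, where $\phi_n:\mathbb{R}^n\to L_p$ is an arbitrary mapping and $L_j\in\Lambda$; the choice of $L_j$ may be adaptive, i.e. $L_j$ may depend on the already computed values $L_1(f),\dots,L_{j-1}(f)$. For $n=0$, $A_0(f)$ is a fixed element of $L_p$. Minimal worst case errors. For $n=0,1,2,\dots$, $$e_n^{\rm all\text{-}wor}(F,L_p)=\inf_{A_n\text{ with }L_j\in\Lambda^{\rm all}}\ \sup_{\|f\|_F\le1}\|f-A_n(f)\|_p,\qquad e_n^{\rm std\text{-}wor}(F,L_p)=\inf_{A_n\text{ with }L_j\in\Lambda^{\rm std}}\ \sup_{\|f\|_F\le1}\|f-A_n(f)\|_p.$$ Put $r^{\rm all\text{-}wor}(F,L_p)=r\big(e_n^{\rm all\text{-}wor}(F,L_p)\big)$ and $r^{\rm std\text{-}wor}(F,L_p)=r\big(e_n^{\rm std\text{-}wor}(F,L_p)\big)$. Power function. For $r\in(0,\infty)$ and $p\in[1,\infty]$, $$\ell^{\,\mathrm{wor}\text{-}B}(r,p):=\inf_{F:\ r^{\rm all\text{-}wor}(F,L_p)=r}\ \frac{r^{\rm std\text{-}wor}(F,L_p)}{r},$$ where the infimum is over all Banach spaces $F$ as in the setting above (continuously embedded in $L_p$, with continuous function evaluations) satisfying $r^{\rm all\text{-}wor}(F,L_p)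=r$.
   Formalization: For p=∞ the infimum is restricted to spaces F for which, outside one null set common to all of F, |f(x)| ≤ ‖f‖_∞ for every f in F (as for the sup norm or separable F); without this the lower bound in (5) is false for arbitrary μ. F ⊂ L_p is read as an injective embedding. *)

theory Defs
  imports "HOL-Probability.Essential_Supremum"
begin

text \<open>
  Elements of \<open>L\<^sub>p\<close> are represented by real functions that are measurable on the measure space;
  the exponent is an extended real, so that \<open>p = \<infinity>\<close> is included. The values of these functions
  outside \<^term>\<open>space M\<close> play no role.
\<close>

definition lp_norm :: "ereal \<Rightarrow> 'a measure \<Rightarrow> ('a \<Rightarrow> real) \<Rightarrow> real" where
  "lp_norm p M f =
    (if p = \<infinity> then real_of_ereal (esssup M (\<lambda>x. ereal \<bar>f x\<bar>))
     else (LINT x|M. \<bar>f x\<bar> powr real_of_ereal p) powr (1 / real_of_ereal p))"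

definition lp_space :: "ereal \<Rightarrow> 'a measure \<Rightarrow> ('a \<Rightarrow> real) set" where
  "lp_space p M =
    {f \<in> borel_measurable M.
      if p = \<infinity> then esssup M (\<lambda>x. ereal \<bar>f x\<bar>) < \<infinity>
      else integrable M (\<lambda>x. \<bar>f x\<bar> powr real_of_ereal p)}"

text \<open>
  A real Banach space of functions on \<open>\<Omega>\<close>, given by its carrier \<open>F\<close> and its norm \<open>N\<close>, with
  continuous point evaluations. A function on \<open>\<Omega>\<close> is represented by its extension by zero to
  the whole type, so that equality in HOL is equality on \<open>\<Omega>\<close>. Only the values of \<open>N\<close> on \<open>F\<close>
  matter.
\<close>

definition banach_function_space ::
  "'a set \<Rightarrow> ('a \<Rightarrow> real) set \<Rightarrow> (('a \<Rightarrow> real) \<Rightarrow> real) \<Rightarrow> bool" where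
  "banach_function_space \<Omega> F N \<longleftrightarrow>
    (\<forall>f\<in>F. \<forall>x. x \<notin> \<Omega> \<longrightarrow> f x = 0) \<and>
    (\<lambda>x. 0) \<in> F \<and>
    (\<forall>f\<in>F. \<forall>g\<in>F. (\<lambda>x. f x + g x) \<in> F) \<and>
    (\<forall>c. \<forall>f\<in>F. (\<lambda>x. c * f x) \<in> F) \<and>
    (\<forall>f\<in>F. 0 \<le> N f) \<and>
    (\<forall>f\<in>F. N f = 0 \<longleftrightarrow> f = (\<lambda>x. 0)) \<and>
    (\<forall>f\<in>F. \<forall>g\<in>F. N (\<lambda>x. f x + g x) \<le> N f + N g) \<and>
    (\<forall>c. \<forall>f\<in>F. N (\<lambda>x. c * f x) = \<bar>c\<bar> * N f) \<and>
    (\<forall>u. (\<forall>n::nat. u n \<in> F) \<and>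
         (\<forall>\<epsilon>>0. \<exists>n\<^sub>0. \<forall>m\<ge>n\<^sub>0. \<forall>n\<ge>n\<^sub>0. N (\<lambda>x. u m x - u n x) < \<epsilon>)
       \<longrightarrow> (\<exists>f\<in>F. (\<lambda>n. N (\<lambda>x. u n x - f x)) \<longlonglongrightarrow> 0)) \<and>
    (\<forall>x\<in>\<Omega>. \<exists>C. \<forall>f\<in>F. \<bar>f x\<bar> \<le> C * N f)"

text \<open>
  \<open>F\<close> is a subset of \<open>L\<^sub>p\<close>, with continuous inclusion. Since the elements of \<open>L\<^sub>p\<close> are classes of
  functions, being a subset includes that a member of \<open>F\<close> is determined by its class: only the
  zero function of \<open>F\<close> vanishes almost everywhere.

  For \<open>p = \<infinity>\<close> every single \<open>f\<close> satisfies \<open>\<bar>f x\<bar> \<le> \<parallel>f\<parallel>\<^sub>\<infinity>\<close> off a null set depending on \<open>f\<close>;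
  the last clause asks for one null set that serves all of \<open>F\<close>. This holds if the norm of
  \<open>L\<^sub>\<infinity>\<close> is the supremum norm on \<open>F\<close>, and for every separable \<open>F\<close>. Without it, function values
  on null sets can be so badly related to the essential supremum that the classical bound of the
  sampling error by a multiple of \<open>n\<close> times the error for general linear information fails.
\<close>

definition embedded_in_lp ::
  "ereal \<Rightarrow> 'a measure \<Rightarrow> ('a \<Rightarrow> real) set \<Rightarrow> (('a \<Rightarrow> real) \<Rightarrow> real) \<Rightarrow> bool" where
  "embedded_in_lp p M F N \<longleftrightarrow>
    F \<subseteq> lp_space p M \<and>
    (\<exists>C. \<forall>f\<in>F. lp_norm p M f \<le> C * N f) \<and>
    (\<forall>f\<in>F. (AE x in M. f x = 0) \<longrightarrow> f = (\<lambda>x. 0)) \<and>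
    (p = \<infinity> \<longrightarrow> (AE x in M. \<forall>f\<in>F. \<bar>f x\<bar> \<le> lp_norm p M f))"

definition admissible_space ::
  "ereal \<Rightarrow> 'a measure \<Rightarrow> ('a \<Rightarrow> real) set \<Rightarrow> (('a \<Rightarrow> real) \<Rightarrow> real) \<Rightarrow> bool" where
  "admissible_space p M F N \<longleftrightarrow>
    banach_function_space (space M) F N \<and> embedded_in_lp p M F N"

text \<open>Members of the dual are unconstrained outside \<open>F\<close>; they are only ever applied to \<open>f \<in> F\<close>.\<close>

definition Lambda_all ::
  "('a \<Rightarrow> real) set \<Rightarrow> (('a \<Rightarrow> real) \<Rightarrow> real) \<Rightarrow> (('a \<Rightarrow> real) \<Rightarrow> real) set" where
  "Lambda_all F N =
    {L. (\<forall>f\<in>F. \<forall>g\<in>F. L (\<lambda>x. f x + g x) = L f + L g) \<and>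
        (\<forall>c. \<forall>f\<in>F. L (\<lambda>x. c * f x) = c * L f) \<and>
        (\<exists>C. \<forall>f\<in>F. \<bar>L f\<bar> \<le> C * N f)}"

definition Lambda_std :: "'a set \<Rightarrow> (('a \<Rightarrow> real) \<Rightarrow> real) set" where
  "Lambda_std \<Omega> = {\<lambda>f. f x | x. x \<in> \<Omega>}"

text \<open>
  Adaptive information: \<open>sel [y\<^sub>1, \<dots>, y\<^sub>j]\<close> is the functional that is evaluated after the values
  \<open>y\<^sub>1, \<dots>, y\<^sub>j\<close> have been observed.
\<close>

primrec information ::
  "(real list \<Rightarrow> ('a \<Rightarrow> real) \<Rightarrow> real) \<Rightarrow> nat \<Rightarrow> ('a \<Rightarrow> real) \<Rightarrow> real list" where
  "information sel 0 f = []"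
| "information sel (Suc n) f = information sel n f @ [sel (information sel n f) f]"

definition algorithms ::
  "ereal \<Rightarrow> 'a measure \<Rightarrow> (('a \<Rightarrow> real) \<Rightarrow> real) set \<Rightarrow> nat \<Rightarrow> (('a \<Rightarrow> real) \<Rightarrow> 'a \<Rightarrow> real) set" where
  "algorithms p M \<Lambda> n =
    {\<lambda>f. \<phi> (information sel n f) | \<phi> sel.
      (\<forall>ys. length ys = n \<longrightarrow> \<phi> ys \<in> lp_space p M) \<and>
      (\<forall>ys. length ys < n \<longrightarrow> sel ys \<in> \<Lambda>)}"

definition minimal_error ::
  "ereal \<Rightarrow> 'a measure \<Rightarrow> ('a \<Rightarrow> real) set \<Rightarrow> (('a \<Rightarrow> real) \<Rightarrow> real) \<Rightarrow>
    (('a \<Rightarrow> real) \<Rightarrow> real) set \<Rightarrow> nat \<Rightarrow> ereal" where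
  "minimal_error p M F N \<Lambda> n =
    (INF A \<in> algorithms p M \<Lambda> n.
      SUP f \<in> {f \<in> F. N f \<le> 1}. ereal (lp_norm p M (\<lambda>x. f x - A f x)))"

definition rate :: "(nat \<Rightarrow> ereal) \<Rightarrow> ereal" where
  "rate c =
    (if c \<longlonglongrightarrow> 0
     then Sup {ereal \<beta> | \<beta>. 0 \<le> \<beta> \<and> (\<lambda>n. c n * ereal (real n powr \<beta>)) \<longlonglongrightarrow> 0}
     else 0)"

definition rate_all ::
  "ereal \<Rightarrow> 'a measure \<Rightarrow> ('a \<Rightarrow> real) set \<Rightarrow> (('a \<Rightarrow> real) \<Rightarrow> real) \<Rightarrow> ereal" where
  "rate_all p M F N = rate (minimal_error p M F N (Lambda_all F N))"

definition rate_std ::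
  "ereal \<Rightarrow> 'a measure \<Rightarrow> ('a \<Rightarrow> real) set \<Rightarrow> (('a \<Rightarrow> real) \<Rightarrow> real) \<Rightarrow> ereal" where
  "rate_std p M F N = rate (minimal_error p M F N (Lambda_std (space M)))"

text \<open>
  The type \<open>'a\<close> is the universe from which the sets \<open>\<Omega> = space M\<close> are taken. HOL has no infimum
  over all types, so the universe is a parameter. It should be infinite: on a finite set every
  \<open>F\<close> is finite-dimensional, \<^term>\<open>rate_all p M F N\<close> is infinite, and the infimum below is taken
  over the empty set.
\<close>

definition power_function :: "'a itself \<Rightarrow> real \<Rightarrow> ereal \<Rightarrow> ereal" where
  "power_function TYPE('a) r p =
    Inf {rate_std p M F N / ereal r | (M :: 'a measure) F N.
      admissible_space p M F N \<and> rate_all p M F N = ereal r}"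

end

theory Submission
  imports Defs "Jordan_Normal_Form.Determinant" "HOL-Real_Asymp.Real_Asymp"
begin

text \<open>
  The minimal error of \<open>n\<close> pieces of information is, up to a factor \<open>2\<close>, the smallest possible
  size in \<open>L\<^sub>p\<close> of the part of the unit ball on which \<open>n\<close> admissible functionals vanish
  (\<open>kernel_bound_of_minimal_error\<close>, \<open>minimal_error_of_kernel_bound\<close>). For arbitrary functionals these
  are Gelfand widths; for function values, the functions have to vanish at \<open>n\<close> points. Everything
  below is about these two quantities.

  The upper bounds of the power function come from one family of spaces, \<open>hidden_line_space\<close>. The
  domain is countable and carries the counting measure; its points are called \<open>a i\<close> and \<open>b i\<close>. On the
  points \<open>b i\<close> the norm is an \<open>\<ell>\<^sub>p\<close> norm with weights \<open>(i + 1) powr r\<close>. This part has the error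
  \<open>(n + 1) powr - r\<close>, so the rate for arbitrary functionals is at most \<open>r\<close>. On the points \<open>a i\<close>, a function
  has the form \<open>c * g i + u i\<close> and contributes \<open>\<bar>c\<bar> + (\<Sum>i. w i * \<bar>u i\<bar>)\<close> to the norm.

  Arbitrary functionals do well on this part. One of them finds \<open>c\<close>, and some find the first
  values of \<open>u\<close>. On a polynomial number of further coordinates one uses \<open>n\<close> random sign vectors. On
  their common kernel the Euclidean norm is smaller than the \<open>\<ell>\<^sub>1\<close> norm by the factor
  \<open>n powr (- 1 / 2)\<close>, up to logarithms, as in the work of Kashin, Garnaev and Gluskin
  (\<open>exists_signs_with_flat_kernel\<close>). By interpolation the \<open>\<ell>\<^sub>p\<close> norm is smaller by
  \<open>n powr - \<kappa>\<close>, where \<open>\<kappa> = 1 - 1 / p\<close> for \<open>p \<le> 2\<close> and \<open>\<kappa> = 1 / 2\<close> for \<open>p \<ge> 2\<close>. If \<open>w i\<close> grows like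
  \<open>i powr \<sigma>\<close>, the error on this part therefore decays at least with the rate \<open>\<sigma> + \<kappa>\<close> (\<open>rate_all_eq\<close>).

  Function values do badly for two reasons. First, \<open>n\<close> points leave one of the first \<open>n + 1\<close> coordinates
  free, so for increasing \<open>w\<close> the error is at least \<open>1 / w n\<close>. With \<open>\<sigma> = r - \<kappa>\<close> the rates are \<open>r\<close> and at most \<open>r - \<kappa>\<close>, which
  gives the bound \<open>1 - \<kappa> / r\<close> (\<open>power_function_le_gain\<close>). Secondly, the line spanned by \<open>g\<close> is hidden:
  changing \<open>g\<close> to \<open>0\<close> at finitely many points costs only the sum of \<open>w i * g i\<close> over these points. On blocks
  of rapidly increasing size \<open>T\<close>, let \<open>w\<close> be \<open>T powr (1 / p)\<close> and \<open>g\<close> be \<open>T powr (- 1 / p)\<close>, up to factors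
  smaller than every power of \<open>T\<close>. Then this cost and the norm of \<open>g\<close> on the block are so close to
  constant, compared with the number of points, that function values have rate \<open>0\<close>, while the
  rate \<open>1 / p + \<kappa>\<close> is available for arbitrary functionals (\<open>power_function_zero\<close>). Hence the value \<open>0\<close> for all
  \<open>r \<le> 1 / p + \<kappa>\<close>, because the points \<open>b i\<close> bring the rate for arbitrary functionals down to \<open>r\<close>.

  The lower bound for \<open>p = \<infinity>\<close> says that function values lose at most a factor proportional to \<open>n\<close>
  (\<open>sampling_error_le\<close>). By the Hahn--Banach theorem, evaluation at any point is a combination of the
  \<open>n\<close> given functionals up to a small error. By a determinant argument, \<open>n\<close> of the points can be
  selected such that evaluation at any point is a combination of the selected evaluations with
  coefficients at most \<open>2\<close>, again up to a small error.
\<close>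

section \<open>Norms of p-integrable functions\<close>

lemma lp_norm_nonneg: "0 \<le> lp_norm p M f"
proof (cases "p = \<infinity>")
  case True
  show ?thesis
  proof (cases "emeasure M (space M) = 0 \<or> (\<lambda>x. ereal \<bar>f x\<bar>) \<notin> borel_measurable M")
    case True
    then show ?thesis using \<open>p = \<infinity>\<close>
      by (cases "(\<lambda>x. ereal \<bar>f x\<bar>) \<in> borel_measurable M")
        (auto simp: lp_norm_def esssup_non_measurable esssup_zero_space top_ereal_def)
  next
    case False
    then have "esssup M (\<lambda>x. 0) \<le> esssup M (\<lambda>x. ereal \<bar>f x\<bar>)"
      by (intro esssup_mono) auto
    moreover have "esssup M (\<lambda>x. 0::ereal) = 0" using False by (intro esssup_const) auto
    ultimately show ?thesis using True by (simp add: lp_norm_def real_of_ereal_pos)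
  qed
qed (simp add: lp_norm_def)

lemma lp_space_measurable: "f \<in> lp_space p M \<Longrightarrow> f \<in> borel_measurable M"
  by (simp add: lp_space_def)

lemma lp_inf_AE_le:
  assumes "f \<in> lp_space \<infinity> M"
  shows "AE x in M. \<bar>f x\<bar> \<le> lp_norm \<infinity> M f"
proof -
  have "AE x in M. ereal \<bar>f x\<bar> \<le> esssup M (\<lambda>x. ereal \<bar>f x\<bar>)" by (rule esssup_AE)
  moreover have fin: "esssup M (\<lambda>x. ereal \<bar>f x\<bar>) < \<infinity>"
    using assms by (simp add: lp_space_def)
  ultimately show ?thesis
  proof (elim eventually_mono)
    fix x assume "ereal \<bar>f x\<bar> \<le> esssup M (\<lambda>x. ereal \<bar>f x\<bar>)"
    then show "\<bar>f x\<bar> \<le> lp_norm \<infinity> M f" using fin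
      by (cases "esssup M (\<lambda>x. ereal \<bar>f x\<bar>)") (auto simp: lp_norm_def)
  qed
qed

lemma lp_inf_leI:
  assumes "f \<in> borel_measurable M" "AE x in M. \<bar>f x\<bar> \<le> B" "0 \<le> B"
  shows "f \<in> lp_space \<infinity> M" "lp_norm \<infinity> M f \<le> B"
proof -
  have *: "esssup M (\<lambda>x. ereal \<bar>f x\<bar>) \<le> ereal B"
    using assms by (intro esssup_I) auto
  then show "f \<in> lp_space \<infinity> M" using assms by (auto simp: lp_space_def)
  show "lp_norm \<infinity> M f \<le> B" using * \<open>0 \<le> B\<close>
    by (cases "esssup M (\<lambda>x. ereal \<bar>f x\<bar>)") (auto simp: lp_norm_def)
qed

lemma lp_norm_powr:
  assumes "p \<noteq> \<infinity>" "1 \<le> p"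
  shows "lp_norm p M f powr real_of_ereal p = (LINT x|M. \<bar>f x\<bar> powr real_of_ereal p)"
proof -
  have "1 \<le> real_of_ereal p" using assms by (cases p) auto
  moreover have "0 \<le> (LINT x|M. \<bar>f x\<bar> powr real_of_ereal p)" by simp
  ultimately show ?thesis using assms by (simp add: lp_norm_def powr_powr)
qed

text \<open>
  Convexity of the power function on the closed half-line. If one of the points is \<open>0\<close>, it holds
  because \<open>l powr p \<le> l\<close>.
\<close>
lemma powr_convex_comb:
  fixes s t l p :: real
  assumes "1 \<le> p" "0 \<le> s" "0 \<le> t" "0 \<le> l" "l \<le> 1"
  shows "(l * s + (1 - l) * t) powr p \<le> l * s powr p + (1 - l) * t powr p"
proof -
  have aux: "(m * t) powr p \<le> m * t powr p" if "0 \<le> m" "m \<le> 1" "0 \<le> t" for m t :: real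
  proof (cases "m = 0")
    case False
    have "m powr p \<le> m powr 1" using that False assms by (intro powr_mono') auto
    then show ?thesis using that False by (auto simp: powr_mult intro!: mult_right_mono)
  qed simp
  consider "s = 0" | "t = 0" | "s > 0" "t > 0" using assms by linarith
  then show ?thesis
  proof cases
    case 1 then show ?thesis using aux[of "1 - l" t] assms by simp
  next
    case 2 then show ?thesis using aux[of "l" s] assms by simp
  next
    case 3
    then show ?thesis
      using convex_onD[OF powr_convex[OF \<open>1 \<le> p\<close>], of "1 - l" s t] assms by simp
  qed
qed

text \<open>
  Minkowski's inequality, by convexity of the power function: with \<open>a\<close> and \<open>b\<close> upper bounds of
  the norms, \<open>(f + g) / (a + b)\<close> is a pointwise convex combination of \<open>f / a\<close> and \<open>g / b\<close>, both of
  which lie in the unit ball.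
\<close>
lemma lp_norm_add_bound:
  assumes p: "1 \<le> p" and f: "f \<in> lp_space p M" and g: "g \<in> lp_space p M"
    and a: "lp_norm p M f \<le> a" "0 < a" and b: "lp_norm p M g \<le> b" "0 < b"
  shows "(\<lambda>x. f x + g x) \<in> lp_space p M \<and> lp_norm p M (\<lambda>x. f x + g x) \<le> a + b"
proof (cases "p = \<infinity>")
  case True
  have "AE x in M. \<bar>f x + g x\<bar> \<le> a + b"
    using lp_inf_AE_le[of f M] lp_inf_AE_le[of g M] f g True a(1) b(1)
    by (auto elim!: eventually_elim2)
  then show ?thesis using True a(2) b(2) f g
    lp_inf_leI[of "\<lambda>x. f x + g x" M "a + b"] by (auto dest!: lp_space_measurable)
next
  case False
  define q where "q = real_of_ereal p"
  have q: "1 \<le> q" using False p unfolding q_def by (cases p) auto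
  define l where "l = a / (a + b)"
  have l: "0 \<le> l" "l \<le> 1" "1 - l = b / (a + b)"
    using a(2) b(2) by (auto simp: l_def field_simps)
  have fi: "integrable M (\<lambda>x. \<bar>f x\<bar> powr q)" and gi: "integrable M (\<lambda>x. \<bar>g x\<bar> powr q)"
    and [measurable]: "f \<in> borel_measurable M" "g \<in> borel_measurable M"
    using f g False by (auto simp: lp_space_def q_def)
  let ?h = "\<lambda>x. (a + b) powr q * (l * (\<bar>f x\<bar> powr q / a powr q) + (1 - l) * (\<bar>g x\<bar> powr q / b powr q))"
  have pt: "\<bar>f x + g x\<bar> powr q \<le> ?h x" for x
  proof -
    have "\<bar>f x + g x\<bar> powr q \<le> ((a + b) * (l * (\<bar>f x\<bar> / a) + (1 - l) * (\<bar>g x\<bar> / b))) powr q"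
    proof (rule powr_mono2)
      have "(a + b) * (l * (\<bar>f x\<bar> / a) + (1 - l) * (\<bar>g x\<bar> / b)) = \<bar>f x\<bar> + \<bar>g x\<bar>"
      proof -
        have "(a + b) * l = a" "(a + b) * (1 - l) = b"
          unfolding l(3) using a(2) b(2) by (auto simp: l_def)
        then have "(a + b) * (l * s + (1 - l) * t) = a * s + b * t" for s t
          by (metis distrib_left mult.assoc)
        then have "(a + b) * (l * (\<bar>f x\<bar> / a) + (1 - l) * (\<bar>g x\<bar> / b))
            = a * (\<bar>f x\<bar> / a) + b * (\<bar>g x\<bar> / b)" .
        then show ?thesis using a(2) b(2) by simp
      qed
      then show "\<bar>f x + g x\<bar> \<le> (a + b) * (l * (\<bar>f x\<bar> / a) + (1 - l) * (\<bar>g x\<bar> / b))" by simp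
    qed (use q in auto)
    also have "\<dots> = (a + b) powr q * (l * (\<bar>f x\<bar> / a) + (1 - l) * (\<bar>g x\<bar> / b)) powr q"
      using a(2) b(2) l by (simp add: powr_mult)
    also have "\<dots> \<le> (a + b) powr q * (l * (\<bar>f x\<bar> / a) powr q + (1 - l) * (\<bar>g x\<bar> / b) powr q)"
      using a(2) b(2) l q by (intro mult_left_mono powr_convex_comb) auto
    finally show ?thesis using a(2) b(2) by (simp add: powr_divide)
  qed
  have hi: "integrable M ?h" using fi gi by auto
  have si: "integrable M (\<lambda>x. \<bar>f x + g x\<bar> powr q)"
    by (rule Bochner_Integration.integrable_bound[OF hi]) (auto intro!: AE_I2 order_trans[OF pt abs_ge_self] simp del: times_divide_eq_right)
  have "(LINT x|M. \<bar>f x + g x\<bar> powr q) \<le> (LINT x|M. ?h x)"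
    by (rule integral_mono[OF si hi pt])
  also have "\<dots> = (a + b) powr q * (l * ((LINT x|M. \<bar>f x\<bar> powr q) / a powr q)
      + (1 - l) * ((LINT x|M. \<bar>g x\<bar> powr q) / b powr q))"
    using fi gi by simp
  also have "\<dots> \<le> (a + b) powr q * (l * 1 + (1 - l) * 1)"
  proof -
    have "lp_norm p M f powr q \<le> a powr q" "lp_norm p M g powr q \<le> b powr q"
      using a b q lp_norm_nonneg by (auto intro!: powr_mono2)
    then have "(LINT x|M. \<bar>f x\<bar> powr q) / a powr q \<le> 1" "(LINT x|M. \<bar>g x\<bar> powr q) / b powr q \<le> 1"
      using a(2) b(2) False p by (simp_all add: q_def lp_norm_powr)
    then show ?thesis using l by (intro mult_left_mono add_mono) auto
  qed
  finally have "(LINT x|M. \<bar>f x + g x\<bar> powr q) \<le> (a + b) powr q" by simp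
  then have "(LINT x|M. \<bar>f x + g x\<bar> powr q) powr (1 / q) \<le> ((a + b) powr q) powr (1 / q)"
    using q by (intro powr_mono2) auto
  then show ?thesis using si False q a(2) b(2)
    by (auto simp: lp_space_def lp_norm_def q_def powr_powr)
qed

text \<open>
  The norms may be \<open>0\<close>; the positive bounds of \<open>lp_norm_add_bound\<close> approach them from above.
\<close>
lemma lp_add:
  assumes p: "1 \<le> p" and f: "f \<in> lp_space p M" and g: "g \<in> lp_space p M"
  shows "(\<lambda>x. f x + g x) \<in> lp_space p M"
    and "lp_norm p M (\<lambda>x. f x + g x) \<le> lp_norm p M f + lp_norm p M g"
proof -
  have *: "(\<lambda>x. f x + g x) \<in> lp_space p M \<and>
     lp_norm p M (\<lambda>x. f x + g x) \<le> (lp_norm p M f + e / 2) + (lp_norm p M g + e / 2)" if "0 < e" for e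
    by (rule lp_norm_add_bound) (use that assms lp_norm_nonneg[of p M] in \<open>auto intro: add_nonneg_pos\<close>)
  show "(\<lambda>x. f x + g x) \<in> lp_space p M" using *[of 1] by simp
  show "lp_norm p M (\<lambda>x. f x + g x) \<le> lp_norm p M f + lp_norm p M g"
    by (rule field_le_epsilon) (use * in fastforce)
qed

lemma lp_scale:
  assumes p: "1 \<le> p" and f: "f \<in> lp_space p M"
  shows "(\<lambda>x. c * f x) \<in> lp_space p M"
    and "lp_norm p M (\<lambda>x. c * f x) = \<bar>c\<bar> * lp_norm p M f"
proof -
  have 1: "(\<lambda>x. c * f x) \<in> lp_space p M \<and> lp_norm p M (\<lambda>x. c * f x) \<le> \<bar>c\<bar> * lp_norm p M f"
    if f: "f \<in> lp_space p M" for f c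
  proof (cases "p = \<infinity>")
    case True
    have "AE x in M. \<bar>c * f x\<bar> \<le> \<bar>c\<bar> * lp_norm p M f"
      using lp_inf_AE_le[of f M] f True by (auto simp: abs_mult elim!: eventually_mono intro: mult_left_mono)
    then show ?thesis using True f lp_norm_nonneg[of p M f]
      lp_inf_leI[of "\<lambda>x. c * f x" M "\<bar>c\<bar> * lp_norm p M f"] by (auto dest!: lp_space_measurable)
  next
    case False
    define q where "q = real_of_ereal p"
    have q: "1 \<le> q" using False p unfolding q_def by (cases p) auto
    have "(LINT x|M. \<bar>c * f x\<bar> powr q) = \<bar>c\<bar> powr q * (LINT x|M. \<bar>f x\<bar> powr q)"
      by (simp add: abs_mult powr_mult)
    then show ?thesis using False f q
      by (auto simp: lp_space_def lp_norm_def q_def[symmetric] powr_mult abs_mult powr_powr)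
  qed
  show "(\<lambda>x. c * f x) \<in> lp_space p M" using 1 f by blast
  show "lp_norm p M (\<lambda>x. c * f x) = \<bar>c\<bar> * lp_norm p M f"
  proof (cases "c = 0")
    case True
    then show ?thesis using 1[OF f, of 0] lp_norm_nonneg[of p M "\<lambda>x. 0"] by simp
  next
    case False
    have "lp_norm p M f = lp_norm p M (\<lambda>x. (1 / c) * (c * f x))" using False by simp
    also have "\<dots> \<le> \<bar>1 / c\<bar> * lp_norm p M (\<lambda>x. c * f x)" using 1 f by blast
    finally have "\<bar>c\<bar> * lp_norm p M f \<le> lp_norm p M (\<lambda>x. c * f x)"
      using False by (simp add: field_simps)
    then show ?thesis using 1[OF f, of c] by linarith
  qed
qed

lemma lp_zero: "1 \<le> p \<Longrightarrow> (\<lambda>x. 0) \<in> lp_space p M" "1 \<le> p \<Longrightarrow> lp_norm p M (\<lambda>x. 0) = 0"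
proof -
  assume p: "1 \<le> p"
  show z: "(\<lambda>x. 0) \<in> lp_space p M"
    using lp_inf_leI[of "\<lambda>x. 0" M 0] by (cases "p = \<infinity>") (auto simp: lp_space_def)
  show "lp_norm p M (\<lambda>x. 0) = 0" using lp_scale(2)[OF p z, of 0] by simp
qed

lemma lp_diff:
  assumes p: "1 \<le> p" and f: "f \<in> lp_space p M" and g: "g \<in> lp_space p M"
  shows "(\<lambda>x. f x - g x) \<in> lp_space p M"
    and "lp_norm p M (\<lambda>x. f x - g x) \<le> lp_norm p M f + lp_norm p M g"
  using lp_add[OF p f lp_scale(1)[OF p g, of "-1"]] lp_scale(2)[OF p g, of "-1"] by auto

lemma lp_mono:
  assumes p: "1 \<le> p" and g: "g \<in> lp_space p M" and f: "f \<in> borel_measurable M"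
    and le: "\<And>x. x \<in> space M \<Longrightarrow> \<bar>f x\<bar> \<le> \<bar>g x\<bar>"
  shows "f \<in> lp_space p M" and "lp_norm p M f \<le> lp_norm p M g"
proof -
  have "f \<in> lp_space p M \<and> lp_norm p M f \<le> lp_norm p M g"
  proof (cases "p = \<infinity>")
    case True
    have "AE x in M. \<bar>f x\<bar> \<le> lp_norm \<infinity> M g"
      using lp_inf_AE_le[of g M] g True le AE_space[of M] by (auto elim!: eventually_elim2 dest: order_trans)
    then show ?thesis using lp_inf_leI[OF f, of "lp_norm \<infinity> M g"] True lp_norm_nonneg[of \<infinity> M g] by auto
  next
    case False
    define q where "q = real_of_ereal p"
    have q: "1 \<le> q" using False p unfolding q_def by (cases p) auto
    have pt: "\<bar>f x\<bar> powr q \<le> \<bar>g x\<bar> powr q" if "x \<in> space M" for x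
      using le[OF that] q by (intro powr_mono2) auto
    have gi: "integrable M (\<lambda>x. \<bar>g x\<bar> powr q)" using g False by (simp add: lp_space_def q_def)
    have fi: "integrable M (\<lambda>x. \<bar>f x\<bar> powr q)"
      by (rule Bochner_Integration.integrable_bound[OF gi]) (use f pt in auto)
    have "(LINT x|M. \<bar>f x\<bar> powr q) \<le> (LINT x|M. \<bar>g x\<bar> powr q)"
      by (rule integral_mono[OF fi gi]) (rule pt)
    then show ?thesis using fi f False q
      by (auto simp: lp_space_def lp_norm_def q_def[symmetric] intro!: powr_mono2)
  qed
  then show "f \<in> lp_space p M" "lp_norm p M f \<le> lp_norm p M g" by auto
qed

section \<open>Norms of p-summable functions on a set\<close>

abbreviation ell_norm :: "ereal \<Rightarrow> 'a set \<Rightarrow> ('a \<Rightarrow> real) \<Rightarrow> real" where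
  "ell_norm p A \<equiv> lp_norm p (count_space A)"
abbreviation ell_space :: "ereal \<Rightarrow> 'a set \<Rightarrow> ('a \<Rightarrow> real) set" where
  "ell_space p A \<equiv> lp_space p (count_space A)"

lemma lp_space_finite: "finite S \<Longrightarrow> f \<in> ell_space p S"
proof (cases "p = \<infinity>")
  case True
  assume S: "finite S"
  have "\<bar>f x\<bar> \<le> (\<Sum>x\<in>S. \<bar>f x\<bar>)" if "x \<in> S" for x
    using S that by (intro member_le_sum) auto
  then show ?thesis using True lp_inf_leI[of f "count_space S" "\<Sum>x\<in>S. \<bar>f x\<bar>"]
    by (auto simp: AE_count_space intro: sum_nonneg)
qed (auto simp: lp_space_def intro: integrable_count_space)

lemma lp_norm_finite:
  "finite S \<Longrightarrow> p \<noteq> \<infinity> \<Longrightarrow>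
    ell_norm p S f = (\<Sum>x\<in>S. \<bar>f x\<bar> powr real_of_ereal p) powr (1 / real_of_ereal p)"
  by (simp add: lp_norm_def lebesgue_integral_count_space_finite)

lemma lp1_norm_finite: "finite S \<Longrightarrow> ell_norm 1 S f = (\<Sum>x\<in>S. \<bar>f x\<bar>)"
  by (subst lp_norm_finite) (auto intro!: sum_nonneg)

lemma lp_norm_singleton: "1 \<le> p \<Longrightarrow> ell_norm p {x} f = \<bar>f x\<bar>"
proof (cases "p = \<infinity>")
  case True
  have "ell_norm \<infinity> {x} f \<le> \<bar>f x\<bar>"
    by (rule lp_inf_leI) (auto simp: AE_count_space)
  moreover have "\<bar>f x\<bar> \<le> ell_norm \<infinity> {x} f"
    using lp_inf_AE_le[of f "count_space {x}"] lp_space_finite[of "{x}" f \<infinity>] by (auto simp: AE_count_space)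
  ultimately show ?thesis using True by auto
next
  case False
  assume "1 \<le> p"
  with False have "1 \<le> real_of_ereal p" by (cases p) auto
  then show ?thesis using False by (simp add: lp_norm_finite powr_powr)
qed

lemma lp_count_subset:
  assumes p: "1 \<le> p" and f: "f \<in> ell_space p A" and S: "S \<subseteq> A"
  shows "f \<in> ell_space p S" and "ell_norm p S f \<le> ell_norm p A f"
proof -
  have "f \<in> ell_space p S \<and> ell_norm p S f \<le> ell_norm p A f"
  proof (cases "p = \<infinity>")
    case True
    have "\<bar>f x\<bar> \<le> ell_norm \<infinity> A f" if "x \<in> A" for x
      using lp_inf_AE_le[of f "count_space A"] f True that by (auto simp: AE_count_space)
    then show ?thesis using lp_inf_leI[of f "count_space S" "ell_norm \<infinity> A f"] S True
      by (auto simp: AE_count_space lp_norm_nonneg)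
  next
    case False
    define q where "q = real_of_ereal p"
    have q: "1 \<le> q" using False p unfolding q_def by (cases p) auto
    have fi: "Infinite_Set_Sum.abs_summable_on (\<lambda>x. \<bar>f x\<bar> powr q) A"
      using f False by (simp add: lp_space_def q_def abs_summable_on_def)
    then have si: "Infinite_Set_Sum.abs_summable_on (\<lambda>x. \<bar>f x\<bar> powr q) S"
      using S by (rule abs_summable_on_subset)
    have "infsetsum (\<lambda>x. \<bar>f x\<bar> powr q) S \<le> infsetsum (\<lambda>x. \<bar>f x\<bar> powr q) A"
      using fi si S by (intro infsetsum_mono_neutral_left) auto
    then show ?thesis using si False q
      by (auto simp: lp_space_def lp_norm_def q_def[symmetric] abs_summable_on_def infsetsum_def
          intro!: powr_mono2)
  qed
  then show "f \<in> ell_space p S" "ell_norm p S f \<le> ell_norm p A f"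
    by auto
qed

lemma lp_count_point:
  assumes "1 \<le> p" "f \<in> ell_space p A" "x \<in> A"
  shows "\<bar>f x\<bar> \<le> ell_norm p A f"
  using lp_count_subset(2)[OF assms(1,2), of "{x}"] assms by (simp add: lp_norm_singleton)

text \<open>
  For the counting measure, membership in \<open>L\<^sub>p\<close> and bounds of the norm can be checked on finite
  subsets. All estimates in infinite-dimensional spaces below are reduced to finite sums in this way.
\<close>
lemma lp_count_leI:
  assumes p: "1 \<le> p" and B: "0 \<le> B"
    and le: "\<And>S. finite S \<Longrightarrow> S \<subseteq> A \<Longrightarrow> ell_norm p S f \<le> B"
  shows "f \<in> ell_space p A" and "ell_norm p A f \<le> B"
proof -
  have "f \<in> ell_space p A \<and> ell_norm p A f \<le> B"
  proof (cases "p = \<infinity>")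
    case True
    have "\<bar>f x\<bar> \<le> B" if "x \<in> A" for x
      using le[of "{x}"] that p by (simp add: lp_norm_singleton)
    then show ?thesis using lp_inf_leI[of f "count_space A" B] B True
      by (auto simp: AE_count_space)
  next
    case False
    define q where "q = real_of_ereal p"
    have q: "1 \<le> q" using False p unfolding q_def by (cases p) auto
    have sb: "(\<Sum>x\<in>S. \<bar>f x\<bar> powr q) \<le> B powr q" if "finite S" "S \<subseteq> A" for S
    proof -
      have "0 \<le> (\<Sum>x\<in>S. \<bar>f x\<bar> powr q)" by (intro sum_nonneg) auto
      then have "(\<Sum>x\<in>S. \<bar>f x\<bar> powr q) = ((\<Sum>x\<in>S. \<bar>f x\<bar> powr q) powr (1 / q)) powr q"
        using q by (simp add: powr_powr)
      also have "\<dots> \<le> B powr q"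
        using le[OF that] False that q B by (intro powr_mono2) (auto simp: lp_norm_finite q_def[symmetric])
      finally show ?thesis .
    qed
    have s: "(\<lambda>x. \<bar>f x\<bar> powr q) summable_on A"
      by (rule nonneg_bdd_above_summable_on) (use sb in \<open>auto intro!: bdd_aboveI\<close>)
    then have as: "Infinite_Set_Sum.abs_summable_on (\<lambda>x. \<bar>f x\<bar> powr q) A"
      by (simp add: abs_summable_equivalent[symmetric])
    have "infsetsum (\<lambda>x. \<bar>f x\<bar> powr q) A = infsum (\<lambda>x. \<bar>f x\<bar> powr q) A"
      by (rule infsetsum_infsum[OF as])
    also have "\<dots> \<le> B powr q" by (rule infsum_le_finite_sums[OF s sb])
    finally have "infsetsum (\<lambda>x. \<bar>f x\<bar> powr q) A \<le> B powr q" .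
    then have "infsetsum (\<lambda>x. \<bar>f x\<bar> powr q) A powr (1 / q) \<le> (B powr q) powr (1 / q)"
      using q by (intro powr_mono2) (auto intro: infsetsum_nonneg)
    then show ?thesis using as False q B
      by (auto simp: lp_space_def lp_norm_def q_def[symmetric] abs_summable_on_def infsetsum_def powr_powr)
  qed
  then show "f \<in> ell_space p A" "ell_norm p A f \<le> B" by auto
qed

text \<open>
  The exponent \<open>\<kappa>\<close> with which the Gelfand widths of \<open>\<ell>\<^sub>1\<^sup>N\<close> in \<open>\<ell>\<^sub>p\<^sup>N\<close> decay, for \<open>N\<close> polynomial in the
  number of functionals.
\<close>
definition gelfand_gain :: "ereal \<Rightarrow> real" where
  "gelfand_gain p = (if p \<le> 2 then 1 - 1 / real_of_ereal p else 1 / 2)"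

text \<open>
  A bound of the Euclidean norm by the \<open>\<ell>\<^sub>1\<close> norm passes to all other exponents: below \<open>2\<close> by interpolation
  with \<open>\<ell>\<^sub>1\<close>, above \<open>2\<close> because the \<open>\<ell>\<^sub>p\<close> norm is at most the Euclidean norm. That is why one construction
  of functionals serves all \<open>p\<close>.
\<close>
lemma lp_norm_interpolate:
  fixes f :: "'a \<Rightarrow> real"
  assumes p: "1 \<le> p" and S: "finite S" and q: "0 < q" "q \<le> 1"
    and l2: "(\<Sum>x\<in>S. (f x)\<^sup>2) \<le> q * (\<Sum>x\<in>S. \<bar>f x\<bar>)\<^sup>2"
  shows "ell_norm p S f \<le> q powr gelfand_gain p * (\<Sum>x\<in>S. \<bar>f x\<bar>)"
proof -
  define X where "X = (\<Sum>x\<in>S. \<bar>f x\<bar>)"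
  define Y where "Y = sqrt q * X"
  have X0: "0 \<le> X" unfolding X_def by (intro sum_nonneg) auto
  then have Y0: "0 \<le> Y" using q by (auto simp: Y_def)
  have Y2: "(\<Sum>x\<in>S. (f x)\<^sup>2) \<le> Y\<^sup>2" using l2 q by (simp add: Y_def X_def power_mult_distrib)
  have ptY: "\<bar>f x\<bar> \<le> Y" if "x \<in> S" for x
  proof (rule power2_le_imp_le)
    have "(f x)\<^sup>2 \<le> (\<Sum>x\<in>S. (f x)\<^sup>2)" using that S by (intro member_le_sum) auto
    then show "\<bar>f x\<bar>\<^sup>2 \<le> Y\<^sup>2" using Y2 by simp
  qed (rule Y0)
  consider "p = \<infinity>" | r where "p = ereal r" "2 \<le> r" | r where "p = ereal r" "1 \<le> r" "r \<le> 2"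
    using p by (cases p) force+
  then show ?thesis
  proof cases
    case 1
    have "ell_norm \<infinity> S f \<le> Y"
      by (rule lp_inf_leI) (use ptY Y0 in \<open>auto simp: AE_count_space\<close>)
    then show ?thesis using 1 q by (simp add: gelfand_gain_def Y_def X_def powr_half_sqrt)
  next
    case (2 r)
    have gain: "gelfand_gain p = 1 / 2" using 2 by (auto simp: gelfand_gain_def)
    have pt: "\<bar>f x\<bar> powr r \<le> (f x)\<^sup>2 * Y powr (r - 2)" if "x \<in> S" for x
    proof (cases "f x = 0")
      case False
      have "\<bar>f x\<bar> powr r = \<bar>f x\<bar> powr 2 * \<bar>f x\<bar> powr (r - 2)"
        using powr_add[of "\<bar>f x\<bar>" 2 "r - 2"] by simp
      also have "\<dots> \<le> \<bar>f x\<bar> powr 2 * Y powr (r - 2)"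
        using ptY[OF that] 2 by (intro mult_left_mono powr_mono2) auto
      also have "\<bar>f x\<bar> powr 2 = (f x)\<^sup>2" using False by (simp add: powr_numeral)
      finally show ?thesis .
    qed simp
    have "(\<Sum>x\<in>S. \<bar>f x\<bar> powr r) \<le> (\<Sum>x\<in>S. (f x)\<^sup>2 * Y powr (r - 2))"
      by (intro sum_mono pt)
    also have "\<dots> = (\<Sum>x\<in>S. (f x)\<^sup>2) * Y powr (r - 2)" by (simp add: sum_distrib_right)
    also have "\<dots> \<le> Y\<^sup>2 * Y powr (r - 2)" using Y2 by (intro mult_right_mono) auto
    also have "\<dots> = Y powr r"
    proof (cases "Y = 0")
      case False
      then have "Y\<^sup>2 = Y powr 2" using Y0 by (simp add: powr_numeral)
      then show ?thesis using powr_add[of Y 2 "r - 2"] by simp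
    qed simp
    finally have "(\<Sum>x\<in>S. \<bar>f x\<bar> powr r) powr (1 / r) \<le> (Y powr r) powr (1 / r)"
      using 2 by (intro powr_mono2) (auto intro: sum_nonneg)
    also have "\<dots> = Y" using 2 Y0 by (simp add: powr_powr)
    finally show ?thesis unfolding gain using 2 q S by (simp add: lp_norm_finite Y_def X_def powr_half_sqrt)
  next
    case (3 r)
    have gain: "gelfand_gain p = 1 - 1 / r" using 3 by (auto simp: gelfand_gain_def)
    show ?thesis
    proof (cases "X = 0")
      case True
      then have "\<forall>x\<in>S. f x = 0" using S by (simp add: X_def sum_nonneg_eq_0_iff)
      then show ?thesis using 3 S by (simp add: lp_norm_finite)
    next
      case False
      then have X: "0 < X" using X0 by simp
      define Z where "Z = q * X"
      have Z: "0 < Z" using X q by (simp add: Z_def)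
      \<comment> \<open>The tangent of the concave function \<open>t powr (r - 1)\<close> at \<open>Z\<close>, multiplied by \<open>t\<close>.\<close>
      have tangent: "t powr r \<le> Z powr (r - 1) * ((2 - r) * t + (r - 1) * t\<^sup>2 / Z)" if t: "0 \<le> t" for t
      proof (cases "t = 0")
        case False
        then have t: "0 < t" using t by simp
        have "(t / Z) powr (r - 1) * 1 powr (2 - r) \<le> (r - 1) * (t / Z) + (2 - r) * 1"
          using t Z 3 by (intro Youngs_inequality_0) auto
        then have "t * (Z powr (r - 1) * (t / Z) powr (r - 1)) \<le> t * (Z powr (r - 1) * ((r - 1) * (t / Z) + (2 - r)))"
          using t by (intro mult_left_mono) auto
        moreover have "t * (Z powr (r - 1) * (t / Z) powr (r - 1)) = t powr r"
        proof -
          have "Z powr (r - 1) * (t / Z) powr (r - 1) = t powr (r - 1)"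
            using t Z by (subst powr_mult[symmetric]) auto
          then show ?thesis using t powr_mult_base[of t "r - 1"] by simp
        qed
        ultimately show ?thesis by (simp add: algebra_simps power2_eq_square)
      qed simp
      have "(\<Sum>x\<in>S. \<bar>f x\<bar> powr r) \<le> (\<Sum>x\<in>S. Z powr (r - 1) * ((2 - r) * \<bar>f x\<bar> + (r - 1) * \<bar>f x\<bar>\<^sup>2 / Z))"
        by (intro sum_mono tangent) auto
      also have "\<dots> = Z powr (r - 1) * ((2 - r) * X + (r - 1) * (\<Sum>x\<in>S. (f x)\<^sup>2) / Z)"
        by (simp add: X_def sum_distrib_left sum.distrib sum_divide_distrib distrib_left)
      also have "\<dots> \<le> Z powr (r - 1) * ((2 - r) * X + (r - 1) * (Z * X) / Z)"
        using l2 Z 3 by (intro mult_left_mono add_left_mono divide_right_mono)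
          (auto simp: X_def Z_def power2_eq_square algebra_simps)
      also have "(2 - r) * X + (r - 1) * (Z * X) / Z = X" using Z by (simp add: field_simps)
      also have "Z powr (r - 1) * X = q powr (r - 1) * X powr r"
      proof -
        have "Z powr (r - 1) * X = q powr (r - 1) * (X * X powr (r - 1))"
          using X q by (simp add: Z_def powr_mult)
        then show ?thesis using X powr_mult_base[of X "r - 1"] by simp
      qed
      finally have "(\<Sum>x\<in>S. \<bar>f x\<bar> powr r) powr (1 / r) \<le> (q powr (r - 1) * X powr r) powr (1 / r)"
        using 3 by (intro powr_mono2) (auto intro: sum_nonneg)
      also have "\<dots> = q powr (1 - 1 / r) * X"
        using 3 X by (simp add: powr_powr powr_mult diff_divide_distrib)
      finally show ?thesis unfolding gain using 3 S by (simp add: lp_norm_finite X_def)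
    qed
  qed
qed

text \<open>
  The case \<open>q = 1\<close> of the interpolation inequality, whose assumption then says that the Euclidean norm is
  at most the \<open>\<ell>\<^sub>1\<close> norm.
\<close>
lemma lp_norm_le_sum:
  assumes "1 \<le> p" "finite S"
  shows "ell_norm p S f \<le> (\<Sum>x\<in>S. \<bar>f x\<bar>)"
proof -
  have "(\<Sum>x\<in>S. (f x)\<^sup>2) \<le> (\<Sum>x\<in>S. \<bar>f x\<bar> * (\<Sum>x\<in>S. \<bar>f x\<bar>))"
  proof (intro sum_mono)
    fix x assume "x \<in> S"
    then have "\<bar>f x\<bar> \<le> (\<Sum>x\<in>S. \<bar>f x\<bar>)" using assms(2) by (intro member_le_sum) auto
    then have "\<bar>f x\<bar> * \<bar>f x\<bar> \<le> \<bar>f x\<bar> * (\<Sum>x\<in>S. \<bar>f x\<bar>)" by (intro mult_left_mono) auto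
    then show "(f x)\<^sup>2 \<le> \<bar>f x\<bar> * (\<Sum>x\<in>S. \<bar>f x\<bar>)" by (simp add: power2_eq_square)
  qed
  then show ?thesis using lp_norm_interpolate[OF assms, of 1 f]
    by (simp add: sum_distrib_right power2_eq_square)
qed

lemma lp_norm_reindex_finite:
  assumes "1 \<le> p" "finite S" "inj_on h S"
  shows "ell_norm p (h ` S) f = ell_norm p S (\<lambda>x. f (h x))"
proof (cases "p = \<infinity>")
  case True
  have 1: "ell_norm \<infinity> (h ` S) f \<le> ell_norm \<infinity> S (\<lambda>x. f (h x))"
    using lp_count_point[of \<infinity> "\<lambda>x. f (h x)" S] assms(2)
    by (intro lp_inf_leI) (auto simp: AE_count_space lp_norm_nonneg lp_space_finite)
  have 2: "ell_norm \<infinity> S (\<lambda>x. f (h x)) \<le> ell_norm \<infinity> (h ` S) f"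
    using lp_count_point[of \<infinity> f "h ` S"] assms(2)
    by (intro lp_inf_leI) (auto simp: AE_count_space lp_norm_nonneg lp_space_finite)
  show ?thesis using 1 2 True by simp
next
  case False
  then show ?thesis using assms by (simp add: lp_norm_finite sum.reindex)
qed

text \<open>
  A Cauchy sequence converges pointwise, and the bound on finite sets that characterises the norm
  survives the pointwise limit.
\<close>
lemma lp_count_complete:
  fixes u :: "nat \<Rightarrow> 'a \<Rightarrow> real"
  assumes p: "1 \<le> p" and u: "\<And>n. u n \<in> ell_space p A"
    and C: "\<And>e. 0 < e \<Longrightarrow> \<exists>n0. \<forall>m\<ge>n0. \<forall>n\<ge>n0. ell_norm p A (\<lambda>x. u m x - u n x) < e"
  obtains f where "f \<in> ell_space p A" "\<And>x. x \<in> A \<Longrightarrow> (\<lambda>n. u n x) \<longlonglongrightarrow> f x"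
    "\<And>x. x \<notin> A \<Longrightarrow> f x = 0"
    "(\<lambda>n. ell_norm p A (\<lambda>x. u n x - f x)) \<longlonglongrightarrow> 0"
proof -
  have d: "(\<lambda>x. u m x - u n x) \<in> ell_space p A" for m n
    using lp_diff(1)[OF p u u] .
  have conv: "\<exists>l. (\<lambda>n. u n x) \<longlonglongrightarrow> l" if x: "x \<in> A" for x
  proof -
    have "Cauchy (\<lambda>n. u n x)"
    proof (rule metric_CauchyI)
      fix e :: real assume "0 < e"
      then obtain n0 where n0: "\<forall>m\<ge>n0. \<forall>n\<ge>n0. ell_norm p A (\<lambda>x. u m x - u n x) < e"
        using C by blast
      have "dist (u m x) (u n x) < e" if "m \<ge> n0" "n \<ge> n0" for m n
        using lp_count_point[OF p d x, of m n] n0 that by (fastforce simp: dist_real_def)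
      then show "\<exists>n0. \<forall>m\<ge>n0. \<forall>n\<ge>n0. dist (u m x) (u n x) < e" by blast
    qed
    then show ?thesis by (metis Cauchy_convergent convergent_def)
  qed
  define f where "f = (\<lambda>x. if x \<in> A then lim (\<lambda>n. u n x) else 0)"
  have lim: "(\<lambda>n. u n x) \<longlonglongrightarrow> f x" if "x \<in> A" for x
    using conv[OF that] that by (auto simp: f_def limI)
  have key: "(\<lambda>x. u m x - f x) \<in> ell_space p A
      \<and> ell_norm p A (\<lambda>x. u m x - f x) \<le> e"
    if e: "0 < e" and n0: "\<forall>m\<ge>n0. \<forall>n\<ge>n0. ell_norm p A (\<lambda>x. u m x - u n x) < e"
      and m: "m \<ge> n0" for m n0 e
  proof -
    have "ell_norm p S (\<lambda>x. u m x - f x) \<le> e" if S: "finite S" "S \<subseteq> A" for S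
    proof -
      have b: "ell_norm p S (\<lambda>x. u m x - f x)
          \<le> e + (\<Sum>x\<in>S. \<bar>u n x - f x\<bar>)" if "n \<ge> n0" for n
      proof -
        have "ell_norm p S (\<lambda>x. u m x - f x)
            \<le> ell_norm p S (\<lambda>x. u m x - u n x) + ell_norm p S (\<lambda>x. u n x - f x)"
          using lp_add(2)[OF p lp_space_finite lp_space_finite, OF S(1) S(1), of "\<lambda>x. u m x - u n x" "\<lambda>x. u n x - f x"]
          by simp
        moreover have "ell_norm p S (\<lambda>x. u m x - u n x) \<le> e"
          using lp_count_subset(2)[OF p d S(2), of m n] n0 m that by (meson less_imp_le order_trans)
        moreover have "ell_norm p S (\<lambda>x. u n x - f x) \<le> (\<Sum>x\<in>S. \<bar>u n x - f x\<bar>)"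
          by (rule lp_norm_le_sum[OF p S(1)])
        ultimately show ?thesis by (meson add_mono order_trans)
      qed
      have "(\<lambda>n. e + (\<Sum>x\<in>S. \<bar>u n x - f x\<bar>)) \<longlonglongrightarrow> e + (\<Sum>x\<in>S. \<bar>f x - f x\<bar>)"
        using S by (intro tendsto_intros lim) auto
      then show ?thesis
        using b by (intro LIMSEQ_le_const) (auto intro!: exI[of _ n0])
    qed
    then show ?thesis using lp_count_leI[OF p, of e A] e by auto
  qed
  obtain n1 where n1: "\<forall>m\<ge>n1. \<forall>n\<ge>n1. ell_norm p A (\<lambda>x. u m x - u n x) < 1"
    using C[of 1] by auto
  have "(\<lambda>x. u n1 x - (u n1 x - f x)) \<in> ell_space p A"
    by (rule lp_diff(1)[OF p u]) (use key[OF _ n1] in auto)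
  then have "f \<in> ell_space p A" by simp
  moreover have "(\<lambda>n. ell_norm p A (\<lambda>x. u n x - f x)) \<longlonglongrightarrow> 0"
  proof (rule LIMSEQ_I)
    fix e :: real assume e: "0 < e"
    then obtain n0 where n0: "\<forall>m\<ge>n0. \<forall>n\<ge>n0. ell_norm p A (\<lambda>x. u m x - u n x) < e / 2"
      using C[of "e / 2"] by auto
    have "norm (ell_norm p A (\<lambda>x. u n x - f x) - 0) < e" if "n \<ge> n0" for n
      using key[OF _ n0 that] e lp_norm_nonneg[of p "count_space A" "\<lambda>x. u n x - f x"] by simp
    then show "\<exists>n0. \<forall>n\<ge>n0. norm (ell_norm p A (\<lambda>x. u n x - f x) - 0) < e"
      by blast
  qed
  ultimately show ?thesis using that lim by (auto simp: f_def)
qed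

section \<open>Rates of convergence\<close>

lemma rate_nonneg: "0 \<le> rate c"
proof (cases "c \<longlonglongrightarrow> 0")
  case True
  have "(\<lambda>n. c n * ereal (real n powr 0)) \<longlonglongrightarrow> 0"
    by (rule Lim_transform_eventually[OF True eventually_mono[OF eventually_gt_at_top[of 0]]]) simp
  then have "ereal 0 \<le> Sup {ereal \<beta> | \<beta>. 0 \<le> \<beta> \<and> (\<lambda>n. c n * ereal (real n powr \<beta>)) \<longlonglongrightarrow> 0}"
    by (intro Sup_upper) auto
  then show ?thesis using True by (simp add: rate_def zero_ereal_def)
qed (simp add: rate_def)

lemma rate_geI:
  assumes r: "0 < r" and lim: "\<And>\<beta>. 0 \<le> \<beta> \<Longrightarrow> \<beta> < r \<Longrightarrow> (\<lambda>n. c n * ereal (real n powr \<beta>)) \<longlonglongrightarrow> 0"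
  shows "ereal r \<le> rate c"
proof -
  have c: "c \<longlonglongrightarrow> 0"
    by (rule Lim_transform_eventually[OF lim[of 0] eventually_mono[OF eventually_gt_at_top[of 0]]])
      (use r in simp_all)
  have *: "ereal \<beta> \<le> rate c" if "\<beta> < r" "0 \<le> \<beta>" for \<beta>
    using c lim[OF that(2,1)] that by (auto simp: rate_def intro!: Sup_upper)
  show ?thesis
  proof (rule dense_le)
    fix x assume x: "x < ereal r"
    show "x \<le> rate c"
    proof (cases "x \<le> 0")
      case True then show ?thesis using rate_nonneg[of c] by (rule order_trans)
    next
      case False then show ?thesis using x * by (cases x) auto
    qed
  qed
qed

lemma rate_leI:
  assumes "0 \<le> \<rho>" and "\<And>\<beta>. \<rho> < \<beta> \<Longrightarrow> \<not> (\<lambda>n. c n * ereal (real n powr \<beta>)) \<longlonglongrightarrow> 0"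
  shows "rate c \<le> ereal \<rho>"
proof (cases "c \<longlonglongrightarrow> 0")
  case True
  have "Sup {ereal \<beta> | \<beta>. 0 \<le> \<beta> \<and> (\<lambda>n. c n * ereal (real n powr \<beta>)) \<longlonglongrightarrow> 0} \<le> ereal \<rho>"
    using assms(2) by (intro Sup_least) (force simp: not_le[symmetric])
  then show ?thesis using True by (simp add: rate_def)
qed (use assms(1) in \<open>simp add: rate_def\<close>)

lemma rate_geD:
  assumes "ereal \<beta> < rate c" "0 \<le> \<beta>" and c: "\<And>n. 0 \<le> c n"
  shows "(\<lambda>n. c n * ereal (real n powr \<beta>)) \<longlonglongrightarrow> 0"
proof -
  have "c \<longlonglongrightarrow> 0" using assms by (auto simp: rate_def split: if_splits)
  with assms have "ereal \<beta> < Sup {ereal \<beta> | \<beta>. 0 \<le> \<beta> \<and> (\<lambda>n. c n * ereal (real n powr \<beta>)) \<longlonglongrightarrow> 0}"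
    by (simp add: rate_def)
  then obtain \<gamma> where g: "\<beta> < \<gamma>" "(\<lambda>n. c n * ereal (real n powr \<gamma>)) \<longlonglongrightarrow> 0"
    unfolding less_Sup_iff by auto
  show ?thesis
  proof (rule tendsto_sandwich[OF _ _ tendsto_const g(2)])
    show "\<forall>\<^sub>F n in sequentially. 0 \<le> c n * ereal (real n powr \<beta>)" using c by auto
    show "\<forall>\<^sub>F n in sequentially. c n * ereal (real n powr \<beta>) \<le> c n * ereal (real n powr \<gamma>)"
      using g(1) c by (intro eventually_mono[OF eventually_gt_at_top[of 0]] ereal_mult_left_mono)
        (auto intro!: powr_mono)
  qed
qed

lemma tendsto_zero_ereal_bound:
  assumes "\<And>n. 0 \<le> c n" "eventually (\<lambda>n. c n \<le> ereal (d n)) sequentially"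
    "(\<lambda>n. d n * real n powr \<beta>) \<longlonglongrightarrow> 0"
  shows "(\<lambda>n. c n * ereal (real n powr \<beta>)) \<longlonglongrightarrow> 0"
proof (rule tendsto_sandwich[OF _ _ tendsto_const])
  show "\<forall>\<^sub>F n in sequentially. 0 \<le> c n * ereal (real n powr \<beta>)" using assms(1) by auto
  show "\<forall>\<^sub>F n in sequentially. c n * ereal (real n powr \<beta>) \<le> ereal (d n * real n powr \<beta>)"
    using assms(2)
  proof eventually_elim
    case (elim n)
    then have "c n * ereal (real n powr \<beta>) \<le> ereal (d n) * ereal (real n powr \<beta>)"
      by (intro ereal_mult_right_mono) auto
    then show ?case by simp
  qed
  show "(\<lambda>n. ereal (d n * real n powr \<beta>)) \<longlonglongrightarrow> 0" using assms(3)
    using tendsto_ereal[of _ 0] by (simp add: zero_ereal_def)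
qed

section \<open>Minimal errors and kernels of functionals\<close>

context
  fixes p :: ereal and M :: "'a measure" and F N
  assumes p: "1 \<le> p" and adm: "admissible_space p M F N"
begin

lemma space_facts:
  "f \<in> F \<Longrightarrow> x \<notin> space M \<Longrightarrow> f x = 0"
  "(\<lambda>x. 0) \<in> F"
  "f \<in> F \<Longrightarrow> g \<in> F \<Longrightarrow> (\<lambda>x. f x + g x) \<in> F"
  "f \<in> F \<Longrightarrow> (\<lambda>x. c * f x) \<in> F"
  "f \<in> F \<Longrightarrow> 0 \<le> N f"
  "f \<in> F \<Longrightarrow> N f = 0 \<longleftrightarrow> f = (\<lambda>x. 0)"
  "f \<in> F \<Longrightarrow> g \<in> F \<Longrightarrow> N (\<lambda>x. f x + g x) \<le> N f + N g"
  "f \<in> F \<Longrightarrow> N (\<lambda>x. c * f x) = \<bar>c\<bar> * N f"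
  "f \<in> F \<Longrightarrow> f \<in> lp_space p M"
proof -
  have *: "(\<forall>f\<in>F. \<forall>x. x \<notin> space M \<longrightarrow> f x = 0) \<and> (\<lambda>x. 0) \<in> F \<and>
    (\<forall>f\<in>F. \<forall>g\<in>F. (\<lambda>x. f x + g x) \<in> F) \<and> (\<forall>c. \<forall>f\<in>F. (\<lambda>x. c * f x) \<in> F) \<and>
    (\<forall>f\<in>F. 0 \<le> N f) \<and> (\<forall>f\<in>F. N f = 0 \<longleftrightarrow> f = (\<lambda>x. 0)) \<and>
    (\<forall>f\<in>F. \<forall>g\<in>F. N (\<lambda>x. f x + g x) \<le> N f + N g) \<and>
    (\<forall>c. \<forall>f\<in>F. N (\<lambda>x. c * f x) = \<bar>c\<bar> * N f) \<and> F \<subseteq> lp_space p M"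
    using adm unfolding admissible_space_def banach_function_space_def embedded_in_lp_def
    by (elim conjE) (intro conjI; assumption)
  show "f \<in> F \<Longrightarrow> x \<notin> space M \<Longrightarrow> f x = 0" "(\<lambda>x. 0) \<in> F"
    "f \<in> F \<Longrightarrow> g \<in> F \<Longrightarrow> (\<lambda>x. f x + g x) \<in> F" "f \<in> F \<Longrightarrow> (\<lambda>x. c * f x) \<in> F"
    "f \<in> F \<Longrightarrow> 0 \<le> N f" "f \<in> F \<Longrightarrow> N f = 0 \<longleftrightarrow> f = (\<lambda>x. 0)"
    "f \<in> F \<Longrightarrow> g \<in> F \<Longrightarrow> N (\<lambda>x. f x + g x) \<le> N f + N g"
    "f \<in> F \<Longrightarrow> N (\<lambda>x. c * f x) = \<bar>c\<bar> * N f" "f \<in> F \<Longrightarrow> f \<in> lp_space p M"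
    using * by simp_all blast
qed

lemma space_neg: "f \<in> F \<Longrightarrow> (\<lambda>x. - f x) \<in> F" "f \<in> F \<Longrightarrow> N (\<lambda>x. - f x) = N f"
  using space_facts(4)[of f "-1"] space_facts(8)[of f "-1"] by auto

lemma space_diff:
  "f \<in> F \<Longrightarrow> g \<in> F \<Longrightarrow> (\<lambda>x. f x - g x) \<in> F"
  "f \<in> F \<Longrightarrow> g \<in> F \<Longrightarrow> N (\<lambda>x. f x - g x) \<le> N f + N g"
  using space_facts(3)[of f "\<lambda>x. - g x"] space_facts(7)[of f "\<lambda>x. - g x"] space_neg[of g] by auto

lemma Lambda_std_subset: "Lambda_std (space M) \<subseteq> Lambda_all F N"
proof -
  have "\<forall>x\<in>space M. \<exists>C. \<forall>f\<in>F. \<bar>f x\<bar> \<le> C * N f"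
    using adm unfolding admissible_space_def banach_function_space_def by (elim conjE)
  then show ?thesis by (auto simp: Lambda_std_def Lambda_all_def)
qed

lemma Lambda_all_linear:
  assumes "L \<in> Lambda_all F N"
  shows "f \<in> F \<Longrightarrow> L (\<lambda>x. - f x) = - L f"
    and "f \<in> F \<Longrightarrow> g \<in> F \<Longrightarrow> L (\<lambda>x. f x - g x) = L f - L g"
proof -
  have s: "L (\<lambda>x. c * f x) = c * L f" if "f \<in> F" for c f using assms that by (auto simp: Lambda_all_def)
  have a: "L (\<lambda>x. f x + g x) = L f + L g" if "f \<in> F" "g \<in> F" for f g
    using assms that by (auto simp: Lambda_all_def)
  show n: "L (\<lambda>x. - f x) = - L f" if "f \<in> F" for f using s[OF that, of "-1"] by simp
  show "f \<in> F \<Longrightarrow> g \<in> F \<Longrightarrow> L (\<lambda>x. f x - g x) = L f - L g"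
    using a[of f "\<lambda>x. - g x"] n[of g] space_neg(1)[of g] by simp
qed

lemma minimal_error_nonneg: "0 \<le> minimal_error p M F N \<Lambda> n"
  unfolding minimal_error_def
proof (intro INF_greatest)
  fix A :: "('a \<Rightarrow> real) \<Rightarrow> 'a \<Rightarrow> real"
  have "ereal 0 \<le> ereal (lp_norm p M (\<lambda>x. 0 - A (\<lambda>x. 0) x))" using lp_norm_nonneg by simp
  also have "\<dots> \<le> (SUP f \<in> {f \<in> F. N f \<le> 1}. ereal (lp_norm p M (\<lambda>x. f x - A f x)))"
    using space_facts(2) space_facts(6)[of "\<lambda>x. 0"] by (intro SUP_upper) auto
  finally show "0 \<le> (SUP f \<in> {f \<in> F. N f \<le> 1}. ereal (lp_norm p M (\<lambda>x. f x - A f x)))"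
    by (simp only: zero_ereal_def)
qed

text \<open>
  Whatever the adaption, an algorithm that only observes zeros cannot distinguish \<open>f\<close> from \<open>- f\<close>,
  so its error is at least the norm of \<open>f\<close>. The functionals in question are those chosen along the
  path on which every observation is zero.
\<close>
lemma kernel_bound_of_minimal_error:
  assumes \<Lambda>: "\<Lambda> \<subseteq> Lambda_all F N" and e: "minimal_error p M F N \<Lambda> n < ereal e"
  obtains Ls where "length Ls = n" "set Ls \<subseteq> \<Lambda>"
    "\<And>f. f \<in> F \<Longrightarrow> N f \<le> 1 \<Longrightarrow> \<forall>L\<in>set Ls. L f = 0 \<Longrightarrow> lp_norm p M f < e"
proof -
  obtain A where A: "A \<in> algorithms p M \<Lambda> n"
    and Ae: "(SUP f \<in> {f \<in> F. N f \<le> 1}. ereal (lp_norm p M (\<lambda>x. f x - A f x))) < ereal e"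
    using e unfolding minimal_error_def INF_less_iff by blast
  obtain \<phi> sel where Adef: "A = (\<lambda>f. \<phi> (information sel n f))"
    and \<phi>: "\<And>ys. length ys = n \<Longrightarrow> \<phi> ys \<in> lp_space p M"
    and sel: "\<And>ys. length ys < n \<Longrightarrow> sel ys \<in> \<Lambda>"
    using A by (auto simp: algorithms_def)
  define Ls where "Ls = map (\<lambda>j. sel (replicate j 0)) [0..<n]"
  have info: "information sel m f = replicate m 0"
    if "m \<le> n" "\<forall>L\<in>set Ls. L f = 0" for f m
    using that
  proof (induction m)
    case (Suc m)
    then have "sel (replicate m 0) \<in> set Ls" by (auto simp: Ls_def)
    then have "sel (replicate m 0) f = 0" using Suc.prems(2) by blast
    then show ?case using Suc by (simp add: replicate_append_same)
  qed simp
  have sub: "set Ls \<subseteq> \<Lambda>" using sel by (auto simp: Ls_def)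
  have "lp_norm p M f < e" if f: "f \<in> F" "N f \<le> 1" "\<forall>L\<in>set Ls. L f = 0" for f
  proof -
    define h where "h = \<phi> (replicate n 0)"
    have h: "h \<in> lp_space p M" by (simp add: h_def \<phi>)
    have L': "\<forall>L\<in>set Ls. L (\<lambda>x. - f x) = 0"
    proof
      fix L assume L: "L \<in> set Ls"
      have "L \<in> Lambda_all F N" "L f = 0" using L f(3) sub \<Lambda> by auto
      then show "L (\<lambda>x. - f x) = 0" using Lambda_all_linear(1)[OF _ f(1), of L] by simp
    qed
    have Af: "A f = h" "A (\<lambda>x. - f x) = h"
      using info[of n f] info[of n "\<lambda>x. - f x"] f(3) L' by (simp_all add: Adef h_def)
    have up: "lp_norm p M (\<lambda>x. g x - A g x) < e" if "g \<in> F" "N g \<le> 1" for g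
    proof -
      have "ereal (lp_norm p M (\<lambda>x. g x - A g x)) < ereal e"
        by (rule order_le_less_trans[OF SUP_upper Ae]) (use that in simp)
      then show ?thesis by simp
    qed
    have b: "lp_norm p M (\<lambda>x. f x - h x) < e" "lp_norm p M (\<lambda>x. - f x - h x) < e"
      using up[OF f(1,2)] up[of "\<lambda>x. - f x"] space_neg[OF f(1)] f(2) Af by auto
    have "2 * lp_norm p M f = lp_norm p M (\<lambda>x. 2 * f x)"
      using lp_scale(2)[OF p space_facts(9)[OF f(1)], of 2] by simp
    also have "(\<lambda>x. 2 * f x) = (\<lambda>x. (f x - h x) - (- f x - h x))" by auto
    also have "lp_norm p M \<dots> \<le> lp_norm p M (\<lambda>x. f x - h x) + lp_norm p M (\<lambda>x. - f x - h x)"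
      using f(1) h space_neg(1)[OF f(1)] by (intro lp_diff p) (auto intro: space_facts(9))
    finally show ?thesis using b by linarith
  qed
  then show ?thesis using that[of Ls] sub by (simp add: Ls_def)
qed

text \<open>
  Conversely, a nonadaptive algorithm may return any element of the unit ball that is consistent
  with the observations; the difference to \<open>f\<close> lies in the kernel and in twice the unit ball.
\<close>
lemma minimal_error_of_kernel_bound:
  assumes \<Lambda>: "\<Lambda> \<subseteq> Lambda_all F N" and Ls: "length Ls = n" "set Ls \<subseteq> \<Lambda>"
    and bound: "\<And>f. f \<in> F \<Longrightarrow> N f \<le> 2 \<Longrightarrow> \<forall>L\<in>set Ls. L f = 0 \<Longrightarrow> lp_norm p M f \<le> e"
  shows "minimal_error p M F N \<Lambda> n \<le> ereal e"
proof -
  define \<phi> where "\<phi> = (\<lambda>ys. if \<exists>g\<in>F. N g \<le> 1 \<and> map (\<lambda>L. L g) Ls = ys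
     then SOME g. g \<in> F \<and> N g \<le> 1 \<and> map (\<lambda>L. L g) Ls = ys else (\<lambda>x. 0))"
  define sel where "sel = (\<lambda>ys :: real list. Ls ! length ys)"
  have \<phi>: "\<phi> ys \<in> F \<and> N (\<phi> ys) \<le> 1 \<and> map (\<lambda>L. L (\<phi> ys)) Ls = ys"
    if "\<exists>g\<in>F. N g \<le> 1 \<and> map (\<lambda>L. L g) Ls = ys" for ys
    using that someI_ex[of "\<lambda>g. g \<in> F \<and> N g \<le> 1 \<and> map (\<lambda>L. L g) Ls = ys"] unfolding \<phi>_def by auto
  have "information sel m f = map (\<lambda>L. L f) (take m Ls)" if "m \<le> n" for m f
    using that by (induction m) (auto simp: sel_def Ls take_Suc_conv_app_nth)
  then have info: "information sel n f = map (\<lambda>L. L f) Ls" for f using Ls(1) by simp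
  have "(\<lambda>f. \<phi> (information sel n f)) \<in> algorithms p M \<Lambda> n"
    unfolding algorithms_def
  proof (rule CollectI, intro exI[of _ \<phi>] exI[of _ sel] conjI refl allI impI)
    fix ys :: "real list"
    show "\<phi> ys \<in> lp_space p M"
    proof (cases "\<exists>g\<in>F. N g \<le> 1 \<and> map (\<lambda>L. L g) Ls = ys")
      case True then show ?thesis using \<phi> space_facts(9) by blast
    next
      case False
      then have "\<phi> ys = (\<lambda>x. 0)" unfolding \<phi>_def by (rule if_not_P)
      then show ?thesis using lp_zero(1)[OF p] by simp
    qed
    show "sel ys \<in> \<Lambda>" if "length ys < n"
      using Ls that nth_mem[of "length ys" Ls] by (auto simp: sel_def)
  qed
  then have "minimal_error p M F N \<Lambda> n \<le>
      (SUP f \<in> {f \<in> F. N f \<le> 1}. ereal (lp_norm p M (\<lambda>x. f x - \<phi> (information sel n f) x)))"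
    unfolding minimal_error_def by (rule INF_lower)
  also have "\<dots> \<le> ereal e"
  proof (intro SUP_least)
    fix f assume "f \<in> {f \<in> F. N f \<le> 1}"
    then have f: "f \<in> F" "N f \<le> 1" by auto
    define g where "g = \<phi> (map (\<lambda>L. L f) Ls)"
    have g: "g \<in> F" "N g \<le> 1" "map (\<lambda>L. L g) Ls = map (\<lambda>L. L f) Ls"
      using \<phi>[of "map (\<lambda>L. L f) Ls"] f by (auto simp: g_def)
    have "lp_norm p M (\<lambda>x. f x - g x) \<le> e"
    proof (rule bound)
      show "N (\<lambda>x. f x - g x) \<le> 2" using space_diff(2)[OF f(1) g(1)] f g by linarith
      show "\<forall>L\<in>set Ls. L (\<lambda>x. f x - g x) = 0"
      proof
        fix L assume L: "L \<in> set Ls"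
        have "L \<in> Lambda_all F N" "L g = L f" using L Ls(2) \<Lambda> g(3) by auto
        then show "L (\<lambda>x. f x - g x) = 0" using Lambda_all_linear(2)[of L f g] f(1) g(1) by simp
      qed
    qed (rule space_diff(1)[OF f(1) g(1)])
    then show "ereal (lp_norm p M (\<lambda>x. f x - \<phi> (information sel n f) x)) \<le> ereal e"
      by (simp add: info g_def)
  qed
  finally show ?thesis .
qed

end

section \<open>Random signs whose common kernel contains no concentrated vectors\<close>

text \<open>
  Sign vectors are encoded by the set \<open>T\<close> of the positions of the positive signs, so that an average over
  all sign vectors is a sum over \<open>Pow S\<close>.
\<close>
definition sign_sum :: "'a set \<Rightarrow> 'a set \<Rightarrow> ('a \<Rightarrow> real) \<Rightarrow> real" where
  "sign_sum S T x = (\<Sum>i\<in>S. (if i \<in> T then 1 else - 1) * x i)"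

abbreviation sq_sum :: "'a set \<Rightarrow> ('a \<Rightarrow> real) \<Rightarrow> real" where
  "sq_sum S x \<equiv> (\<Sum>i\<in>S. (x i)\<^sup>2)"

abbreviation energy :: "nat \<Rightarrow> 'a set \<Rightarrow> (nat \<Rightarrow> 'a set) \<Rightarrow> ('a \<Rightarrow> real) \<Rightarrow> real" where
  "energy n S T x \<equiv> (\<Sum>k<n. (sign_sum S (T k) x)\<^sup>2)"

lemma sum_Pow_insert:
  assumes "finite S" "b \<notin> S"
  shows "(\<Sum>T\<in>Pow (insert b S). h T) = (\<Sum>T\<in>Pow S. h T + h (insert b T) :: real)"
proof -
  have "inj_on (insert b) (Pow S)" using assms(2) by (auto simp: inj_on_def)
  then show ?thesis using assms
    by (subst Pow_insert, subst sum.union_disjoint) (auto simp: sum.reindex sum.distrib)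
qed

lemma sign_sum_insert:
  assumes "finite S" "b \<notin> S" "T \<subseteq> S"
  shows "sign_sum (insert b S) T x = sign_sum S T x - x b"
    and "sign_sum (insert b S) (insert b T) x = sign_sum S T x + x b"
proof -
  have "(\<Sum>i\<in>S. (if i \<in> insert b T then 1 else - 1) * x i) = (\<Sum>i\<in>S. (if i \<in> T then 1 else - 1) * x i)"
    using assms by (intro sum.cong) auto
  then show "sign_sum (insert b S) T x = sign_sum S T x - x b"
    "sign_sum (insert b S) (insert b T) x = sign_sum S T x + x b"
    using assms by (auto simp: sign_sum_def)
qed

lemma sign_sum_moment2:
  assumes "finite S"
  shows "(\<Sum>T\<in>Pow S. (sign_sum S T x)\<^sup>2) = 2 ^ card S * sq_sum S x"
  using assms
proof (induction S)
  case (insert b S)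
  have "(\<Sum>T\<in>Pow (insert b S). (sign_sum (insert b S) T x)\<^sup>2)
      = (\<Sum>T\<in>Pow S. (sign_sum S T x - x b)\<^sup>2 + (sign_sum S T x + x b)\<^sup>2)"
    using insert by (subst sum_Pow_insert) (auto simp: sign_sum_insert intro!: sum.cong)
  also have "\<dots> = (\<Sum>T\<in>Pow S. 2 * (sign_sum S T x)\<^sup>2 + 2 * (x b)\<^sup>2)"
    by (intro sum.cong) (auto simp: power2_eq_square algebra_simps)
  also have "\<dots> = 2 * (2 ^ card S * sq_sum S x) + 2 * 2 ^ card S * (x b)\<^sup>2"
    using insert by (simp add: sum.distrib card_Pow flip: sum_distrib_left)
  finally show ?case using insert by (simp add: algebra_simps)
qed (simp add: sign_sum_def)

text \<open>
  The constant \<open>3\<close> is the fourth moment of a Gaussian variable; it reproduces itself when one sign is added,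
  since the mixed term has the coefficient \<open>6\<close>.
\<close>
lemma sign_sum_moment4:
  assumes "finite S"
  shows "(\<Sum>T\<in>Pow S. (sign_sum S T x) ^ 4) \<le> 3 * 2 ^ card S * (sq_sum S x)\<^sup>2"
  using assms
proof (induction S)
  case (insert b S)
  let ?s = "\<Sum>i\<in>S. (x i)\<^sup>2" and ?D = "\<lambda>T. sign_sum S T x"
  have "(\<Sum>T\<in>Pow (insert b S). (sign_sum (insert b S) T x) ^ 4)
      = (\<Sum>T\<in>Pow S. (?D T - x b) ^ 4 + (?D T + x b) ^ 4)"
    using insert by (subst sum_Pow_insert) (auto simp: sign_sum_insert intro!: sum.cong)
  also have "\<dots> = (\<Sum>T\<in>Pow S. 2 * ?D T ^ 4 + 12 * (x b)\<^sup>2 * (?D T)\<^sup>2 + 2 * x b ^ 4)"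
    by (intro sum.cong) (auto simp: eval_nat_numeral algebra_simps)
  also have "\<dots> = 2 * (\<Sum>T\<in>Pow S. ?D T ^ 4) + 12 * (x b)\<^sup>2 * (\<Sum>T\<in>Pow S. (?D T)\<^sup>2) + 2 * 2 ^ card S * x b ^ 4"
    using insert by (simp add: sum.distrib card_Pow sum_distrib_left)
  also have "\<dots> \<le> 2 * (3 * 2 ^ card S * ?s\<^sup>2) + 12 * (x b)\<^sup>2 * (2 ^ card S * ?s) + 6 * 2 ^ card S * x b ^ 4"
    using insert by (intro add_mono mult_left_mono) (auto simp: sign_sum_moment2)
  also have "\<dots> = 3 * 2 ^ card (insert b S) * ((x b)\<^sup>2 + ?s)\<^sup>2"
    using insert by (simp add: eval_nat_numeral algebra_simps)
  finally show ?case using insert by simp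
qed (simp add: sign_sum_def)

lemma exp_minus_le_quadratic: "0 \<le> z \<Longrightarrow> exp (- z) \<le> 1 - z + z\<^sup>2 / 2" for z :: real
proof -
  assume z: "0 \<le> z"
  obtain t where "exp (- z) = (\<Sum>m<3. (- z) ^ m / fact m) + exp t / fact 3 * (- z) ^ 3"
    using Maclaurin_exp_le[of "- z" 3] by auto
  moreover have "exp t / fact 3 * (- z) ^ 3 \<le> 0"
    using z by (auto simp: power3_eq_cube intro!: mult_nonneg_nonpos)
  ultimately show ?thesis by (simp add: eval_nat_numeral)
qed

text \<open>
  Second and fourth moments suffice for the lower tail, because \<open>exp (- z)\<close> lies below its quadratic Taylor
  polynomial for \<open>z \<ge> 0\<close>. With a third of the square of the sign sum for \<open>z\<close>, the bound is \<open>1 - 1 / 3 + 3 / 18 = 5 / 6\<close>, the smallest value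
  that the two moments give.
\<close>
lemma sign_sum_laplace:
  assumes S: "finite S" and n: "sq_sum S x = 1"
  shows "(\<Sum>T\<in>Pow S. exp (- ((sign_sum S T x)\<^sup>2 / 3))) \<le> 2 ^ card S * (5 / 6)"
proof -
  have "(\<Sum>T\<in>Pow S. exp (- ((sign_sum S T x)\<^sup>2 / 3)))
      \<le> (\<Sum>T\<in>Pow S. 1 - (sign_sum S T x)\<^sup>2 / 3 + ((sign_sum S T x)\<^sup>2 / 3)\<^sup>2 / 2)"
    by (intro sum_mono exp_minus_le_quadratic) auto
  also have "\<dots> = 2 ^ card S - (\<Sum>T\<in>Pow S. (sign_sum S T x)\<^sup>2) / 3 + (\<Sum>T\<in>Pow S. (sign_sum S T x) ^ 4) / 18"
    using S by (simp add: sum.distrib sum_subtractf card_Pow power_divide sum_divide_distrib)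
  also have "\<dots> \<le> 2 ^ card S * (5 / 6)"
    using sign_sum_moment4[OF S, of x] n by (simp add: sign_sum_moment2[OF S])
  finally show ?thesis .
qed

lemma exists_sign_vector:
  assumes S: "finite S" and Y: "finite Y" and c: "\<And>y. y \<in> Y \<Longrightarrow> 0 \<le> c y"
    and n: "\<forall>y\<in>Y. sq_sum S (v y) = 1"
  obtains T where "T \<subseteq> S" "(\<Sum>y\<in>Y. c y * exp (- ((sign_sum S T (v y))\<^sup>2 / 3))) \<le> 5 / 6 * (\<Sum>y\<in>Y. c y)"
proof (rule ccontr)
  note found = that
  assume "\<not> thesis"
  then have *: "5 / 6 * (\<Sum>y\<in>Y. c y) < (\<Sum>y\<in>Y. c y * exp (- ((sign_sum S T (v y))\<^sup>2 / 3)))" if "T \<subseteq> S" for T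
    using that found by (meson not_le)
  have "(\<Sum>T\<in>Pow S. 5 / 6 * (\<Sum>y\<in>Y. c y))
      < (\<Sum>T\<in>Pow S. \<Sum>y\<in>Y. c y * exp (- ((sign_sum S T (v y))\<^sup>2 / 3)))"
    using S by (intro sum_strict_mono *) auto
  also have "\<dots> = (\<Sum>y\<in>Y. c y * (\<Sum>T\<in>Pow S. exp (- ((sign_sum S T (v y))\<^sup>2 / 3))))"
    by (subst sum.swap) (simp add: sum_distrib_left)
  also have "\<dots> \<le> (\<Sum>y\<in>Y. c y * (2 ^ card S * (5 / 6)))"
    using n by (intro sum_mono mult_left_mono sign_sum_laplace S c) auto
  also have "\<dots> = 2 ^ card S * (5 / 6) * (\<Sum>y\<in>Y. c y)"
    unfolding sum_distrib_right[symmetric] by (rule mult.commute)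
  finally show False using S by (simp add: card_Pow)
qed

text \<open>
  Instead of a probability space of \<open>n\<close> independent sign vectors, the vectors are chosen one after the
  other, each of them at least as good as the average for the potential that the earlier ones have left.
\<close>
lemma exists_sign_vectors:
  assumes S: "finite S" and Y: "finite Y" and n: "\<forall>y\<in>Y. sq_sum S (v y) = 1"
  shows "\<exists>T. (\<forall>k. T k \<subseteq> S) \<and>
    (\<Sum>y\<in>Y. exp (- (energy n S T (v y) / 3))) \<le> (5 / 6) ^ n * card Y"
proof (induction n)
  case 0
  show ?case by (intro exI[of _ "\<lambda>k. {}"]) auto
next
  case (Suc n)
  then obtain T where T: "\<And>k. T k \<subseteq> S"
    "(\<Sum>y\<in>Y. exp (- (energy n S T (v y) / 3))) \<le> (5 / 6) ^ n * card Y" by auto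
  let ?c = "\<lambda>y. exp (- (energy n S T (v y) / 3))"
  obtain T' where T': "T' \<subseteq> S"
    "(\<Sum>y\<in>Y. ?c y * exp (- ((sign_sum S T' (v y))\<^sup>2 / 3))) \<le> 5 / 6 * (\<Sum>y\<in>Y. ?c y)"
    using exists_sign_vector[OF S Y, of ?c v] n by auto
  let ?T = "T(n := T')"
  have "(\<Sum>y\<in>Y. exp (- ((\<Sum>k<Suc n. (sign_sum S (?T k) (v y))\<^sup>2) / 3)))
      = (\<Sum>y\<in>Y. ?c y * exp (- ((sign_sum S T' (v y))\<^sup>2 / 3)))"
    by (intro sum.cong) (auto simp: exp_add[symmetric] add_divide_distrib)
  also have "\<dots> \<le> 5 / 6 * ((5 / 6) ^ n * card Y)" using T'(2) T(2) by linarith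
  finally show ?case using T(1) T'(1) by (intro exI[of _ ?T]) auto
qed

text \<open>
  A vector \<open>y\<close> that violates the bound would contribute at least \<open>exp (- n / 12)\<close> to the potential. Since
  \<open>exp (1 / 12) \<le> 12 / 11\<close>, this exceeds \<open>(5 / 6) ^ n\<close> at least by the factor \<open>(11 / 10) ^ n\<close>, which is more than the number
  of vectors.
\<close>
lemma sign_vectors_lower_bound:
  assumes S: "finite S" and Y: "finite Y" and small: "card Y * (10 / 11) ^ n < (1 :: real)"
  obtains T where "\<And>k. T k \<subseteq> S"
    "\<And>y. y \<in> Y \<Longrightarrow> 0 < sq_sum S y \<Longrightarrow>
      real n / 4 * sq_sum S y < energy n S T y"
proof -
  define Y' where "Y' = {y \<in> Y. 0 < sq_sum S y}"
  define s where "s y = sqrt (sq_sum S y)" for y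
  define v where "v y = (\<lambda>i. y i / s y)" for y
  have s: "s y > 0" "(s y)\<^sup>2 = sq_sum S y" if "y \<in> Y'" for y
    using that by (auto simp: Y'_def s_def)
  have n1: "\<forall>y\<in>Y'. sq_sum S (v y) = 1"
    using s by (simp add: v_def power_divide Y'_def flip: sum_divide_distrib)
  have Y': "finite Y'" "card Y' \<le> card Y" using Y by (auto simp: Y'_def intro: card_mono)
  obtain T where T: "\<And>k. T k \<subseteq> S"
    "(\<Sum>y\<in>Y'. exp (- (energy n S T (v y) / 3))) \<le> (5 / 6) ^ n * card Y'"
    using exists_sign_vectors[OF S Y'(1) n1] by blast
  have "real n / 4 * sq_sum S y < energy n S T y" if y: "y \<in> Y'" for y
  proof (rule ccontr)
    assume neg: "\<not> ?thesis"
    have "sign_sum S U (v y) = sign_sum S U y / s y" for U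
      by (simp add: sign_sum_def v_def sum_divide_distrib)
    then have eq: "energy n S T (v y) = energy n S T y / (s y)\<^sup>2"
      by (simp add: power_divide sum_divide_distrib)
    then have "energy n S T (v y) \<le> real n / 4"
    proof -
      have "energy n S T y \<le> real n / 4 * (s y)\<^sup>2" using neg s[OF y] by simp
      then show ?thesis using s(1)[OF y] eq by (simp add: pos_divide_le_eq)
    qed
    then have "exp (- (real n / 12)) \<le> exp (- (energy n S T (v y) / 3))" by simp
    also have "\<dots> \<le> (\<Sum>y\<in>Y'. exp (- (energy n S T (v y) / 3)))"
      using y Y' by (intro member_le_sum) auto
    also have "\<dots> \<le> (5 / 6) ^ n * card Y" using Y'(2)
      by (intro order_trans[OF T(2)] mult_left_mono) auto
    finally have *: "exp (- (real n / 12)) \<le> (5 / 6) ^ n * card Y" .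
    have "(11 / 12 :: real) ^ n \<le> exp (- (1 / 12)) ^ n"
      using exp_ge_add_one_self[of "- (1 / 12) :: real"] by (intro power_mono) auto
    also have "\<dots> = exp (- (real n / 12))" by (simp flip: exp_of_nat_mult)
    finally have "(11 / 12) ^ n \<le> (5 / 6) ^ n * real (card Y)" using * by linarith
    then have "1 \<le> (5 / 6) ^ n * real (card Y) / (11 / 12) ^ n" by (simp add: le_divide_eq)
    also have "\<dots> = card Y * ((5 / 6) / (11 / 12)) ^ n" unfolding power_divide by simp
    finally show False using small by simp
  qed
  then show ?thesis using that[of T] T(1) by (auto simp: Y'_def)
qed

text \<open>
  The sums of \<open>m\<close> unit vectors with signs, repetitions allowed. Scaled by \<open>1 / m\<close>, they are the values of
  the empirical averages in Maurey's method.
\<close>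
primrec signed_unit_sums :: "'a set \<Rightarrow> nat \<Rightarrow> ('a \<Rightarrow> real) set" where
  "signed_unit_sums S 0 = {\<lambda>i. 0}"
| "signed_unit_sums S (Suc m) = (\<lambda>(v, i, \<sigma>). v(i := v i + \<sigma>)) ` (signed_unit_sums S m \<times> S \<times> {1, - 1})"

lemma signed_unit_sums_finite:
  assumes "finite S"
  shows "finite (signed_unit_sums S m)" "card (signed_unit_sums S m) \<le> (2 * card S) ^ m"
proof -
  have "finite (signed_unit_sums S m) \<and> card (signed_unit_sums S m) \<le> (2 * card S) ^ m"
  proof (induction m)
    case (Suc m)
    have "card (signed_unit_sums S (Suc m)) \<le> card (signed_unit_sums S m \<times> S \<times> {1, - 1 :: real})"
      unfolding signed_unit_sums.simps by (rule card_image_le) (use Suc assms in auto)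
    also have "\<dots> = card (signed_unit_sums S m) * (card S * 2)" by (simp add: card_cartesian_product)
    also have "\<dots> \<le> (2 * card S) ^ m * (card S * 2)" using Suc by (intro mult_right_mono) auto
    finally show ?case using Suc assms by (simp add: mult.commute)
  qed simp
  then show "finite (signed_unit_sums S m)" "card (signed_unit_sums S m) \<le> (2 * card S) ^ m" by auto
qed

text \<open>
  A random signed unit vector that picks \<open>i\<close> with probability \<open>\<bar>x i\<bar>\<close> has the mean \<open>x\<close>. Adding such a vector
  minus its mean to \<open>w\<close> increases the expected square of the norm by at most its variance, so some choice
  does so. The rows \<open>a j\<close> define the Euclidean seminorm in which the distance is measured.
\<close>
lemma maurey_step:
  fixes a :: "'j \<Rightarrow> 'a \<Rightarrow> real"
  assumes S: "finite S" and J: "finite J" and D: "\<forall>i\<in>S. (\<Sum>j\<in>J. (a j i)\<^sup>2) \<le> D"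
    and x: "(\<Sum>i\<in>S. \<bar>x i\<bar>) = 1"
  obtains i where "i \<in> S" "x i \<noteq> 0"
    "(\<Sum>j\<in>J. (w j + sgn (x i) * a j i - (\<Sum>i\<in>S. a j i * x i))\<^sup>2) \<le> (\<Sum>j\<in>J. (w j)\<^sup>2) + D"
proof (rule ccontr)
  note found = that
  assume neg: "\<not> thesis"
  define l where "l j = (\<Sum>i\<in>S. a j i * x i)" for j
  let ?q = "\<lambda>i. \<Sum>j\<in>J. (w j + sgn (x i) * a j i - l j)\<^sup>2"
  have gt: "(\<Sum>j\<in>J. (w j)\<^sup>2) + D < ?q i" if "i \<in> S" "x i \<noteq> 0" for i
    using neg that found unfolding l_def by (meson not_le)
  have ex: "\<exists>i\<in>S. x i \<noteq> 0" using x by (metis (mono_tags, lifting) abs_zero sum.neutral zero_neq_one)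
  have "(\<Sum>j\<in>J. (w j)\<^sup>2) + D = (\<Sum>i\<in>S. \<bar>x i\<bar> * ((\<Sum>j\<in>J. (w j)\<^sup>2) + D))"
    using x by (simp flip: sum_distrib_right)
  also have "\<dots> < (\<Sum>i\<in>S. \<bar>x i\<bar> * ?q i)"
  proof -
    obtain i where i: "i \<in> S" "x i \<noteq> 0" using ex by blast
    show ?thesis
    proof (rule sum_strict_mono_ex1[OF S])
      show "\<forall>i\<in>S. \<bar>x i\<bar> * ((\<Sum>j\<in>J. (w j)\<^sup>2) + D) \<le> \<bar>x i\<bar> * ?q i"
      proof
        fix i assume "i \<in> S"
        then show "\<bar>x i\<bar> * ((\<Sum>j\<in>J. (w j)\<^sup>2) + D) \<le> \<bar>x i\<bar> * ?q i"
          using gt[of i] by (cases "x i = 0") (auto intro!: mult_left_mono)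
      qed
      show "\<exists>i\<in>S. \<bar>x i\<bar> * ((\<Sum>j\<in>J. (w j)\<^sup>2) + D) < \<bar>x i\<bar> * ?q i"
        using i gt[OF i] by (intro bexI[of _ i]) auto
    qed
  qed
  also have "\<dots> = (\<Sum>j\<in>J. \<Sum>i\<in>S. \<bar>x i\<bar> * (w j + sgn (x i) * a j i - l j)\<^sup>2)"
    unfolding sum_distrib_left by (rule sum.swap)
  also have "\<dots> \<le> (\<Sum>j\<in>J. (w j)\<^sup>2 + (\<Sum>i\<in>S. \<bar>x i\<bar> * (a j i)\<^sup>2))"
  proof (intro sum_mono)
    fix j
    have "(\<Sum>i\<in>S. \<bar>x i\<bar> * (w j + sgn (x i) * a j i - l j)\<^sup>2)
      = (\<Sum>i\<in>S. \<bar>x i\<bar> * (w j - l j)\<^sup>2 + 2 * (w j - l j) * (a j i * x i) + \<bar>x i\<bar> * (a j i)\<^sup>2)"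
      by (intro sum.cong refl) (auto simp: sgn_if abs_if power2_eq_square algebra_simps)
    also have "\<dots> = (w j - l j)\<^sup>2 + 2 * (w j - l j) * l j + (\<Sum>i\<in>S. \<bar>x i\<bar> * (a j i)\<^sup>2)"
      using x by (simp add: sum.distrib l_def flip: sum_distrib_left sum_distrib_right)
    also have "(w j - l j)\<^sup>2 + 2 * (w j - l j) * l j = (w j)\<^sup>2 - (l j)\<^sup>2"
      by (simp add: power2_eq_square algebra_simps)
    finally show "(\<Sum>i\<in>S. \<bar>x i\<bar> * (w j + sgn (x i) * a j i - l j)\<^sup>2)
        \<le> (w j)\<^sup>2 + (\<Sum>i\<in>S. \<bar>x i\<bar> * (a j i)\<^sup>2)" by simp
  qed
  also have "\<dots> = (\<Sum>j\<in>J. (w j)\<^sup>2) + (\<Sum>i\<in>S. \<bar>x i\<bar> * (\<Sum>j\<in>J. (a j i)\<^sup>2))"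
    by (simp add: sum.distrib sum_distrib_left sum.swap[of _ S])
  also have "(\<Sum>i\<in>S. \<bar>x i\<bar> * (\<Sum>j\<in>J. (a j i)\<^sup>2)) \<le> (\<Sum>i\<in>S. \<bar>x i\<bar> * D)"
    using D by (intro sum_mono mult_left_mono) auto
  also have "\<dots> = D" using x by (simp flip: sum_distrib_right)
  finally show False by simp
qed

lemma maurey_approximation:
  fixes a :: "'j \<Rightarrow> 'a \<Rightarrow> real"
  assumes S: "finite S" and J: "finite J" and D: "\<forall>i\<in>S. (\<Sum>j\<in>J. (a j i)\<^sup>2) \<le> D"
    and x: "(\<Sum>i\<in>S. \<bar>x i\<bar>) = 1"
  shows "\<exists>v\<in>signed_unit_sums S m. (\<Sum>j\<in>J. (\<Sum>i\<in>S. a j i * (v i - m * x i))\<^sup>2) \<le> m * D"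
proof (induction m)
  case (Suc m)
  then obtain v where v: "v \<in> signed_unit_sums S m"
    "(\<Sum>j\<in>J. (\<Sum>i\<in>S. a j i * (v i - m * x i))\<^sup>2) \<le> m * D" by blast
  let ?w = "\<lambda>j. \<Sum>i\<in>S. a j i * (v i - m * x i)"
  obtain i where i: "i \<in> S" "x i \<noteq> 0"
    "(\<Sum>j\<in>J. (?w j + sgn (x i) * a j i - (\<Sum>i\<in>S. a j i * x i))\<^sup>2) \<le> (\<Sum>j\<in>J. (?w j)\<^sup>2) + D"
    using maurey_step[OF S J D x, where w = ?w] by blast
  let ?v = "v(i := v i + sgn (x i))"
  have eq: "(\<Sum>k\<in>S. a j k * (?v k - Suc m * x k)) = ?w j + sgn (x i) * a j i - (\<Sum>i\<in>S. a j i * x i)" for j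
  proof -
    have "(\<Sum>k\<in>S. a j k * (?v k - Suc m * x k))
        = (\<Sum>k\<in>S. a j k * (v k - m * x k) + (if k = i then sgn (x i) * a j i else 0) - a j k * x k)"
      by (intro sum.cong) (auto simp: algebra_simps)
    then show ?thesis using S i(1) by (simp add: sum.distrib sum_subtractf)
  qed
  have "(v, i, sgn (x i)) \<in> signed_unit_sums S m \<times> S \<times> {1, - 1}"
    using v(1) i(1,2) by (auto simp: sgn_if)
  then have "?v \<in> signed_unit_sums S (Suc m)" by (force simp only: signed_unit_sums.simps)
  moreover have "(\<Sum>j\<in>J. (\<Sum>k\<in>S. a j k * (?v k - Suc m * x k))\<^sup>2) \<le> m * D + D"
    unfolding eq using i(3) v(2) by linarith
  then have "(\<Sum>j\<in>J. (\<Sum>k\<in>S. a j k * (?v k - Suc m * x k))\<^sup>2) \<le> Suc m * D"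
    by (simp add: algebra_simps)
  ultimately show ?case by blast
qed simp

text \<open>
  Let \<open>x\<close> lie in the kernel and have \<open>\<ell>\<^sub>1\<close> norm \<open>1\<close>. Maurey's method approximates \<open>m * x\<close> by a member \<open>v\<close> of a
  finite set of vectors, at the same time in the Euclidean norm and in the seminorm given by the sign
  vectors. As \<open>x\<close> is in the kernel, \<open>v\<close> is small in this seminorm. The sign vectors were chosen such that
  no nonzero member of the finite set is much smaller in the seminorm than in the Euclidean norm. So \<open>v\<close> is
  small in the Euclidean norm, and with it \<open>x\<close>.
\<close>
lemma exists_signs_with_flat_kernel:
  fixes S :: "'a set"
  assumes S: "finite S" and m: "1 \<le> m" and n: "1 \<le> n"
    and small: "real (2 * card S) ^ m * (10 / 11) ^ n < 1"
  obtains T where "\<And>k. T k \<subseteq> S"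
    "\<And>x. \<forall>k<n. sign_sum S (T k) x = 0 \<Longrightarrow>
      sq_sum S x \<le> 20 / real m * (\<Sum>i\<in>S. \<bar>x i\<bar>)\<^sup>2"
proof -
  let ?Y = "signed_unit_sums S m"
  have "card ?Y * (10 / 11 :: real) ^ n \<le> real (2 * card S) ^ m * (10 / 11) ^ n"
    using signed_unit_sums_finite(2)[OF S, of m]
    by (intro mult_right_mono) (metis of_nat_le_iff of_nat_power, simp)
  then have "card ?Y * (10 / 11 :: real) ^ n < 1" using small by (rule order_le_less_trans)
  then obtain T where T: "\<And>k. T k \<subseteq> S"
    and low: "\<And>y. y \<in> ?Y \<Longrightarrow> 0 < sq_sum S y \<Longrightarrow>
      real n / 4 * sq_sum S y < energy n S T y"
    using sign_vectors_lower_bound[OF S signed_unit_sums_finite(1)[OF S]] by blast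
  have normalized: "sq_sum S x \<le> 20 / real m"
    if ker: "\<forall>k<n. sign_sum S (T k) x = 0" and x: "(\<Sum>i\<in>S. \<bar>x i\<bar>) = 1" for x
  proof -
    \<comment> \<open>The two seminorms as one family of rows: the coordinates, and the normalised sign vectors.
      Every unit vector has the square \<open>1 + 1\<close> in their sum.\<close>
    define a :: "'a + nat \<Rightarrow> 'a \<Rightarrow> real" where
      "a j i = (case j of Inl i' \<Rightarrow> if i' = i then 1 else 0
        | Inr k \<Rightarrow> (if i \<in> T k then 1 else - 1) / sqrt n)" for j i
    define J where "J = Inl ` S \<union> Inr ` {..<n}"
    have sumJ: "(\<Sum>j\<in>J. h j) = (\<Sum>i\<in>S. h (Inl i)) + (\<Sum>k<n. h (Inr k))" for h :: "'a + nat \<Rightarrow> real"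
      unfolding J_def using S by (subst sum.union_disjoint) (auto simp: sum.reindex)
    have J: "finite J" using S by (auto simp: J_def)
    have D: "\<forall>i\<in>S. (\<Sum>j\<in>J. (a j i)\<^sup>2) \<le> 2"
    proof
      fix i assume i: "i \<in> S"
      have "(\<Sum>i'\<in>S. (a (Inl i') i)\<^sup>2) = (\<Sum>i'\<in>S. if i' = i then 1 else 0)"
        by (intro sum.cong) (auto simp: a_def)
      also have "\<dots> = 1" using S i by simp
      finally have 1: "(\<Sum>i'\<in>S. (a (Inl i') i)\<^sup>2) = 1" .
      have "(\<Sum>k<n. (a (Inr k) i)\<^sup>2) = (\<Sum>k<n. 1 / real n)"
        by (intro sum.cong) (auto simp: a_def power_divide)
      then show "(\<Sum>j\<in>J. (a j i)\<^sup>2) \<le> 2" unfolding sumJ 1 using n by simp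
    qed
    obtain v where v: "v \<in> ?Y" "(\<Sum>j\<in>J. (\<Sum>i\<in>S. a j i * (v i - m * x i))\<^sup>2) \<le> real m * 2"
      by (rule bexE[OF maurey_approximation[OF S J D x, of m]])
    have aL: "(\<Sum>i\<in>S. a (Inl i') i * (v i - m * x i)) = v i' - m * x i'" if "i' \<in> S" for i'
    proof -
      have "(\<Sum>i\<in>S. a (Inl i') i * (v i - m * x i)) = (\<Sum>i\<in>S. if i = i' then v i' - m * x i' else 0)"
        by (intro sum.cong) (auto simp: a_def)
      then show ?thesis using S that by simp
    qed
    have aR: "(\<Sum>i\<in>S. a (Inr k) i * (v i - m * x i)) = sign_sum S (T k) v / sqrt n" if "k < n" for k
    proof -
      have "(\<Sum>i\<in>S. a (Inr k) i * (v i - m * x i)) = (sign_sum S (T k) v - m * sign_sum S (T k) x) / sqrt n"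
        unfolding sign_sum_def sum_distrib_left sum_subtractf[symmetric] sum_divide_distrib
        by (intro sum.cong refl) (simp add: a_def right_diff_distrib diff_divide_distrib mult.left_commute)
      then show ?thesis using ker that by simp
    qed
    have "(\<Sum>i\<in>S. (v i - m * x i)\<^sup>2) + (\<Sum>k<n. (sign_sum S (T k) v)\<^sup>2 / n) \<le> real m * 2"
      using v(2) unfolding sumJ by (simp add: aL aR power_divide)
    then have dist: "(\<Sum>i\<in>S. (v i - m * x i)\<^sup>2) + energy n S T v / n \<le> real m * 2"
      by (simp add: sum_divide_distrib)
    have nn: "0 \<le> (\<Sum>i\<in>S. (v i - m * x i)\<^sup>2)" "0 \<le> energy n S T v"
      by (auto intro: sum_nonneg)
    have v8: "sq_sum S v \<le> 8 * m"
    proof (cases "0 < sq_sum S v")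
      case True
      have "sq_sum S v / 4 < energy n S T v / n"
        using low[OF v(1) True] n by (simp add: field_simps)
      then show ?thesis using dist nn by linarith
    qed simp
    have "(real m)\<^sup>2 * sq_sum S x = (\<Sum>i\<in>S. (m * x i)\<^sup>2)"
      by (simp add: sum_distrib_left power_mult_distrib)
    also have "\<dots> \<le> (\<Sum>i\<in>S. 2 * (v i)\<^sup>2 + 2 * (v i - m * x i)\<^sup>2)"
    proof (intro sum_mono)
      fix i
      have "0 \<le> (2 * v i - m * x i)\<^sup>2" by simp
      then show "(m * x i)\<^sup>2 \<le> 2 * (v i)\<^sup>2 + 2 * (v i - m * x i)\<^sup>2"
        by (simp add: power2_eq_square algebra_simps)
    qed
    also have "\<dots> = 2 * sq_sum S v + 2 * (\<Sum>i\<in>S. (v i - m * x i)\<^sup>2)"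
      by (simp add: sum.distrib sum_distrib_left)
    \<comment> \<open>\<open>20 = 2 * 8 + 2 * 2\<close>, from the bounds of \<open>v\<close> and of its distance to \<open>m * x\<close>.\<close>
    also have "\<dots> \<le> 20 * m"
    proof -
      have "0 \<le> energy n S T v / n" using nn by simp
      then show ?thesis using v8 dist by linarith
    qed
    finally have "real m * (real m * sq_sum S x) \<le> real m * 20"
      by (simp add: power2_eq_square mult.assoc mult.commute)
    then show ?thesis using m by (simp add: pos_le_divide_eq mult.commute)
  qed
  have "sq_sum S x \<le> 20 / real m * (\<Sum>i\<in>S. \<bar>x i\<bar>)\<^sup>2"
    if ker: "\<forall>k<n. sign_sum S (T k) x = 0" for x
  proof (cases "(\<Sum>i\<in>S. \<bar>x i\<bar>) = 0")
    case True
    then show ?thesis using S by (simp add: sum_nonneg_eq_0_iff)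
  next
    case False
    define X where "X = (\<Sum>i\<in>S. \<bar>x i\<bar>)"
    have X: "0 < X" using False by (simp add: X_def less_le sum_nonneg)
    have "(\<Sum>i\<in>S. (x i / X)\<^sup>2) \<le> 20 / real m"
    proof (rule normalized)
      show "\<forall>k<n. sign_sum S (T k) (\<lambda>i. x i / X) = 0"
        using ker by (simp add: sign_sum_def flip: sum_divide_distrib)
      show "(\<Sum>i\<in>S. \<bar>x i / X\<bar>) = 1"
        using X by (simp add: abs_divide X_def flip: sum_divide_distrib)
    qed
    then have "sq_sum S x / X\<^sup>2 \<le> 20 / real m"
      by (simp add: power_divide sum_divide_distrib)
    then show ?thesis using X by (simp add: X_def[symmetric] pos_divide_le_eq)
  qed
  then show ?thesis using that[of T] T by blast
qed

section \<open>Sampling compared with arbitrary information for the supremum norm\<close>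

text \<open>
  Cramer's rule: if \<open>s\<close> nearly maximises the volume spanned by \<open>n\<close> members of \<open>V\<close>, then no
  replacement of a member can increase the volume by more than a factor \<open>2\<close>, and the quotients of
  these volumes are the coordinates with respect to \<open>s\<close>.
\<close>
lemma near_maximal_volume:
  fixes V :: "(nat \<Rightarrow> real) set"
  assumes bounded: "\<And>v i. v \<in> V \<Longrightarrow> i < n \<Longrightarrow> \<bar>v i\<bar> \<le> B"
    and eps: "0 < \<epsilon>" and unit: "\<And>k. k < n \<Longrightarrow> (\<lambda>i. if i = k then \<epsilon> else 0) \<in> V"
  obtains s where "\<And>j. j < n \<Longrightarrow> s j \<in> V"
    "\<And>v. v \<in> V \<Longrightarrow> \<exists>c. (\<forall>j<n. \<bar>c j\<bar> \<le> 2) \<and> (\<forall>i<n. v i = (\<Sum>j<n. c j * s j i))"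
proof -
  define mt where "mt s = mat n n (\<lambda>(i, j). s j i)" for s :: "nat \<Rightarrow> nat \<Rightarrow> real"
  have mt: "mt s \<in> carrier_mat n n" for s by (simp add: mt_def)
  define D where "D s = \<bar>det (mt s)\<bar>" for s
  define VS where "VS = {s. \<forall>j<n. s j \<in> V}"
  let ?P = "{q. q permutes {0..<n}}"
  have bd: "D s \<le> real (card ?P) * B ^ n" if s: "s \<in> VS" for s
  proof -
    have "D s \<le> (\<Sum>q\<in>?P. \<bar>signof q * (\<Prod>i = 0..<n. mt s $$ (i, q i))\<bar>)"
      unfolding D_def det_def'[OF mt] by (rule sum_abs)
    also have "\<dots> \<le> (\<Sum>q\<in>?P. B ^ n)"
    proof (intro sum_mono)
      fix q assume "q \<in> ?P"
      then have q: "q i < n" if "i < n" for i using that permutes_in_image[of q "{0..<n}" i] by auto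
      have "\<bar>signof q * (\<Prod>i = 0..<n. mt s $$ (i, q i))\<bar> = (\<Prod>i = 0..<n. \<bar>mt s $$ (i, q i)\<bar>)"
        by (simp add: abs_mult abs_prod sign_def)
      also have "\<dots> \<le> (\<Prod>i = 0..<n. B)"
        using q s bounded by (intro prod_mono) (auto simp: mt_def VS_def)
      finally show "\<bar>signof q * (\<Prod>i = 0..<n. mt s $$ (i, q i))\<bar> \<le> B ^ n" by simp
    qed
    finally show ?thesis by simp
  qed
  have bdd: "bdd_above (D ` VS)" using bd by (auto intro!: bdd_aboveI)
  define s0 where "s0 = (\<lambda>j i :: nat. if i = j then \<epsilon> else 0)"
  have s0: "s0 \<in> VS" using unit by (auto simp: VS_def s0_def)
  have "mt s0 = \<epsilon> \<cdot>\<^sub>m 1\<^sub>m n" by (auto simp: mt_def s0_def intro!: eq_matI)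
  then have D0: "0 < D s0" using eps by (simp add: D_def det_smult)
  define W where "W = (SUP s\<in>VS. D s)"
  have W: "D s \<le> W" if "s \<in> VS" for s unfolding W_def using that bdd by (intro cSUP_upper)
  have W0: "0 < W" using D0 W[OF s0] by linarith
  then have "W / 2 < (SUP s\<in>VS. D s)" by (simp add: W_def)
  then obtain s where s: "s \<in> VS" "W / 2 < D s"
    using less_cSUP_iff[OF _ bdd, of "W / 2"] s0 by auto
  have "\<exists>c. (\<forall>j<n. \<bar>c j\<bar> \<le> 2) \<and> (\<forall>i<n. v i = (\<Sum>j<n. c j * s j i))" if v: "v \<in> V" for v
  proof -
    let ?A = "mt s" and ?b = "vec n v"
    have det: "det ?A \<noteq> 0" using s(2) W0 by (auto simp: D_def)
    from det_non_zero_imp_unit[OF mt det, of "()"]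
    obtain R where R: "R \<in> carrier_mat n n" "?A * R = 1\<^sub>m n"
      by (auto simp: Units_def ring_mat_def)
    define x where "x = R *\<^sub>v ?b"
    have x: "x \<in> carrier_vec n" using R(1) by (simp add: x_def)
    have Ax: "?A *\<^sub>v x = ?b"
      unfolding x_def using R mt[of s] by (simp flip: assoc_mult_mat_vec[of _ n n _ n])
    have "\<bar>x $ k\<bar> \<le> 2" if k: "k < n" for k
    proof -
      have "det (replace_col ?A ?b k) = x $ k * det ?A"
        using cramer_lemma_mat[OF mt[of s] x k] unfolding Ax .
      moreover have "replace_col ?A ?b k = mt (s(k := v))"
        using k by (auto simp: replace_col_def mt_def intro!: eq_matI)
      ultimately have "\<bar>x $ k\<bar> * D s = D (s(k := v))" by (simp add: D_def abs_mult)
      also have "\<dots> \<le> W" using s(1) v by (intro W) (auto simp: VS_def)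
      also have "\<dots> \<le> 2 * D s" using s(2) by simp
      finally show ?thesis using s(2) W0 by (simp add: mult_le_cancel_right)
    qed
    moreover have "v i = (\<Sum>j<n. x $ j * s j i)" if i: "i < n" for i
    proof -
      have "v i = (?A *\<^sub>v x) $ i" using Ax i by simp
      also have "\<dots> = (\<Sum>j<n. x $ j * s j i)"
        using i x by (auto simp: mt_def scalar_prod_def lessThan_atLeast0 intro!: sum.cong)
      finally show ?thesis .
    qed
    ultimately show ?thesis by (intro exI[of _ "\<lambda>j. x $ j"]) auto
  qed
  then show ?thesis using that[of s] s(1) by (auto simp: VS_def)
qed

text \<open>
  Every functional bounded by \<open>C\<close>, whose restriction to the common kernel of \<open>Ls\<close> is bounded by \<open>c\<close>, becomes
  bounded by \<open>c\<close> on the whole space after subtraction of a combination of \<open>Ls\<close>. One bound \<open>B\<close> of the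
  coefficients serves all these functionals; the determinants below need bounded entries.
\<close>
definition extends_kernel_bounds ::
  "('a \<Rightarrow> real) set \<Rightarrow> (('a \<Rightarrow> real) \<Rightarrow> real) \<Rightarrow> (('a \<Rightarrow> real) \<Rightarrow> real) list \<Rightarrow> real \<Rightarrow> real \<Rightarrow> real \<Rightarrow> bool" where
  "extends_kernel_bounds F N Ls c C B \<longleftrightarrow>
    (\<forall>\<delta>\<in>Lambda_all F N. (\<forall>f\<in>F. \<bar>\<delta> f\<bar> \<le> C * N f) \<longrightarrow>
      (\<forall>f\<in>F. (\<forall>L\<in>set Ls. L f = 0) \<longrightarrow> \<bar>\<delta> f\<bar> \<le> c * N f) \<longrightarrow>
      (\<exists>a. (\<forall>i<length Ls. \<bar>a i\<bar> \<le> B) \<and>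
        (\<forall>f\<in>F. \<bar>\<delta> f - (\<Sum>i<length Ls. a i * (Ls ! i) f)\<bar> \<le> c * N f)))"

lemma extends_kernel_boundsD:
  assumes "extends_kernel_bounds F N Ls c C B" "\<delta> \<in> Lambda_all F N" "\<forall>f\<in>F. \<bar>\<delta> f\<bar> \<le> C * N f"
    and "\<forall>f\<in>F. (\<forall>L\<in>set Ls. L f = 0) \<longrightarrow> \<bar>\<delta> f\<bar> \<le> c * N f"
  obtains a where "\<forall>i<length Ls. \<bar>a i\<bar> \<le> B"
    "\<forall>f\<in>F. \<bar>\<delta> f - (\<Sum>i<length Ls. a i * (Ls ! i) f)\<bar> \<le> c * N f"
  using assms unfolding extends_kernel_bounds_def by blast

context
  fixes p :: ereal and M :: "'a measure" and F N
  assumes p: "1 \<le> p" and adm: "admissible_space p M F N"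
begin

lemma Lambda_all_facts:
  assumes "L \<in> Lambda_all F N"
  shows "f \<in> F \<Longrightarrow> g \<in> F \<Longrightarrow> L (\<lambda>x. f x + g x) = L f + L g"
    and "f \<in> F \<Longrightarrow> L (\<lambda>x. c * f x) = c * L f"
    and "\<exists>C\<ge>0. \<forall>f\<in>F. \<bar>L f\<bar> \<le> C * N f"
proof -
  show "f \<in> F \<Longrightarrow> g \<in> F \<Longrightarrow> L (\<lambda>x. f x + g x) = L f + L g" "f \<in> F \<Longrightarrow> L (\<lambda>x. c * f x) = c * L f"
    using assms by (auto simp: Lambda_all_def)
  obtain C where C: "\<forall>f\<in>F. \<bar>L f\<bar> \<le> C * N f" using assms by (auto simp: Lambda_all_def)
  have "\<bar>L f\<bar> \<le> max 0 C * N f" if "f \<in> F" for f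
    using C that space_facts(5)[OF p adm that] by (meson max.cobounded2 mult_right_mono order_trans)
  then show "\<exists>C\<ge>0. \<forall>f\<in>F. \<bar>L f\<bar> \<le> C * N f" by (intro exI[of _ "max 0 C"]) auto
qed

lemma Lambda_all_combination:
  assumes "L1 \<in> Lambda_all F N" "L2 \<in> Lambda_all F N"
  shows "(\<lambda>f. L1 f + c * L2 f) \<in> Lambda_all F N"
proof -
  obtain C1 where C1: "C1 \<ge> 0" "\<forall>f\<in>F. \<bar>L1 f\<bar> \<le> C1 * N f" using Lambda_all_facts(3)[OF assms(1)] by blast
  obtain C2 where C2: "C2 \<ge> 0" "\<forall>f\<in>F. \<bar>L2 f\<bar> \<le> C2 * N f" using Lambda_all_facts(3)[OF assms(2)] by blast
  have "\<bar>L1 f + c * L2 f\<bar> \<le> (C1 + \<bar>c\<bar> * C2) * N f" if "f \<in> F" for f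
  proof -
    have "\<bar>L1 f + c * L2 f\<bar> \<le> \<bar>L1 f\<bar> + \<bar>c\<bar> * \<bar>L2 f\<bar>" by (metis abs_mult abs_triangle_ineq)
    also have "\<dots> \<le> C1 * N f + \<bar>c\<bar> * (C2 * N f)"
      using C1 C2 that by (intro add_mono mult_left_mono) auto
    finally show ?thesis by (simp add: algebra_simps)
  qed
  then have "\<exists>C. \<forall>f\<in>F. \<bar>L1 f + c * L2 f\<bar> \<le> C * N f" by blast
  then show ?thesis
    using Lambda_all_facts(1,2)[OF assms(1)] Lambda_all_facts(1,2)[OF assms(2)]
    unfolding Lambda_all_def by (intro CollectI conjI) (simp_all add: algebra_simps)
qed

text \<open>
  The Hahn--Banach theorem for a subspace of finite codimension. Each step adds one dimension, spanned
  by some \<open>f1\<close> with \<open>L f1 = 1\<close>. The admissible coefficients of \<open>L\<close> form an interval around \<open>\<delta> f1\<close>, whose length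
  is controlled by the norm of \<open>f1\<close>; hence the uniform bound. A functional \<open>L\<close> that vanishes on the kernel of
  the others gets the coefficient \<open>0\<close>.
\<close>
lemma kernel_bound_extends:
  assumes "set Ls \<subseteq> Lambda_all F N" "0 \<le> c" "0 \<le> C"
  shows "\<exists>B. extends_kernel_bounds F N Ls c C B"
  using assms
proof (induction Ls arbitrary: C)
  case Nil
  then show ?case by (auto simp: extends_kernel_bounds_def)
next
  case (Cons L Ls)
  note S = space_facts[OF p adm]
  have L: "L \<in> Lambda_all F N" and Ls: "set Ls \<subseteq> Lambda_all F N" using Cons.prems by auto
  note Ladd = Lambda_all_facts(1)[OF L] and Lscale = Lambda_all_facts(2)[OF L]
  have split: "(\<Sum>i<length (L # Ls). case_nat a1 a i * ((L # Ls) ! i) f)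
      = a1 * L f + (\<Sum>i<length Ls. a i * (Ls ! i) f)" for a1 a f
    by (simp add: sum.lessThan_Suc_shift del: sum.lessThan_Suc)
  have bnd: "(\<forall>i<length (L # Ls). \<bar>case_nat a1 a i\<bar> \<le> max A1 B')"
    if "\<bar>a1\<bar> \<le> A1" "\<forall>i<length Ls. \<bar>a i\<bar> \<le> B'" for a1 A1 B' :: real and a
    using that by (auto simp: less_Suc_eq_0_disj le_max_iff_disj)
  show ?case
  proof (cases "\<forall>f\<in>F. (\<forall>L'\<in>set Ls. L' f = 0) \<longrightarrow> L f = 0")
    case True
    obtain B' where B': "extends_kernel_bounds F N Ls c C B'"
      using Cons.IH[OF Ls Cons.prems(2,3)] by blast
    show ?thesis
    unfolding extends_kernel_bounds_def
    proof (intro exI[of _ "max 0 B'"] ballI impI)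
      fix \<delta> assume d: "\<delta> \<in> Lambda_all F N" "\<forall>f\<in>F. \<bar>\<delta> f\<bar> \<le> C * N f"
        "\<forall>f\<in>F. (\<forall>L\<in>set (L # Ls). L f = 0) \<longrightarrow> \<bar>\<delta> f\<bar> \<le> c * N f"
      have d3: "\<forall>f\<in>F. (\<forall>L\<in>set Ls. L f = 0) \<longrightarrow> \<bar>\<delta> f\<bar> \<le> c * N f"
        using d(3) True by auto
      obtain a where a: "\<forall>i<length Ls. \<bar>a i\<bar> \<le> B'"
          "\<forall>f\<in>F. \<bar>\<delta> f - (\<Sum>i<length Ls. a i * (Ls ! i) f)\<bar> \<le> c * N f"
        by (rule extends_kernel_boundsD[OF B' d(1,2) d3])
      show "\<exists>a. (\<forall>i<length (L # Ls). \<bar>a i\<bar> \<le> max 0 B') \<and>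
          (\<forall>f\<in>F. \<bar>\<delta> f - (\<Sum>i<length (L # Ls). a i * ((L # Ls) ! i) f)\<bar> \<le> c * N f)"
        by (rule exI[of _ "case_nat 0 a"], unfold split) (use a bnd[of 0 0 a B'] in auto)
    qed
  next
    case False
    then obtain f0 where f0: "f0 \<in> F" "\<forall>L'\<in>set Ls. L' f0 = 0" "L f0 \<noteq> 0" by blast
    define f1 where "f1 = (\<lambda>x. (1 / L f0) * f0 x)"
    have f1F: "f1 \<in> F" unfolding f1_def by (rule S(4)[OF f0(1)])
    have Lf1: "L f1 = 1" unfolding f1_def Lscale[OF f0(1)] using f0(3) by simp
    have f1ker: "\<forall>L'\<in>set Ls. L' f1 = 0"
      using f0 Ls Lambda_all_facts(2)[OF _ f0(1)] unfolding f1_def by (metis mult_zero_right subsetD)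
    define A1 where "A1 = (C + c) * N f1"
    obtain CL where CL: "CL \<ge> 0" "\<forall>f\<in>F. \<bar>L f\<bar> \<le> CL * N f" using Lambda_all_facts(3)[OF L] by blast
    have A10: "0 \<le> A1" using Cons.prems S(5)[OF f1F] by (simp add: A1_def)
    have C': "0 \<le> C + A1 * CL" using A10 CL Cons.prems by simp
    obtain B' where B': "extends_kernel_bounds F N Ls c (C + A1 * CL) B'"
      using Cons.IH[OF Ls Cons.prems(2) C'] by blast
    show ?thesis
    unfolding extends_kernel_bounds_def
    proof (intro exI[of _ "max A1 B'"] ballI impI)
      fix \<delta> assume d: "\<delta> \<in> Lambda_all F N" "\<forall>f\<in>F. \<bar>\<delta> f\<bar> \<le> C * N f"
        "\<forall>f\<in>F. (\<forall>L\<in>set (L # Ls). L f = 0) \<longrightarrow> \<bar>\<delta> f\<bar> \<le> c * N f"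
      note dadd = Lambda_all_facts(1)[OF d(1)] and dscale = Lambda_all_facts(2)[OF d(1)]
        and ddiff = Lambda_all_linear(2)[OF p adm d(1)]
      define K where "K = {f \<in> F. \<forall>L'\<in>set (L # Ls). L' f = 0}"
      have K0: "(\<lambda>x. 0) \<in> K"
        using S(2) L Ls Lambda_all_facts(2)[OF _ S(2), of _ 0] by (auto simp: K_def)
      \<comment> \<open>The coefficient \<open>a1\<close> has to lie between \<open>lo k\<close> and \<open>hi k\<close> for all \<open>k\<close> in the kernel.\<close>
      define lo where "lo k = \<delta> k + \<delta> f1 - c * N (\<lambda>x. k x + f1 x)" for k
      define hi where "hi k = \<delta> k + \<delta> f1 + c * N (\<lambda>x. k x + f1 x)" for k
      have lohi: "lo k \<le> hi k'" if k: "k \<in> K" "k' \<in> K" for k k'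
      proof -
        have F: "k \<in> F" "k' \<in> F" using k by (auto simp: K_def)
        have "L' (\<lambda>x. k x - k' x) = 0" if "L' \<in> set (L # Ls)" for L'
        proof -
          have "L' k = 0" "L' k' = 0" "L' \<in> Lambda_all F N"
            using that k Cons.prems(1) by (auto simp: K_def)
          then show ?thesis using Lambda_all_linear(2)[OF p adm _ F, of L'] by simp
        qed
        then have "\<delta> k - \<delta> k' \<le> c * N (\<lambda>x. k x - k' x)"
          using d(3) ddiff[OF F] space_diff(1)[OF p adm F] by (metis abs_le_D1)
        also have "\<dots> \<le> c * (N (\<lambda>x. k x + f1 x) + N (\<lambda>x. k' x + f1 x))"
          using space_diff(2)[OF p adm S(3)[OF F(1) f1F] S(3)[OF F(2) f1F]] Cons.prems(2)
          by (intro mult_left_mono) auto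
        finally show ?thesis by (simp add: lo_def hi_def algebra_simps)
      qed
      define a1 where "a1 = (SUP k\<in>K. lo k)"
      have lo: "lo k \<le> a1" if "k \<in> K" for k
        unfolding a1_def using that lohi[OF _ K0] by (intro cSUP_upper bdd_aboveI[of _ "hi (\<lambda>x. 0)"]) auto
      have hi: "a1 \<le> hi k" if "k \<in> K" for k
        unfolding a1_def using that K0 lohi[OF _ that] by (intro cSUP_least) auto
      have a1: "\<bar>\<delta> k + \<delta> f1 - a1\<bar> \<le> c * N (\<lambda>x. k x + f1 x)" if "k \<in> K" for k
        using lo[OF that] hi[OF that] by (auto simp: lo_def hi_def abs_le_iff)
      have a1A: "\<bar>a1\<bar> \<le> A1"
      proof -
        have "\<bar>\<delta> f1 - a1\<bar> \<le> c * N f1" using a1[OF K0] dscale[OF S(2), of 0] by simp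
        moreover have "\<bar>\<delta> f1\<bar> \<le> C * N f1" using d(2) f1F by blast
        ultimately show ?thesis unfolding A1_def distrib_right by linarith
      qed
      define \<delta>' where "\<delta>' = (\<lambda>f. \<delta> f + (- a1) * L f)"
      have d'1: "\<delta>' \<in> Lambda_all F N" unfolding \<delta>'_def by (rule Lambda_all_combination[OF d(1) L])
      have d'2: "\<forall>f\<in>F. \<bar>\<delta>' f\<bar> \<le> (C + A1 * CL) * N f"
      proof
        fix f assume f: "f \<in> F"
        have "\<bar>\<delta>' f\<bar> \<le> \<bar>\<delta> f\<bar> + \<bar>a1\<bar> * \<bar>L f\<bar>"
          unfolding \<delta>'_def by (metis abs_minus_cancel abs_mult abs_triangle_ineq)
        also have "\<dots> \<le> C * N f + A1 * (CL * N f)"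
          using d(2) CL f a1A A10 by (intro add_mono mult_mono) auto
        finally show "\<bar>\<delta>' f\<bar> \<le> (C + A1 * CL) * N f" by (simp add: algebra_simps)
      qed
      have "\<bar>\<delta>' f\<bar> \<le> c * N f" if f: "f \<in> F" "\<forall>L\<in>set Ls. L f = 0" for f
      proof (cases "L f = 0")
        case True
        then show ?thesis using d(3) f by (auto simp: \<delta>'_def)
      next
        case nz: False
        define t where "t = L f"
        have t: "t \<noteq> 0" using nz by (simp add: t_def)
        define g where "g = (\<lambda>x. (1 / t) * f x)"
        have g: "g \<in> F" unfolding g_def by (rule S(4)[OF f(1)])
        define k where "k = (\<lambda>x. g x - f1 x)"
        have "L' k = 0" if "L' \<in> set (L # Ls)" for L'
        proof -
          have L': "L' \<in> Lambda_all F N" using that Cons.prems(1) by auto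
          have "L' k = (1 / t) * L' f - L' f1"
            unfolding k_def Lambda_all_linear(2)[OF p adm L' g f1F] unfolding g_def
              Lambda_all_facts(2)[OF L' f(1)] ..
          then show ?thesis using that f f1ker Lf1 t by (auto simp: t_def)
        qed
        then have k: "k \<in> K" using space_diff(1)[OF p adm g f1F] by (auto simp: K_def k_def)
        have kF: "k \<in> F" using k by (simp add: K_def)
        have kf: "(\<lambda>x. k x + f1 x) = g" by (simp add: k_def)
        have dg: "\<delta> k + \<delta> f1 = (1 / t) * \<delta> f"
          using dadd[OF kF f1F] dscale[OF f(1), of "1 / t"] unfolding kf by (simp add: g_def)
        have Ng: "N g = \<bar>1 / t\<bar> * N f" unfolding g_def by (rule S(8)[OF f(1)])
        have "\<bar>t\<bar> * \<bar>(1 / t) * \<delta> f - a1\<bar> \<le> \<bar>t\<bar> * (c * (\<bar>1 / t\<bar> * N f))"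
          using a1[OF k] unfolding kf dg Ng by (intro mult_left_mono) auto
        also have "\<dots> = c * N f" using t by (simp add: abs_divide)
        also have "\<bar>t\<bar> * \<bar>(1 / t) * \<delta> f - a1\<bar> = \<bar>\<delta>' f\<bar>"
          unfolding abs_mult[symmetric] \<delta>'_def t_def[symmetric] using t by (simp add: right_diff_distrib mult.commute)
        finally show ?thesis .
      qed
      then have d'3: "\<forall>f\<in>F. (\<forall>L\<in>set Ls. L f = 0) \<longrightarrow> \<bar>\<delta>' f\<bar> \<le> c * N f" by blast
      obtain a where a: "\<forall>i<length Ls. \<bar>a i\<bar> \<le> B'"
          "\<forall>f\<in>F. \<bar>\<delta>' f - (\<Sum>i<length Ls. a i * (Ls ! i) f)\<bar> \<le> c * N f"
        by (rule extends_kernel_boundsD[OF B' d'1 d'2 d'3])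
      have "\<forall>f\<in>F. \<bar>\<delta> f - (a1 * L f + (\<Sum>i<length Ls. a i * (Ls ! i) f))\<bar> \<le> c * N f"
        using a(2) by (simp add: \<delta>'_def algebra_simps)
      then show "\<exists>a. (\<forall>i<length (L # Ls). \<bar>a i\<bar> \<le> max A1 B') \<and>
          (\<forall>f\<in>F. \<bar>\<delta> f - (\<Sum>i<length (L # Ls). a i * ((L # Ls) ! i) f)\<bar> \<le> c * N f)"
        using bnd[OF a1A a(1)] by (intro exI[of _ "case_nat a1 a"]) (unfold split, auto)
    qed
  qed
qed

end

text \<open>
  Let \<open>f\<close> vanish at the chosen points. Up to an error \<open>e * N f\<close>, the value of \<open>f\<close> at \<open>x\<close> is a
  combination of \<open>n\<close> functionals with coefficient vector \<open>a x\<close>. This vector is a combination, with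
  coefficients at most \<open>2\<close>, of vectors at which the functional is small: of vectors \<open>a y\<close>
  with \<open>f y = 0\<close>, or of small multiples of unit vectors. The latter are included so that the vectors
  span the whole space.
\<close>
lemma sampling_error_le:
  fixes M :: "'a measure"
  assumes adm: "admissible_space \<infinity> M F N" and ne: "space M \<noteq> {}"
    and all: "minimal_error \<infinity> M F N (Lambda_all F N) n < ereal e"
  shows "minimal_error \<infinity> M F N (Lambda_std (space M)) n \<le> ereal ((4 * real n + 2) * e)"
proof -
  have p: "1 \<le> (\<infinity> :: ereal)" by simp
  note S = space_facts[OF p adm]
  have "0 < ereal e" using minimal_error_nonneg[OF p adm] all by (rule order_le_less_trans)
  then have e: "0 < e" by simp
  obtain Ls where Ls: "length Ls = n" "set Ls \<subseteq> Lambda_all F N"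
    and ker: "\<And>f. f \<in> F \<Longrightarrow> N f \<le> 1 \<Longrightarrow> \<forall>L\<in>set Ls. L f = 0 \<Longrightarrow> lp_norm \<infinity> M f < e"
    using kernel_bound_of_minimal_error[OF p adm order_refl all] by blast
  have emb: "\<exists>C. \<forall>f\<in>F. lp_norm \<infinity> M f \<le> C * N f" and AE0: "AE x in M. \<forall>f\<in>F. \<bar>f x\<bar> \<le> lp_norm \<infinity> M f"
    using adm by (auto simp: admissible_space_def embedded_in_lp_def)
  \<comment> \<open>Evaluation at these points is bounded by the norm of \<open>L\<^sub>\<infinity>\<close>, and almost every point is of this kind.\<close>
  define X where "X = {x \<in> space M. \<forall>f\<in>F. \<bar>f x\<bar> \<le> lp_norm \<infinity> M f}"
  have AEX: "AE x in M. x \<in> X" using AE0 AE_space by eventually_elim (auto simp: X_def)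
  obtain C0 where C0: "\<forall>f\<in>F. lp_norm \<infinity> M f \<le> C0 * N f" using emb by blast
  define C where "C = max 0 C0"
  have C: "lp_norm \<infinity> M f \<le> C * N f" if "f \<in> F" for f
  proof -
    have "C0 * N f \<le> C * N f" using S(5)[OF that] by (intro mult_right_mono) (auto simp: C_def)
    then show ?thesis using C0 that by fastforce
  qed
  have ker': "lp_norm \<infinity> M f \<le> e * N f" if f: "f \<in> F" "\<forall>L\<in>set Ls. L f = 0" for f
  proof (cases "N f = 0")
    case True
    then have "f = (\<lambda>x. 0)" using S(6)[OF f(1)] by simp
    then show ?thesis using lp_zero(2)[OF p, of M] True by simp
  next
    case False
    then have pos: "0 < N f" using S(5)[OF f(1)] by simp
    define g where "g = (\<lambda>x. (1 / N f) * f x)"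
    have g: "g \<in> F" unfolding g_def by (rule S(4)[OF f(1)])
    have "N g \<le> 1" unfolding g_def S(8)[OF f(1)] using pos by simp
    moreover have "L g = 0" if "L \<in> set Ls" for L
    proof -
      have "L g = (1 / N f) * L f"
        unfolding g_def using Ls(2) that by (intro Lambda_all_facts(2)[OF p adm _ f(1)]) auto
      then show ?thesis using f(2) that by simp
    qed
    ultimately have "lp_norm \<infinity> M g < e" using ker[OF g] by blast
    then have "(1 / N f) * lp_norm \<infinity> M f < e"
      unfolding g_def using lp_scale(2)[OF p S(9)[OF f(1)], of "1 / N f"] pos by simp
    then show ?thesis using pos by (simp add: field_simps)
  qed
  have delta: "(\<lambda>f. f x) \<in> Lambda_all F N" if "x \<in> X" for x
    using Lambda_std_subset[OF p adm] that by (auto simp: Lambda_std_def X_def)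
  obtain B where B: "extends_kernel_bounds F N Ls e C B"
    using kernel_bound_extends[OF p adm Ls(2), of e C] e by (auto simp: C_def)
  have "\<exists>a. (\<forall>i<n. \<bar>a i\<bar> \<le> B) \<and> (\<forall>f\<in>F. \<bar>f x - (\<Sum>i<n. a i * (Ls ! i) f)\<bar> \<le> e * N f)"
    if x: "x \<in> X" for x
  proof -
    have 1: "\<forall>f\<in>F. \<bar>f x\<bar> \<le> C * N f" using x C by (fastforce simp: X_def)
    have 2: "\<forall>f\<in>F. (\<forall>L\<in>set Ls. L f = 0) \<longrightarrow> \<bar>f x\<bar> \<le> e * N f"
      using x ker' by (fastforce simp: X_def)
    obtain a where "\<forall>i<length Ls. \<bar>a i\<bar> \<le> B"
      "\<forall>f\<in>F. \<bar>f x - (\<Sum>i<length Ls. a i * (Ls ! i) f)\<bar> \<le> e * N f"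
      by (rule extends_kernel_boundsD[OF B delta[OF x] 1 2])
    then show ?thesis unfolding Ls(1) by (intro exI conjI)
  qed
  then obtain a where a: "\<And>x i. x \<in> X \<Longrightarrow> i < n \<Longrightarrow> \<bar>a x i\<bar> \<le> B"
    "\<And>x f. x \<in> X \<Longrightarrow> f \<in> F \<Longrightarrow> \<bar>f x - (\<Sum>i<n. a x i * (Ls ! i) f)\<bar> \<le> e * N f"
    by metis
  have "\<forall>L\<in>set Ls. \<exists>K\<ge>0. \<forall>f\<in>F. \<bar>L f\<bar> \<le> K * N f"
    using Ls(2) Lambda_all_facts(3)[OF p adm] by blast
  then obtain K where K: "\<And>L. L \<in> set Ls \<Longrightarrow> 0 \<le> K L"
    "\<And>L f. L \<in> set Ls \<Longrightarrow> f \<in> F \<Longrightarrow> \<bar>L f\<bar> \<le> K L * N f" by metis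
  define Q where "Q = (\<Sum>L\<in>set Ls. K L)"
  have Q: "K L \<le> Q" if "L \<in> set Ls" for L
    unfolding Q_def using that K(1) by (intro member_le_sum) auto
  have Q0: "0 \<le> Q" unfolding Q_def using K(1) by (intro sum_nonneg) auto
  define \<epsilon> where "\<epsilon> = e / (Q + 1)"
  have eps: "0 < \<epsilon>" "\<epsilon> * Q \<le> e" using e Q0 by (auto simp: \<epsilon>_def field_simps)
  \<comment> \<open>\<open>\<epsilon>\<close> is so small that \<open>\<epsilon>\<close> times any of the functionals is bounded by \<open>e\<close>.\<close>
  define V where "V = a ` X \<union> (\<lambda>k i. if i = k then \<epsilon> else 0) ` {..<n}"
  obtain s where s: "\<And>j. j < n \<Longrightarrow> s j \<in> V"
    "\<And>v. v \<in> V \<Longrightarrow> \<exists>c. (\<forall>j<n. \<bar>c j\<bar> \<le> 2) \<and> (\<forall>i<n. v i = (\<Sum>j<n. c j * s j i))"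
  proof (rule near_maximal_volume[of V n "max B \<epsilon>" \<epsilon>])
    show "\<bar>v i\<bar> \<le> max B \<epsilon>" if "v \<in> V" "i < n" for v i
      using that a(1)[of _ i] eps(1) by (auto simp: V_def le_max_iff_disj)
  qed (use eps in \<open>auto simp: V_def\<close>)
  obtain x0 where x0: "x0 \<in> space M" using ne by blast
  \<comment> \<open>The point \<open>x0\<close> is a default for the vectors \<open>s j\<close> that are multiples of unit vectors.\<close>
  define P where "P j = (if \<exists>x\<in>X. s j = a x then SOME x. x \<in> X \<and> s j = a x else x0)" for j
  have P: "P j \<in> X \<and> s j = a (P j)" if "\<exists>x\<in>X. s j = a x" for j
    using that someI_ex[of "\<lambda>x. x \<in> X \<and> s j = a x"] by (auto simp: P_def)
  have PM: "P j \<in> space M" for j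
    using P[of j] x0 by (cases "\<exists>x\<in>X. s j = a x") (auto simp: P_def X_def)
  have small: "\<bar>\<Sum>i<n. s j i * (Ls ! i) f\<bar> \<le> e * N f" if j: "j < n" and f: "f \<in> F" "f (P j) = 0" for j f
  proof (cases "\<exists>x\<in>X. s j = a x")
    case True
    then show ?thesis using a(2)[of "P j" f] P[OF True] f by simp
  next
    case False
    then obtain k where k: "k < n" "s j = (\<lambda>i. if i = k then \<epsilon> else 0)"
      using s(1)[OF j] by (auto simp: V_def)
    have "(\<Sum>i<n. s j i * (Ls ! i) f) = (\<Sum>i<n. if i = k then \<epsilon> * (Ls ! k) f else 0)"
      by (intro sum.cong) (auto simp: k)
    also have "\<dots> = \<epsilon> * (Ls ! k) f" using k by simp
    finally have "\<bar>\<Sum>i<n. s j i * (Ls ! i) f\<bar> = \<epsilon> * \<bar>(Ls ! k) f\<bar>" using eps by (simp add: abs_mult)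
    also have "\<dots> \<le> \<epsilon> * (Q * N f)"
    proof (intro mult_left_mono)
      have "Ls ! k \<in> set Ls" using k(1) Ls(1) by simp
      then have "\<bar>(Ls ! k) f\<bar> \<le> K (Ls ! k) * N f" "K (Ls ! k) \<le> Q" using K(2) Q f(1) by blast+
      then show "\<bar>(Ls ! k) f\<bar> \<le> Q * N f"
        using S(5)[OF f(1)] by (meson mult_right_mono order_trans)
    qed (use eps in simp)
    also have "\<dots> \<le> e * N f" using mult_right_mono[OF eps(2) S(5)[OF f(1)]] by (simp add: mult.assoc)
    finally show ?thesis .
  qed
  show ?thesis
  proof (rule minimal_error_of_kernel_bound[OF p adm Lambda_std_subset[OF p adm],
      of "map (\<lambda>j f. f (P j)) [0..<n]"])
    show "set (map (\<lambda>j f. f (P j)) [0..<n]) \<subseteq> Lambda_std (space M)"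
      using PM by (auto simp: Lambda_std_def)
    fix f assume f: "f \<in> F" "N f \<le> 2"
      and z: "\<forall>L\<in>set (map (\<lambda>j f. f (P j)) [0..<n]). L f = 0"
    have zP: "f (P j) = 0" if "j < n" for j using z that by auto
    have pt: "\<bar>f x\<bar> \<le> (4 * real n + 2) * e" if x: "x \<in> X" for x
    proof -
      obtain c where c: "\<forall>j<n. \<bar>c j\<bar> \<le> 2" "\<forall>i<n. a x i = (\<Sum>j<n. c j * s j i)"
        using s(2)[of "a x"] x by (auto simp: V_def)
      have "(\<Sum>i<n. a x i * (Ls ! i) f) = (\<Sum>i<n. \<Sum>j<n. c j * (s j i * (Ls ! i) f))"
        using c(2) by (intro sum.cong) (auto simp: sum_distrib_right mult.assoc)
      also have "\<dots> = (\<Sum>j<n. c j * (\<Sum>i<n. s j i * (Ls ! i) f))"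
        by (subst sum.swap) (simp add: sum_distrib_left)
      also have "\<bar>\<dots>\<bar> \<le> (\<Sum>j<n. \<bar>c j * (\<Sum>i<n. s j i * (Ls ! i) f)\<bar>)" by (rule sum_abs)
      also have "\<dots> \<le> (\<Sum>j<n. 2 * (e * N f))"
        unfolding abs_mult using c(1) small f(1) zP by (intro sum_mono mult_mono) auto
      also have "\<dots> = 2 * real n * (e * N f)" by simp
      finally have "\<bar>f x\<bar> \<le> 2 * real n * (e * N f) + e * N f" using a(2)[OF x f(1)] by linarith
      also have "\<dots> = (2 * real n + 1) * e * N f" by (simp add: algebra_simps)
      \<comment> \<open>The factor \<open>2\<close> is the radius of the ball in \<open>minimal_error_of_kernel_bound\<close>.\<close>
      also have "\<dots> \<le> (2 * real n + 1) * e * 2" using f(2) e by (intro mult_left_mono) auto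
      finally show ?thesis by (simp add: algebra_simps)
    qed
    show "lp_norm \<infinity> M f \<le> (4 * real n + 2) * e"
      by (rule lp_inf_leI) (use AEX pt e lp_space_measurable[OF S(9)[OF f(1)]] in \<open>auto elim: eventually_mono\<close>)
  qed simp
qed

text \<open>
  The infinite rate keeps the zero space out of the infimum in the power function, and with it every space over
  the empty domain, where there are no function values.
\<close>
lemma rate_all_trivial_space:
  fixes M :: "'a measure"
  assumes p: "1 \<le> p" and adm: "admissible_space p M F N" and F: "F = {\<lambda>x. 0}"
  shows "rate_all p M F N = \<infinity>"
proof -
  have 0: "(\<lambda>f. 0) \<in> Lambda_all F N" 
    unfolding Lambda_all_def by (intro CollectI conjI exI[of _ 0]) simp_all
  have "minimal_error p M F N (Lambda_all F N) n \<le> ereal 0" for n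
    by (rule minimal_error_of_kernel_bound[OF p adm order_refl, of "replicate n (\<lambda>f. 0)"])
      (use 0 F lp_zero(2)[OF p, of M] in auto)
  then have "minimal_error p M F N (Lambda_all F N) n = 0" for n
    using minimal_error_nonneg[OF p adm] by (metis order_antisym zero_ereal_def)
  then have me: "minimal_error p M F N (Lambda_all F N) = (\<lambda>n. 0)" by auto
  have "ereal r \<le> rate_all p M F N" if "0 < r" for r
    unfolding rate_all_def me by (rule rate_geI[OF that]) simp
  then have "ereal r \<le> rate_all p M F N" for r
    by (cases "0 < r") (auto intro: order_trans[of "ereal r" "ereal 1"])
  then show ?thesis by (rule ereal_top)
qed

lemma rate_std_ge:
  fixes M :: "'a measure"
  assumes adm: "admissible_space \<infinity> M F N" and r: "rate_all \<infinity> M F N = ereal r" "1 < r"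
  shows "ereal (r - 1) \<le> rate_std \<infinity> M F N"
proof -
  have p: "1 \<le> (\<infinity> :: ereal)" by simp
  have ne: "space M \<noteq> {}"
  proof
    assume "space M = {}"
    then have z: "f = (\<lambda>x. 0)" if "f \<in> F" for f
      by (intro ext space_facts(1)[OF p adm that]) simp
    have "F = {\<lambda>x. 0}"
    proof (rule Set.set_eqI)
      show "f \<in> F \<longleftrightarrow> f \<in> {\<lambda>x. 0}" for f
        using z[of f] space_facts(2)[OF p adm] by (metis singleton_iff)
    qed
    then have "rate_all \<infinity> M F N = \<infinity>" by (rule rate_all_trivial_space[OF p adm])
    then show False using r(1) by simp
  qed
  let ?a = "minimal_error \<infinity> M F N (Lambda_all F N)" and ?s = "minimal_error \<infinity> M F N (Lambda_std (space M))"
  have a0: "0 \<le> ?a n" and s0: "0 \<le> ?s n" for n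
    by (rule minimal_error_nonneg[OF p adm])+
  show ?thesis unfolding rate_std_def
  proof (rule rate_geI)
    fix \<beta> assume b: "0 \<le> \<beta>" "\<beta> < r - 1"
    have lim: "(\<lambda>n. ?a n * ereal (real n powr (\<beta> + 1))) \<longlonglongrightarrow> 0"
      by (rule rate_geD) (use b r a0 in \<open>auto simp: rate_all_def\<close>)
    show "(\<lambda>n. ?s n * ereal (real n powr \<beta>)) \<longlonglongrightarrow> 0"
    proof (rule order_tendstoI)
      fix y :: ereal assume "y < 0"
      moreover have "0 \<le> ?s n * ereal (real n powr \<beta>)" for n using s0 by simp
      ultimately show "\<forall>\<^sub>F n in sequentially. y < ?s n * ereal (real n powr \<beta>)"
        by (intro always_eventually allI) (rule less_le_trans)
    next
      fix y :: ereal assume y: "0 < y"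
      obtain \<eta> where eta: "0 < \<eta>" "ereal \<eta> < y" using y using ereal_dense2[OF y] by (auto simp: zero_ereal_def)
      have "\<forall>\<^sub>F n in sequentially. ?a n * ereal (real n powr (\<beta> + 1)) < ereal (\<eta> / 6)"
        using lim eta by (intro order_tendstoD(2)) auto
      then show "\<forall>\<^sub>F n in sequentially. ?s n * ereal (real n powr \<beta>) < y"
        using eventually_gt_at_top[of 0]
      proof eventually_elim
        case (elim n)
        define q where "q = real n powr (\<beta> + 1)"
        have q: "0 < q" "real n powr \<beta> = q / n" using elim by (auto simp: q_def powr_add)
        have "?a n < ereal (\<eta> / 6 / q)"
        proof (cases "?a n")
          case (real c)
          then show ?thesis using elim q by (simp add: q_def[symmetric] pos_less_divide_eq)
        qed (use elim q a0[of n] in \<open>auto simp: q_def[symmetric]\<close>)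
        then have "?s n \<le> ereal ((4 * real n + 2) * (\<eta> / 6 / q))" by (rule sampling_error_le[OF adm ne])
        then have "?s n * ereal (real n powr \<beta>) \<le> ereal ((4 * real n + 2) * (\<eta> / 6 / q)) * ereal (q / n)"
          unfolding q(2) using q by (intro ereal_mult_right_mono) auto
        also have "\<dots> = ereal ((4 * real n + 2) / (6 * n) * \<eta>)" using q elim by simp
        also have "\<dots> \<le> ereal (1 * \<eta>)" using eta elim by (simp only: ereal_less_eq, intro mult_right_mono) auto
        finally show ?case using eta by (simp add: le_less_trans)
      qed
    qed
  qed (use r in simp)
qed

section \<open>A Banach space with a hidden line\<close>

lemma lp_norm_finite_support:
  assumes p: "1 \<le> p" and T: "finite T" "T' \<subseteq> T" and z: "\<And>x. x \<in> T - T' \<Longrightarrow> f x = 0"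
  shows "ell_norm p T f \<le> ell_norm p T' f"
proof (cases "p = \<infinity>")
  case True
  have T': "finite T'" using T finite_subset by blast
  have "\<bar>f x\<bar> \<le> ell_norm \<infinity> T' f" if "x \<in> T" for x
    using lp_count_point[of \<infinity> f T' x] lp_space_finite[OF T'] z[of x] that lp_norm_nonneg[of \<infinity> "count_space T'" f]
    by (cases "x \<in> T'") auto
  then show ?thesis unfolding True by (intro lp_inf_leI) (auto simp: AE_count_space lp_norm_nonneg)
next
  case False
  have "finite T'" using T finite_subset by blast
  moreover have "(\<Sum>x\<in>T. \<bar>f x\<bar> powr real_of_ereal p) = (\<Sum>x\<in>T'. \<bar>f x\<bar> powr real_of_ereal p)"
    using T z by (intro sum.mono_neutral_right) auto
  ultimately show ?thesis using False T by (simp add: lp_norm_finite)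
qed

lemma homogeneous_system_nontrivial_solution:
  fixes l :: "nat \<Rightarrow> 'i \<Rightarrow> real"
  assumes "finite S" "n < card S"
  shows "\<exists>y. (\<exists>i\<in>S. y i \<noteq> 0) \<and> (\<forall>k<n. (\<Sum>i\<in>S. l k i * y i) = 0)"
  using assms
proof (induction n arbitrary: S l)
  case 0
  then have "S \<noteq> {}" by auto
  then show ?case by (intro exI[of _ "\<lambda>i. 1"]) auto
next
  case (Suc n)
  show ?case
  proof (cases "\<forall>i\<in>S. l n i = 0")
    case True
    obtain y where "\<exists>i\<in>S. y i \<noteq> 0" "\<forall>k<n. (\<Sum>i\<in>S. l k i * y i) = 0"
      using Suc.IH[OF Suc.prems(1), of l] Suc.prems(2) by auto
    then show ?thesis using True by (intro exI[of _ y]) (auto simp: less_Suc_eq)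
  next
    case False
    then obtain j where j: "j \<in> S" "l n j \<noteq> 0" by blast
    define l' where "l' k i = l k i - l k j * l n i / l n j" for k i
    have "n < card (S - {j})" using Suc.prems j by simp
    then obtain y where y: "\<exists>i\<in>S - {j}. y i \<noteq> 0" "\<forall>k<n. (\<Sum>i\<in>S - {j}. l' k i * y i) = 0"
      using Suc.IH[of "S - {j}" l'] Suc.prems(1) by auto
    define s where "s = (\<Sum>i\<in>S - {j}. l n i * y i)"
    define y' where "y' = y(j := - s / l n j)"
    have sum: "(\<Sum>i\<in>S. l k i * y' i) = (\<Sum>i\<in>S - {j}. l k i * y i) - l k j * s / l n j" for k
      using Suc.prems(1) j(1) by (simp add: sum.remove[of S j] y'_def)
    have "(\<Sum>i\<in>S. l k i * y' i) = 0" if "k < Suc n" for k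
    proof (cases "k = n")
      case True
      then show ?thesis using j(2) unfolding sum by (simp add: s_def)
    next
      case False
      then have "(\<Sum>i\<in>S - {j}. l' k i * y i) = 0" using that y(2) by simp
      moreover have "(\<Sum>i\<in>S - {j}. l' k i * y i) = (\<Sum>i\<in>S - {j}. l k i * y i) - l k j * s / l n j"
        by (simp add: l'_def s_def left_diff_distrib sum_subtractf sum_distrib_left sum_divide_distrib mult.assoc)
      ultimately show ?thesis unfolding sum by simp
    qed
    moreover have "\<exists>i\<in>S. y' i \<noteq> 0" using y(1) by (auto simp: y'_def)
    ultimately show ?thesis by blast
  qed
qed

abbreviation nat_count :: "nat measure" where "nat_count \<equiv> count_space UNIV"

text \<open>
  The last assumption says that \<open>g\<close> does not belong to the weighted \<open>\<ell>\<^sub>1\<close> space, so that the decomposition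
  \<open>c * g i + u i\<close> of the values at the points \<open>a i\<close> is unique. The number \<open>c\<close> is then determined by the
  behaviour of the function at infinity and not by finitely many values.
\<close>
locale hidden_line_space =
  fixes a b :: "nat \<Rightarrow> 'a" and p :: ereal and r :: real and w g :: "nat \<Rightarrow> real" and w0 :: real
  assumes inj: "inj a" "inj b" and disj: "\<And>i j. a i \<noteq> b j"
    and p: "1 \<le> p" and r: "0 < r"
    and w0: "0 < w0" "\<And>i. w0 \<le> w i"
    and g: "\<And>i. 0 \<le> g i" "g \<in> lp_space p nat_count"
    and wg: "\<And>B. \<exists>n. B < (\<Sum>i<n. w i * g i)"
begin

definition Omega :: "'a set" where "Omega = range a \<union> range b"
text \<open>
  For a candidate \<open>c\<close>, the sequence \<open>u\<close> multiplied by its weights.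
\<close>
definition rest :: "real \<Rightarrow> ('a \<Rightarrow> real) \<Rightarrow> nat \<Rightarrow> real" where
  "rest c f = (\<lambda>i. w i * (f (a i) - c * g i))"
definition weighted_b :: "('a \<Rightarrow> real) \<Rightarrow> nat \<Rightarrow> real" where
  "weighted_b f = (\<lambda>i. (real i + 1) powr r * f (b i))"
definition F :: "('a \<Rightarrow> real) set" where
  "F = {f. (\<forall>x. x \<notin> Omega \<longrightarrow> f x = 0) \<and> (\<exists>c. rest c f \<in> lp_space 1 nat_count) \<and> weighted_b f \<in> lp_space p nat_count}"
definition coef :: "('a \<Rightarrow> real) \<Rightarrow> real" where
  "coef f = (THE c. rest c f \<in> lp_space 1 nat_count)"
definition N :: "('a \<Rightarrow> real) \<Rightarrow> real" where
  "N f = \<bar>coef f\<bar> + lp_norm 1 nat_count (rest (coef f) f) + lp_norm p nat_count (weighted_b f)"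

lemma w_pos: "0 < w i" using w0(1) w0(2)[of i] by linarith

lemma rest_add: "rest (c + d) (\<lambda>x. f x + h x) = (\<lambda>i. rest c f i + rest d h i)"
  and rest_diff: "rest (c - d) (\<lambda>x. f x - h x) = (\<lambda>i. rest c f i - rest d h i)"
  and rest_scale: "rest (k * c) (\<lambda>x. k * f x) = (\<lambda>i. k * rest c f i)"
  and weighted_b_add: "weighted_b (\<lambda>x. f x + h x) = (\<lambda>i. weighted_b f i + weighted_b h i)"
  and weighted_b_diff: "weighted_b (\<lambda>x. f x - h x) = (\<lambda>i. weighted_b f i - weighted_b h i)"
  and weighted_b_scale: "weighted_b (\<lambda>x. k * f x) = (\<lambda>i. k * weighted_b f i)"
  by (auto simp: rest_def weighted_b_def algebra_simps)

lemma sum_abs_le_lp1: "x \<in> lp_space 1 nat_count \<Longrightarrow> finite S \<Longrightarrow> (\<Sum>i\<in>S. \<bar>x i\<bar>) \<le> lp_norm 1 nat_count x"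
  using lp_count_subset(2)[of 1 x UNIV S] by (simp add: lp1_norm_finite)

lemma coef_unique:
  assumes "rest c f \<in> lp_space 1 nat_count" "rest d f \<in> lp_space 1 nat_count"
  shows "c = d"
proof (rule ccontr)
  assume ne: "c \<noteq> d"
  let ?x = "\<lambda>i. rest d f i - rest c f i"
  have x: "?x \<in> lp_space 1 nat_count" using lp_diff(1)[OF _ assms(2,1)] by simp
  have xeq: "\<bar>?x i\<bar> = \<bar>c - d\<bar> * (w i * g i)" for i
  proof -
    have "?x i = (c - d) * (w i * g i)" by (simp add: rest_def algebra_simps)
    then show ?thesis using g(1)[of i] w_pos[of i] by (simp add: abs_mult)
  qed
  obtain n where n: "lp_norm 1 nat_count ?x / \<bar>c - d\<bar> < (\<Sum>i<n. w i * g i)" using wg by blast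
  have "\<bar>c - d\<bar> * (\<Sum>i<n. w i * g i) \<le> lp_norm 1 nat_count ?x"
    using sum_abs_le_lp1[OF x, of "{..<n}"] by (simp only: xeq sum_distrib_left finite_lessThan)
  then show False using n ne by (simp add: pos_divide_less_eq mult.commute)
qed

lemma coefI: "rest c f \<in> lp_space 1 nat_count \<Longrightarrow> coef f = c"
  unfolding coef_def using coef_unique by blast

lemma F_rest: "f \<in> F \<Longrightarrow> rest (coef f) f \<in> lp_space 1 nat_count"
  using coefI by (auto simp: F_def)

lemma F_weighted_b: "f \<in> F \<Longrightarrow> weighted_b f \<in> lp_space p nat_count"
  by (simp add: F_def)

lemma F_intro:
  "(\<And>x. x \<notin> Omega \<Longrightarrow> f x = 0) \<Longrightarrow> rest c f \<in> lp_space 1 nat_count \<Longrightarrow>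
    weighted_b f \<in> lp_space p nat_count \<Longrightarrow> f \<in> F"
  by (auto simp: F_def)

lemma F_zero_outside: "f \<in> F \<Longrightarrow> x \<notin> Omega \<Longrightarrow> f x = 0"
  by (simp add: F_def)

lemma F_add:
  assumes "f \<in> F" "h \<in> F"
  shows "(\<lambda>x. f x + h x) \<in> F" "coef (\<lambda>x. f x + h x) = coef f + coef h"
proof -
  have *: "rest (coef f + coef h) (\<lambda>x. f x + h x) \<in> lp_space 1 nat_count"
    unfolding rest_add by (intro lp_add F_rest assms) simp
  show "(\<lambda>x. f x + h x) \<in> F"
    using assms by (intro F_intro[OF _ *])
      (auto simp: F_zero_outside weighted_b_add intro: lp_add(1)[OF p] F_weighted_b)
  show "coef (\<lambda>x. f x + h x) = coef f + coef h" by (rule coefI[OF *])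
qed

lemma F_scale:
  assumes "f \<in> F"
  shows "(\<lambda>x. k * f x) \<in> F" "coef (\<lambda>x. k * f x) = k * coef f"
proof -
  have *: "rest (k * coef f) (\<lambda>x. k * f x) \<in> lp_space 1 nat_count"
    unfolding rest_scale by (intro lp_scale F_rest assms) simp
  show "(\<lambda>x. k * f x) \<in> F"
    using assms by (intro F_intro[OF _ *])
      (auto simp: F_zero_outside weighted_b_scale intro: lp_scale(1)[OF p] F_weighted_b)
  show "coef (\<lambda>x. k * f x) = k * coef f" by (rule coefI[OF *])
qed

lemma F_diff:
  assumes "f \<in> F" "h \<in> F"
  shows "(\<lambda>x. f x - h x) \<in> F" "coef (\<lambda>x. f x - h x) = coef f - coef h"
  using F_add[OF assms(1) F_scale(1)[OF assms(2), of "-1"]] F_scale(2)[OF assms(2), of "-1"] by auto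

lemma N_components:
  shows "\<bar>coef f\<bar> \<le> N f" "lp_norm 1 nat_count (rest (coef f) f) \<le> N f" "lp_norm p nat_count (weighted_b f) \<le> N f"
  using lp_norm_nonneg[of 1 nat_count "rest (coef f) f"] lp_norm_nonneg[of p nat_count "weighted_b f"]
  by (auto simp: N_def)

lemma N_nonneg: "0 \<le> N f"
  using N_components(1)[of f] by linarith

lemma N_add: "f \<in> F \<Longrightarrow> h \<in> F \<Longrightarrow> N (\<lambda>x. f x + h x) \<le> N f + N h"
  using lp_add(2)[OF _ F_rest F_rest, of f h] lp_add(2)[OF p F_weighted_b F_weighted_b, of f h]
    abs_triangle_ineq[of "coef f" "coef h"]
  by (simp add: N_def F_add(2) rest_add weighted_b_add)

lemma N_scale: "f \<in> F \<Longrightarrow> N (\<lambda>x. k * f x) = \<bar>k\<bar> * N f"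
  using lp_scale(2)[OF _ F_rest, of f k] lp_scale(2)[OF p F_weighted_b, of f k]
  by (simp add: N_def F_scale(2) rest_scale weighted_b_scale abs_mult distrib_left)

lemma zero_F: "(\<lambda>x. 0) \<in> F" "N (\<lambda>x. 0) = 0"
proof -
  have *: "rest 0 (\<lambda>x. 0) \<in> lp_space 1 nat_count" by (simp add: rest_def lp_zero)
  show "(\<lambda>x. 0) \<in> F" by (rule F_intro[OF _ *]) (simp_all add: weighted_b_def lp_zero p)
  then show "N (\<lambda>x. 0) = 0" using N_scale[of "\<lambda>x. 0" 0] by simp
qed

lemma value_a: "f \<in> F \<Longrightarrow> \<bar>f (a i) - coef f * g i\<bar> \<le> N f / w0"
proof -
  assume f: "f \<in> F"
  have "w0 * \<bar>f (a i) - coef f * g i\<bar> \<le> w i * \<bar>f (a i) - coef f * g i\<bar>"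
    using w0 by (intro mult_right_mono) auto
  also have "\<dots> = \<bar>rest (coef f) f i\<bar>" using w_pos[of i] by (simp add: rest_def abs_mult)
  also have "\<dots> \<le> N f"
    using lp_count_point[OF _ F_rest[OF f], of i] N_components(2)[of f] by simp
  finally show ?thesis using w0(1) by (simp add: pos_le_divide_eq mult.commute)
qed

lemma value_b: "f \<in> F \<Longrightarrow> \<bar>f (b i)\<bar> \<le> N f"
proof -
  assume f: "f \<in> F"
  have "1 * \<bar>f (b i)\<bar> \<le> (real i + 1) powr r * \<bar>f (b i)\<bar>"
    using r by (intro mult_right_mono ge_one_powr_ge_zero) auto
  also have "\<dots> = \<bar>weighted_b f i\<bar>" by (simp add: weighted_b_def abs_mult)
  also have "\<dots> \<le> N f" using lp_count_point[OF p F_weighted_b[OF f], of i] N_components(3)[of f] by simp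
  finally show ?thesis by simp
qed

lemma N_zero_iff: "f \<in> F \<Longrightarrow> N f = 0 \<longleftrightarrow> f = (\<lambda>x. 0)"
proof
  assume f: "f \<in> F" and z: "N f = 0"
  have "coef f = 0" using N_components(1)[of f] z by simp
  then have "f (a i) = 0" for i using value_a[OF f, of i] z by simp
  moreover have "f (b i) = 0" for i using value_b[OF f, of i] z by simp
  ultimately have "f x = 0" for x using F_zero_outside[OF f, of x] by (auto simp: Omega_def)
  then show "f = (\<lambda>x. 0)" by (intro ext)
qed (use zero_F in simp)

text \<open>
  The map from \<open>f\<close> to \<open>c\<close>, \<open>w * u\<close> and the weighted values at the points \<open>b i\<close> identifies \<open>F\<close> with the product of
  the real line, \<open>\<ell>\<^sub>1\<close> and \<open>\<ell>\<^sub>p\<close>.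
\<close>
lemma F_complete:
  assumes u: "\<And>n. u n \<in> F"
    and C: "\<And>e. 0 < e \<Longrightarrow> \<exists>n0. \<forall>m\<ge>n0. \<forall>n\<ge>n0. N (\<lambda>x. u m x - u n x) < e"
  shows "\<exists>f\<in>F. (\<lambda>n. N (\<lambda>x. u n x - f x)) \<longlonglongrightarrow> 0"
proof -
  let ?R = "\<lambda>n. rest (coef (u n)) (u n)"
  have parts: "\<bar>coef (u m) - coef (u n)\<bar> \<le> N (\<lambda>x. u m x - u n x)"
    "lp_norm 1 nat_count (\<lambda>i. ?R m i - ?R n i) \<le> N (\<lambda>x. u m x - u n x)"
    "lp_norm p nat_count (\<lambda>i. weighted_b (u m) i - weighted_b (u n) i) \<le> N (\<lambda>x. u m x - u n x)" for m n
    using N_components[of "\<lambda>x. u m x - u n x"]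
    by (simp_all add: F_diff(2)[OF u u] rest_diff weighted_b_diff)
  have "Cauchy (\<lambda>n. coef (u n))"
  proof (rule metric_CauchyI)
    fix e :: real assume "0 < e"
    then obtain n0 where n0: "\<forall>m\<ge>n0. \<forall>n\<ge>n0. N (\<lambda>x. u m x - u n x) < e" using C by blast
    have "dist (coef (u m)) (coef (u n)) < e" if "m \<ge> n0" "n \<ge> n0" for m n
      using parts(1)[of m n] n0 that unfolding dist_real_def by (meson order_le_less_trans)
    then show "\<exists>n0. \<forall>m\<ge>n0. \<forall>n\<ge>n0. dist (coef (u m)) (coef (u n)) < e" by blast
  qed
  then obtain c where c: "(\<lambda>n. coef (u n)) \<longlonglongrightarrow> c" by (metis Cauchy_convergent convergent_def)
  have C1: "\<exists>n0. \<forall>m\<ge>n0. \<forall>n\<ge>n0. lp_norm 1 nat_count (\<lambda>i. ?R m i - ?R n i) < e" if "0 < e" for e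
    using C[OF that] parts(2) by (meson order_le_less_trans)
  have Cp: "\<exists>n0. \<forall>m\<ge>n0. \<forall>n\<ge>n0. lp_norm p nat_count (\<lambda>i. weighted_b (u m) i - weighted_b (u n) i) < e" if "0 < e" for e
    using C[OF that] parts(3) by (meson order_le_less_trans)
  obtain x where x: "x \<in> lp_space 1 nat_count" "(\<lambda>n. lp_norm 1 nat_count (\<lambda>i. ?R n i - x i)) \<longlonglongrightarrow> 0"
    by (rule lp_count_complete[of 1 ?R UNIV]) (use F_rest[OF u] C1 in auto)
  obtain y where y: "y \<in> lp_space p nat_count" "(\<lambda>n. lp_norm p nat_count (\<lambda>i. weighted_b (u n) i - y i)) \<longlonglongrightarrow> 0"
    by (rule lp_count_complete[OF p, of "\<lambda>n. weighted_b (u n)" UNIV]) (use F_weighted_b[OF u] Cp in auto)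
  define f where "f z = (if z \<in> range a then x (inv_into UNIV a z) / w (inv_into UNIV a z) + c * g (inv_into UNIV a z)
      else if z \<in> range b then y (inv_into UNIV b z) / (real (inv_into UNIV b z) + 1) powr r else 0)" for z
  have fa: "f (a i) = x i / w i + c * g i" for i using inj by (simp add: f_def)
  have fb: "f (b i) = y i / (real i + 1) powr r" for i
    using inj disj by (auto simp: f_def image_iff dest: sym)
  have Rf: "rest c f = x" using w_pos by (auto simp: rest_def fa less_imp_neq[symmetric])
  have Wf: "weighted_b f = y" by (auto simp: weighted_b_def fb)
  have f: "f \<in> F" by (rule F_intro[of f c]) (use x y Rf Wf in \<open>auto simp: f_def Omega_def\<close>)
  have cf: "coef f = c" by (rule coefI) (use x Rf in simp)
  have "N (\<lambda>z. u n z - f z) = \<bar>coef (u n) - c\<bar> + lp_norm 1 nat_count (\<lambda>i. ?R n i - x i)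
      + lp_norm p nat_count (\<lambda>i. weighted_b (u n) i - y i)" for n
    unfolding N_def F_diff(2)[OF u f] cf rest_diff weighted_b_diff Rf Wf ..
  moreover have "(\<lambda>n. \<bar>coef (u n) - c\<bar> + lp_norm 1 nat_count (\<lambda>i. ?R n i - x i)
      + lp_norm p nat_count (\<lambda>i. weighted_b (u n) i - y i)) \<longlonglongrightarrow> \<bar>c - c\<bar> + 0 + 0"
    using c x(2) y(2) by (intro tendsto_intros)
  ultimately show ?thesis using f by (intro bexI[of _ f]) simp_all
qed

lemma lp_norm_split:
  assumes "finite S" "S \<subseteq> Omega"
  obtains S1 S2 where "finite S1" "finite S2" "S = a ` S1 \<union> b ` S2"
    "ell_norm p S f
      \<le> ell_norm p S1 (\<lambda>i. f (a i)) + ell_norm p S2 (\<lambda>i. f (b i))"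
proof -
  define S1 S2 where "S1 = vimage a S" and "S2 = vimage b S"
  have fin: "finite S1" "finite S2"
    using assms(1) inj by (auto simp: S1_def S2_def intro: finite_vimageI)
  have S: "S = a ` S1 \<union> b ` S2" using assms(2) by (auto simp: S1_def S2_def Omega_def)
  let ?f1 = "\<lambda>x. if x \<in> range a then f x else 0" and ?f2 = "\<lambda>x. if x \<in> range a then 0 else f x"
  have "ell_norm p S f = ell_norm p S (\<lambda>x. ?f1 x + ?f2 x)"
    by (rule arg_cong[of _ _ "ell_norm p S"]) auto
  also have "\<dots> \<le> ell_norm p S ?f1 + ell_norm p S ?f2"
    by (rule lp_add(2)[OF p lp_space_finite lp_space_finite, OF assms(1) assms(1)])
  also have "ell_norm p S ?f1 \<le> ell_norm p (a ` S1) ?f1"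
    using disj by (intro lp_norm_finite_support[OF p assms(1)]) (auto simp: S)
  also have "ell_norm p (a ` S1) ?f1 = ell_norm p S1 (\<lambda>i. ?f1 (a i))"
    by (rule lp_norm_reindex_finite[OF p fin(1)]) (use inj in \<open>auto intro: inj_on_subset\<close>)
  also have "ell_norm p S ?f2 \<le> ell_norm p (b ` S2) ?f2"
    by (intro lp_norm_finite_support[OF p assms(1)]) (auto simp: S)
  also have "ell_norm p (b ` S2) ?f2 = ell_norm p S2 (\<lambda>i. ?f2 (b i))"
    by (rule lp_norm_reindex_finite[OF p fin(2)]) (use inj in \<open>auto intro: inj_on_subset\<close>)
  also have "(\<lambda>i. ?f1 (a i)) = (\<lambda>i. f (a i))" by auto
  also have "(\<lambda>i. ?f2 (b i)) = (\<lambda>i. f (b i))" using disj by (auto simp: image_iff fun_eq_iff dest: sym)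
  finally show ?thesis using that fin S by auto
qed

lemma lp_norm_a_le:
  assumes f: "f \<in> F" and S: "finite S"
  shows "ell_norm p S (\<lambda>i. f (a i)) \<le> (lp_norm p nat_count g + 1 / w0) * N f"
proof -
  have "ell_norm p S (\<lambda>i. f (a i))
      = ell_norm p S (\<lambda>i. coef f * g i + (f (a i) - coef f * g i))" by simp
  also have "\<dots> \<le> ell_norm p S (\<lambda>i. coef f * g i)
      + ell_norm p S (\<lambda>i. f (a i) - coef f * g i)"
    by (rule lp_add(2)[OF p lp_space_finite lp_space_finite, OF S S])
  also have "ell_norm p S (\<lambda>i. coef f * g i) = \<bar>coef f\<bar> * ell_norm p S g"
    by (rule lp_scale(2)[OF p lp_space_finite[OF S]])
  also have "\<dots> \<le> N f * lp_norm p nat_count g"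
    using N_components(1) lp_count_subset(2)[OF p g(2)] lp_norm_nonneg N_nonneg by (intro mult_mono) auto
  also have "ell_norm p S (\<lambda>i. f (a i) - coef f * g i) \<le> (\<Sum>i\<in>S. \<bar>f (a i) - coef f * g i\<bar>)"
    by (rule lp_norm_le_sum[OF p S])
  also have "\<dots> \<le> (\<Sum>i\<in>S. \<bar>rest (coef f) f i\<bar> / w0)"
  proof (intro sum_mono)
    fix i
    have "w0 * \<bar>f (a i) - coef f * g i\<bar> \<le> w i * \<bar>f (a i) - coef f * g i\<bar>"
      using w0 by (intro mult_right_mono) auto
    then show "\<bar>f (a i) - coef f * g i\<bar> \<le> \<bar>rest (coef f) f i\<bar> / w0"
      using w_pos[of i] w0(1) by (simp add: rest_def abs_mult pos_le_divide_eq mult.commute)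
  qed
  also have "\<dots> \<le> N f / w0"
    using sum_abs_le_lp1[OF F_rest[OF f] S] N_components(2)[of f] w0(1)
    by (simp add: divide_right_mono flip: sum_divide_distrib)
  finally show ?thesis by (simp add: algebra_simps)
qed

lemma lp_norm_b_le:
  assumes f: "f \<in> F" and S: "finite S"
  shows "ell_norm p S (\<lambda>i. f (b i)) \<le> lp_norm p nat_count (weighted_b f)"
proof -
  have "\<bar>f (b i)\<bar> \<le> \<bar>weighted_b f i\<bar>" for i
  proof -
    have "1 * \<bar>f (b i)\<bar> \<le> (real i + 1) powr r * \<bar>f (b i)\<bar>"
      using r by (intro mult_right_mono ge_one_powr_ge_zero) auto
    then show ?thesis by (simp add: weighted_b_def abs_mult)
  qed
  then have "ell_norm p S (\<lambda>i. f (b i)) \<le> ell_norm p S (weighted_b f)"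
    by (intro lp_mono[OF p lp_space_finite[OF S]]) auto
  also have "\<dots> \<le> lp_norm p nat_count (weighted_b f)" by (rule lp_count_subset(2)[OF p F_weighted_b[OF f]]) simp
  finally show ?thesis .
qed

lemma F_embedding:
  assumes f: "f \<in> F"
  shows "f \<in> ell_space p Omega"
    "ell_norm p Omega f \<le> (lp_norm p nat_count g + 1 / w0 + 1) * N f"
proof -
  have *: "ell_norm p S f \<le> (lp_norm p nat_count g + 1 / w0 + 1) * N f"
    if S: "finite S" "S \<subseteq> Omega" for S
  proof -
    obtain S1 S2 where "finite S1" "finite S2" "S = a ` S1 \<union> b ` S2" "ell_norm p S f
      \<le> ell_norm p S1 (\<lambda>i. f (a i)) + ell_norm p S2 (\<lambda>i. f (b i))"
      by (rule lp_norm_split[OF S, of f])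
    then show ?thesis
      using lp_norm_a_le[OF f, of S1] lp_norm_b_le[OF f, of S2] N_components(3)[of f]
      unfolding distrib_right by linarith
  qed
  have "0 \<le> (lp_norm p nat_count g + 1 / w0 + 1) * N f"
    using w0(1) N_nonneg lp_norm_nonneg[of p nat_count g] by (intro mult_nonneg_nonneg) auto
  then show "f \<in> ell_space p Omega"
    "ell_norm p Omega f \<le> (lp_norm p nat_count g + 1 / w0 + 1) * N f"
    using lp_count_leI[OF p _ *] by auto
qed

lemma admissible: "admissible_space p (count_space Omega) F N"
proof -
  have point: "\<exists>C. \<forall>f\<in>F. \<bar>f x\<bar> \<le> C * N f" if "x \<in> Omega" for x
  proof -
    have "(\<exists>i. x = a i) \<or> (\<exists>i. x = b i)" using that by (auto simp: Omega_def)
    then consider i where "x = a i" | i where "x = b i" by blast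
    then show ?thesis
    proof cases
      case 1
      have "\<bar>f x\<bar> \<le> (g i + 1 / w0) * N f" if "f \<in> F" for f
      proof -
        have "\<bar>f x\<bar> \<le> \<bar>coef f\<bar> * g i + \<bar>f (a i) - coef f * g i\<bar>"
          using abs_triangle_ineq[of "coef f * g i" "f (a i) - coef f * g i"] g(1)[of i] 1
          by (simp add: abs_mult)
        also have "\<dots> \<le> N f * g i + N f / w0"
          using value_a[OF that, of i] N_components(1)[of f] g(1)[of i]
          by (intro add_mono mult_right_mono) auto
        finally show ?thesis by (simp add: algebra_simps)
      qed
      then show ?thesis by blast
    next
      case 2
      then show ?thesis using value_b by (intro exI[of _ 1]) auto
    qed
  qed
  have complete: "\<forall>u. (\<forall>n::nat. u n \<in> F) \<and>
       (\<forall>\<epsilon>>0. \<exists>n\<^sub>0. \<forall>m\<ge>n\<^sub>0. \<forall>n\<ge>n\<^sub>0. N (\<lambda>x. u m x - u n x) < \<epsilon>) \<longrightarrow>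
       (\<exists>f\<in>F. (\<lambda>n. N (\<lambda>x. u n x - f x)) \<longlonglongrightarrow> 0)"
    by (intro allI impI F_complete) auto
  have "banach_function_space Omega F N"
    unfolding banach_function_space_def
  proof (intro conjI complete)
    show "\<forall>f\<in>F. \<forall>x. x \<notin> Omega \<longrightarrow> f x = 0" using F_zero_outside by blast
    show "\<forall>f\<in>F. \<forall>h\<in>F. (\<lambda>x. f x + h x) \<in> F" by (intro ballI F_add(1))
    show "\<forall>c. \<forall>f\<in>F. (\<lambda>x. c * f x) \<in> F" by (intro allI ballI F_scale(1))
    show "\<forall>f\<in>F. (N f = 0) = (f = (\<lambda>x. 0))" by (intro ballI N_zero_iff)
    show "\<forall>f\<in>F. \<forall>h\<in>F. N (\<lambda>x. f x + h x) \<le> N f + N h" by (intro ballI N_add)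
    show "\<forall>c. \<forall>f\<in>F. N (\<lambda>x. c * f x) = \<bar>c\<bar> * N f" by (intro allI ballI N_scale)
    show "\<forall>x\<in>Omega. \<exists>C. \<forall>f\<in>F. \<bar>f x\<bar> \<le> C * N f" by (intro ballI point)
  qed (use zero_F N_nonneg in blast)+
  moreover have "embedded_in_lp p (count_space Omega) F N"
    unfolding embedded_in_lp_def
  proof (intro conjI impI)
    show "F \<subseteq> ell_space p Omega" using F_embedding(1) by blast
    show "\<exists>C. \<forall>f\<in>F. ell_norm p Omega f \<le> C * N f" using F_embedding(2) by blast
    show "\<forall>f\<in>F. (AE x in count_space Omega. f x = 0) \<longrightarrow> f = (\<lambda>x. 0)"
    proof (intro ballI impI ext)
      fix f x assume f: "f \<in> F" "AE x in count_space Omega. f x = 0"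
      then show "f x = 0"
        using F_zero_outside[OF f(1), of x] by (cases "x \<in> Omega") (simp_all add: AE_count_space)
    qed
    show "AE x in count_space Omega. \<forall>f\<in>F. \<bar>f x\<bar> \<le> ell_norm p Omega f"
      using lp_count_point[OF p F_embedding(1)] by (auto simp: AE_count_space)
  qed
  ultimately show ?thesis by (simp add: admissible_space_def)
qed

end

section \<open>Errors in the space with a hidden line\<close>

lemma lp_space_finite_support:
  assumes p: "1 \<le> p" and T: "finite T" "\<And>x. x \<notin> T \<Longrightarrow> f x = 0"
  shows "f \<in> ell_space p A"
proof (rule lp_count_leI(1)[OF p])
  show "0 \<le> (\<Sum>x\<in>T. \<bar>f x\<bar>)" by (intro sum_nonneg) auto
  fix S assume S: "finite S" "S \<subseteq> A"
  have "ell_norm p S f \<le> (\<Sum>x\<in>S. \<bar>f x\<bar>)" by (rule lp_norm_le_sum[OF p S(1)])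
  also have "\<dots> = (\<Sum>x\<in>S \<inter> T. \<bar>f x\<bar>)" using S(1) T(2) by (intro sum.mono_neutral_right) auto
  also have "\<dots> \<le> (\<Sum>x\<in>T. \<bar>f x\<bar>)" using T(1) by (intro sum_mono2) auto
  finally show "ell_norm p S f \<le> (\<Sum>x\<in>T. \<bar>f x\<bar>)" .
qed

lemma sign_sum_linear:
  "sign_sum S T (\<lambda>i. x i + y i) = sign_sum S T x + sign_sum S T y"
  "sign_sum S T (\<lambda>i. c * x i) = c * sign_sum S T x"
  by (simp_all add: sign_sum_def distrib_left sum.distrib sum_distrib_left mult.left_commute)

lemma abs_sign_sum_le: "\<bar>sign_sum S T x\<bar> \<le> (\<Sum>i\<in>S. \<bar>x i\<bar>)"
  unfolding sign_sum_def by (rule order_trans[OF sum_abs]) (auto simp: abs_mult intro!: sum_mono)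

context hidden_line_space
begin

abbreviation err_all :: "nat \<Rightarrow> ereal" where
  "err_all \<equiv> minimal_error p (count_space Omega) F N (Lambda_all F N)"
abbreviation err_std :: "nat \<Rightarrow> ereal" where
  "err_std \<equiv> minimal_error p (count_space Omega) F N (Lambda_std (space (count_space Omega)))"

text \<open>
  A function supported by finitely many points \<open>b i\<close>, written as a sum of point functions so that linear
  functionals can be applied term by term.
\<close>
definition bsum :: "nat set \<Rightarrow> (nat \<Rightarrow> real) \<Rightarrow> 'a \<Rightarrow> real" where
  "bsum S y = (\<lambda>x. \<Sum>i\<in>S. y i * (if x = b i then 1 else 0))"

lemma bsum_values:
  assumes "finite S"
  shows "bsum S y (a i) = 0" "bsum S y (b i) = (if i \<in> S then y i else 0)"
    "x \<notin> Omega \<Longrightarrow> bsum S y x = 0"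
proof -
  show "bsum S y (a i) = 0" using disj by (simp add: bsum_def)
  have "bsum S y (b i) = (\<Sum>j\<in>S. if j = i then y j else 0)"
    unfolding bsum_def using inj(2) by (intro sum.cong) (auto simp: inj_def)
  then show "bsum S y (b i) = (if i \<in> S then y i else 0)" using assms by simp
  show "bsum S y x = 0" if "x \<notin> Omega" using that by (auto simp: bsum_def Omega_def intro!: sum.neutral)
qed

lemma bsum_F:
  assumes "finite S"
  shows "bsum S y \<in> F" "N (bsum S y) = lp_norm p nat_count (weighted_b (bsum S y))"
proof -
  have R: "rest 0 (bsum S y) = (\<lambda>i. 0)" by (simp add: rest_def bsum_values[OF assms])
  have W: "weighted_b (bsum S y) \<in> lp_space p nat_count"
    by (rule lp_space_finite_support[OF p assms]) (simp add: weighted_b_def bsum_values[OF assms])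
  show "bsum S y \<in> F"
    by (rule F_intro[of _ 0]) (simp_all add: R W lp_zero bsum_values[OF assms])
  have "coef (bsum S y) = 0" by (rule coefI) (simp add: R lp_zero)
  then show "N (bsum S y) = lp_norm p nat_count (weighted_b (bsum S y))"
    by (simp add: N_def R lp_zero)
qed

lemma Lambda_bsum:
  assumes L: "L \<in> Lambda_all F N" and S: "finite S"
  shows "L (bsum S y) = (\<Sum>i\<in>S. L (bsum {i} (\<lambda>_. 1)) * y i)"
  using S
proof (induction S)
  case empty
  have "L (\<lambda>x. 0 * bsum {} y x) = 0 * L (bsum {} y)"
    by (rule Lambda_all_facts(2)[OF p admissible L bsum_F(1)]) simp
  then show ?case by (simp add: bsum_def)
next
  case (insert j S)
  have e: "bsum (insert j S) y = (\<lambda>x. y j * bsum {j} (\<lambda>_. 1) x + bsum S y x)"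
    using insert by (auto simp: bsum_def)
  have "L (bsum (insert j S) y) = L (\<lambda>x. y j * bsum {j} (\<lambda>_. 1) x) + L (bsum S y)"
    unfolding e by (rule Lambda_all_facts(1)[OF p admissible L]) (use insert in \<open>auto intro: F_scale bsum_F\<close>)
  also have "L (\<lambda>x. y j * bsum {j} (\<lambda>_. 1) x) = y j * L (bsum {j} (\<lambda>_. 1))"
    by (rule Lambda_all_facts(2)[OF p admissible L bsum_F(1)]) simp
  finally show ?case using insert by simp
qed

text \<open>
  By a dimension count, \<open>n\<close> functionals vanish at some nonzero function supported by \<open>b 0, \<dots>, b n\<close>. There
  all weights of the norm are at most \<open>(n + 1) powr r\<close>.
\<close>
lemma err_all_lower: "ereal ((real n + 1) powr - r) \<le> err_all n"
proof (rule ccontr)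
  assume "\<not> ?thesis"
  then have less: "err_all n < ereal ((real n + 1) powr - r)" by simp
  obtain Ls where Ls: "length Ls = n" "set Ls \<subseteq> Lambda_all F N"
    and ker: "\<And>f. f \<in> F \<Longrightarrow> N f \<le> 1 \<Longrightarrow> \<forall>L\<in>set Ls. L f = 0 \<Longrightarrow>
      ell_norm p Omega f < (real n + 1) powr - r"
    using kernel_bound_of_minimal_error[OF p admissible order_refl less] by blast
  obtain y where y: "\<exists>i\<in>{..n}. y i \<noteq> 0" "\<forall>k<n. (\<Sum>i\<in>{..n}. (Ls ! k) (bsum {i} (\<lambda>_. 1)) * y i) = 0"
    using homogeneous_system_nontrivial_solution[of "{..n}" n "\<lambda>k i. (Ls ! k) (bsum {i} (\<lambda>_. 1))"] by auto
  define f where "f = bsum {..n} y"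
  have f: "f \<in> F" unfolding f_def by (rule bsum_F) simp
  have Lf: "L f = 0" if "L \<in> set Ls" for L
  proof -
    have "\<exists>k<n. L = Ls ! k" using that Ls(1) by (auto simp: in_set_conv_nth)
    then show ?thesis using Lambda_bsum[of L "{..n}" y] that Ls(2) y(2) by (auto simp: f_def)
  qed
  have "f \<noteq> (\<lambda>x. 0)"
  proof
    assume z: "f = (\<lambda>x. 0)"
    obtain i where "i \<in> {..n}" "y i \<noteq> 0" using y(1) by blast
    moreover have "f (b i) = (if i \<in> {..n} then y i else 0)"
      unfolding f_def by (rule bsum_values) simp
    ultimately show False using z by simp
  qed
  then have Nf: "0 < N f" using N_zero_iff[OF f] N_nonneg[of f] by (simp add: less_le)
  have "N f \<le> (real n + 1) powr r * ell_norm p Omega f"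
  proof -
    have "lp_norm p nat_count (weighted_b f) \<le> (real n + 1) powr r * ell_norm p Omega f"
    proof (rule lp_count_leI(2)[OF p])
      show "0 \<le> (real n + 1) powr r * ell_norm p Omega f" by (simp add: lp_norm_nonneg)
      fix S :: "nat set" assume S: "finite S"
      have "ell_norm p S (weighted_b f) \<le> ell_norm p S (\<lambda>i. (real n + 1) powr r * f (b i))"
      proof (rule lp_mono(2)[OF p lp_space_finite[OF S]])
        fix i
        have fb: "f (b i) = (if i \<in> {..n} then y i else 0)" unfolding f_def by (rule bsum_values) simp
        have "(real i + 1) powr r \<le> (real n + 1) powr r" if "i \<le> n"
          using that r by (intro powr_mono2) auto
        then show "\<bar>weighted_b f i\<bar> \<le> \<bar>(real n + 1) powr r * f (b i)\<bar>"
          by (auto simp: weighted_b_def fb abs_mult intro: mult_right_mono)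
      qed simp
      also have "\<dots> = (real n + 1) powr r * ell_norm p S (\<lambda>i. f (b i))"
        using lp_scale(2)[OF p lp_space_finite[OF S], of "(real n + 1) powr r" "\<lambda>i. f (b i)"] by simp
      also have "ell_norm p S (\<lambda>i. f (b i)) = ell_norm p (b ` S) f"
        by (rule lp_norm_reindex_finite[symmetric, OF p S]) (use inj in \<open>auto intro: inj_on_subset\<close>)
      also have "(real n + 1) powr r * \<dots> \<le> (real n + 1) powr r * ell_norm p Omega f"
        by (intro mult_left_mono lp_count_subset(2)[OF p F_embedding(1)[OF f]]) (auto simp: Omega_def)
      finally show "ell_norm p S (weighted_b f) \<le> (real n + 1) powr r * ell_norm p Omega f" .
    qed
    then show ?thesis unfolding f_def by (simp add: bsum_F(2))
  qed
  moreover define h where "h = (\<lambda>x. (1 / N f) * f x)"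
  have h: "h \<in> F" unfolding h_def by (rule F_scale(1)[OF f])
  have "ell_norm p Omega h < (real n + 1) powr - r"
  proof (rule ker[OF h])
    show "N h \<le> 1" unfolding h_def N_scale[OF f] using Nf by simp
    show "\<forall>L\<in>set Ls. L h = 0"
    proof
      fix L assume L: "L \<in> set Ls"
      then have "L h = (1 / N f) * L f"
        unfolding h_def using Ls(2) by (intro Lambda_all_facts(2)[OF p admissible _ f]) auto
      then show "L h = 0" using Lf[OF L] by simp
    qed
  qed
  then have "ell_norm p Omega f / N f < (real n + 1) powr - r"
    unfolding h_def using lp_scale(2)[OF p F_embedding(1)[OF f], of "1 / N f"] Nf by simp
  then have "ell_norm p Omega f * (real n + 1) powr r < N f"
    using Nf by (simp add: powr_minus field_simps)
  ultimately show False by (simp add: mult.commute)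
qed

definition upart :: "('a \<Rightarrow> real) \<Rightarrow> nat \<Rightarrow> real" where
  "upart f = (\<lambda>i. f (a i) - coef f * g i)"

lemma upart_linear:
  "f \<in> F \<Longrightarrow> h \<in> F \<Longrightarrow> upart (\<lambda>x. f x + h x) = (\<lambda>i. upart f i + upart h i)"
  "f \<in> F \<Longrightarrow> upart (\<lambda>x. c * f x) = (\<lambda>i. c * upart f i)"
  by (auto simp: upart_def F_add F_scale algebra_simps)

lemma functionals:
  "coef \<in> Lambda_all F N" "(\<lambda>f. f (b i)) \<in> Lambda_all F N" "(\<lambda>f. 0) \<in> Lambda_all F N"
  "(\<lambda>f. upart f i) \<in> Lambda_all F N"
  "finite S \<Longrightarrow> (\<lambda>f. sign_sum S T (upart f)) \<in> Lambda_all F N"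
proof -
  show "coef \<in> Lambda_all F N"
    unfolding Lambda_all_def using N_components(1) F_add(2) F_scale(2)
    by (intro CollectI conjI exI[of _ 1]) simp_all
  show "(\<lambda>f. f (b i)) \<in> Lambda_all F N"
    unfolding Lambda_all_def using value_b by (intro CollectI conjI exI[of _ 1]) simp_all
  show "(\<lambda>f. 0) \<in> Lambda_all F N"
    unfolding Lambda_all_def by (intro CollectI conjI exI[of _ 0]) simp_all
  have ub: "\<bar>upart f i\<bar> \<le> (1 / w0) * N f" if "f \<in> F" for f i using value_a[OF that, of i] by (simp add: upart_def)
  show "(\<lambda>f. upart f i) \<in> Lambda_all F N"
    unfolding Lambda_all_def using ub by (intro CollectI conjI exI[of _ "1 / w0"]) (simp_all add: upart_linear)
  show "(\<lambda>f. sign_sum S T (upart f)) \<in> Lambda_all F N" if S: "finite S"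
  proof -
    have "\<bar>sign_sum S T (upart f)\<bar> \<le> (card S * (1 / w0)) * N f" if "f \<in> F" for f
    proof -
      have "\<bar>sign_sum S T (upart f)\<bar> \<le> (\<Sum>i\<in>S. \<bar>upart f i\<bar>)" by (rule abs_sign_sum_le)
      also have "\<dots> \<le> (\<Sum>i\<in>S. (1 / w0) * N f)" by (intro sum_mono ub that)
      finally show ?thesis by simp
    qed
    then have "\<exists>C. \<forall>f\<in>F. \<bar>sign_sum S T (upart f)\<bar> \<le> C * N f" by blast
    then show ?thesis
      unfolding Lambda_all_def by (intro CollectI conjI) (simp_all add: upart_linear sign_sum_linear)
  qed
qed

text \<open>
  The functionals are \<open>c\<close>, the values of \<open>u\<close> at the first \<open>n1\<close> points \<open>a i\<close>, the values at the first \<open>n1\<close>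
  points \<open>b i\<close>, and \<open>n1\<close> sign vectors on the coordinates between \<open>n1\<close> and \<open>n2\<close> of \<open>u\<close>. If they vanish, the
  remaining contributions are those of the coordinates between \<open>n1\<close> and \<open>n2\<close>, where the kernel is flat, of
  those after \<open>n2\<close>, where the weight is large, and of the points \<open>b i\<close> with \<open>i \<ge> n1\<close>.
\<close>
lemma err_all_upper:
  assumes c0: "0 < c0" and s: "0 \<le> s" "\<And>i. c0 * (real i + 1) powr s \<le> w i"
    and n: "3 * n1 + 1 \<le> n" "1 \<le> n1" "n1 \<le> n2" and m: "20 \<le> m"
    and small: "real (2 * n2) ^ m * (10 / 11) ^ n1 < 1"
  shows "err_all n \<le> ereal (2 / c0 * (real n1 powr - s * (20 / m) powr gelfand_gain p + real n2 powr - s)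
    + 2 * real n1 powr - r)"
proof -
  let ?S = "{n1..<n2}"
  have "real (2 * card ?S) ^ m \<le> real (2 * n2) ^ m" by (intro power_mono) auto
  then have "real (2 * card ?S) ^ m * (10 / 11) ^ n1 \<le> real (2 * n2) ^ m * (10 / 11) ^ n1"
    by (intro mult_right_mono) auto
  then have small': "real (2 * card ?S) ^ m * (10 / 11) ^ n1 < 1" using small by linarith
  obtain T where "\<And>k. T k \<subseteq> ?S" and T: "\<And>x. \<forall>k<n1. sign_sum ?S (T k) x = 0 \<Longrightarrow>
      sq_sum ?S x \<le> 20 / real m * (\<Sum>i\<in>?S. \<bar>x i\<bar>)\<^sup>2"
    by (rule exists_signs_with_flat_kernel[of ?S m n1, OF _ _ n(2) small']) (use m in auto)
  \<comment> \<open>The zero functional fills the list up to length \<open>n\<close>.\<close>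
  define Ls where "Ls = coef # map (\<lambda>i f. upart f i) [0..<n1] @ map (\<lambda>i f. f (b i)) [0..<n1]
    @ map (\<lambda>k f. sign_sum ?S (T k) (upart f)) [0..<n1] @ replicate (n - 3 * n1 - 1) (\<lambda>f. 0)"
  have len: "length Ls = n" using n by (simp add: Ls_def)
  have sub: "set Ls \<subseteq> Lambda_all F N" unfolding Ls_def using functionals by auto
  show ?thesis
  proof (rule minimal_error_of_kernel_bound[OF p admissible order_refl len sub])
    fix f assume f: "f \<in> F" "N f \<le> 2" and z: "\<forall>L\<in>set Ls. L f = 0"
    have c0f: "coef f = 0" using z by (simp add: Ls_def)
    have u: "upart f = (\<lambda>i. f (a i))" by (simp add: upart_def c0f)
    have uz: "f (a i) = 0" if "i < n1" for i
      using bspec[OF z, of "\<lambda>f. upart f i"] that u by (auto simp: Ls_def)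
    have bz: "f (b i) = 0" if "i < n1" for i
      using bspec[OF z, of "\<lambda>f. f (b i)"] that by (auto simp: Ls_def)
    have tz: "sign_sum ?S (T k) (\<lambda>i. f (a i)) = 0" if "k < n1" for k
      using bspec[OF z, of "\<lambda>f. sign_sum ?S (T k) (upart f)"] that u by (auto simp: Ls_def)
    have weight: "(\<Sum>i\<in>R. \<bar>f (a i)\<bar>) \<le> 2 / c0 * real k powr - s"
      if R: "finite R" "R \<subseteq> {k..}" and k: "1 \<le> k" for R k
    proof -
      have "c0 * real k powr s * (\<Sum>i\<in>R. \<bar>f (a i)\<bar>) = (\<Sum>i\<in>R. c0 * real k powr s * \<bar>f (a i)\<bar>)"
        by (simp add: sum_distrib_left)
      also have "\<dots> \<le> (\<Sum>i\<in>R. \<bar>rest (coef f) f i\<bar>)"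
      proof (intro sum_mono)
        fix i assume "i \<in> R"
        then have "k \<le> i" using R(2) by auto
        then have "c0 * real k powr s \<le> c0 * (real i + 1) powr s"
          using c0 s(1) by (intro mult_left_mono powr_mono2) auto
        also have "\<dots> \<le> w i" by (rule s(2))
        finally have "c0 * real k powr s * \<bar>f (a i)\<bar> \<le> w i * \<bar>f (a i)\<bar>" by (intro mult_right_mono) auto
        then show "c0 * real k powr s * \<bar>f (a i)\<bar> \<le> \<bar>rest (coef f) f i\<bar>"
          using w_pos[of i] by (simp add: rest_def c0f abs_mult)
      qed
      also have "\<dots> \<le> 2" using sum_abs_le_lp1[OF F_rest[OF f(1)] R(1)] N_components(2)[of f] f(2) by linarith
      finally show ?thesis using c0 k by (simp add: powr_minus field_simps)
    qed
    show "ell_norm p Omega f \<le> 2 / c0 * (real n1 powr - s * (20 / m) powr gelfand_gain p + real n2 powr - s)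
      + 2 * real n1 powr - r" (is "_ \<le> ?B")
    proof (rule lp_count_leI(2)[OF p])
      show "0 \<le> ?B" using c0 by (intro add_nonneg_nonneg mult_nonneg_nonneg) auto
      fix S assume S: "finite S" "S \<subseteq> Omega"
      obtain S1 S2 where fin: "finite S1" "finite S2" and "S = a ` S1 \<union> b ` S2"
        and split: "ell_norm p S f
          \<le> ell_norm p S1 (\<lambda>i. f (a i)) + ell_norm p S2 (\<lambda>i. f (b i))"
        by (rule lp_norm_split[OF S, of f])
      have "ell_norm p S2 (\<lambda>i. f (b i)) \<le> ell_norm p S2 (\<lambda>i. real n1 powr - r * weighted_b f i)"
      proof (rule lp_mono(2)[OF p lp_space_finite[OF fin(2)]])
        fix i
        show "\<bar>f (b i)\<bar> \<le> \<bar>real n1 powr - r * weighted_b f i\<bar>"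
        proof (cases "i < n1")
          case False
          then have "real n1 powr r \<le> (real i + 1) powr r" using r by (intro powr_mono2) auto
          then have "1 * \<bar>f (b i)\<bar> \<le> (real n1 powr - r * (real i + 1) powr r) * \<bar>f (b i)\<bar>"
            using n(2) by (intro mult_right_mono) (auto simp: powr_minus field_simps)
          then show ?thesis by (simp add: weighted_b_def abs_mult)
        qed (simp add: bz)
      qed simp
      also have "\<dots> = real n1 powr - r * ell_norm p S2 (weighted_b f)"
        using lp_scale(2)[OF p lp_space_finite[OF fin(2)], of "real n1 powr - r" "weighted_b f"] by simp
      also have "\<dots> \<le> real n1 powr - r * 2"
      proof (intro mult_left_mono)
        show "ell_norm p S2 (weighted_b f) \<le> 2"
          using lp_count_subset(2)[OF p F_weighted_b[OF f(1)], of S2] N_components(3)[of f] f(2) by simp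
      qed simp
      finally have B: "ell_norm p S2 (\<lambda>i. f (b i)) \<le> 2 * real n1 powr - r" by simp
      let ?x = "\<lambda>i. f (a i)" and ?x1 = "\<lambda>i. if i \<in> ?S then f (a i) else 0" and ?x2 = "\<lambda>i. if i < n2 then 0 else f (a i)"
      have "ell_norm p S1 ?x \<le> ell_norm p S1 (\<lambda>i. ?x1 i + ?x2 i)"
        by (rule lp_mono(2)[OF p lp_space_finite[OF fin(1)]]) (auto simp: uz)
      also have "\<dots> \<le> ell_norm p S1 ?x1 + ell_norm p S1 ?x2"
        by (rule lp_add(2)[OF p lp_space_finite lp_space_finite, OF fin(1) fin(1)])
      also have "ell_norm p S1 ?x1 \<le> ell_norm p (S1 \<inter> ?S) ?x1"
        by (rule lp_norm_finite_support[OF p fin(1)]) auto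
      also have "\<dots> \<le> ell_norm p ?S ?x1"
        by (rule lp_count_subset(2)[OF p lp_space_finite]) auto
      also have "\<dots> \<le> ell_norm p ?S ?x"
        by (rule lp_mono(2)[OF p lp_space_finite]) auto
      also have "\<dots> \<le> (20 / m) powr gelfand_gain p * (\<Sum>i\<in>?S. \<bar>f (a i)\<bar>)"
        using m by (intro lp_norm_interpolate[OF p] T allI impI tz) auto
      also have "\<dots> \<le> (20 / m) powr gelfand_gain p * (2 / c0 * real n1 powr - s)"
        by (intro mult_left_mono weight n) auto
      also have "ell_norm p S1 ?x2 \<le> ell_norm p (S1 \<inter> {n2..}) ?x2"
        by (rule lp_norm_finite_support[OF p fin(1)]) auto
      also have "\<dots> \<le> (\<Sum>i\<in>S1 \<inter> {n2..}. \<bar>?x2 i\<bar>)" by (rule lp_norm_le_sum[OF p]) (use fin in simp)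
      also have "\<dots> = (\<Sum>i\<in>S1 \<inter> {n2..}. \<bar>f (a i)\<bar>)" by (intro sum.cong) auto
      also have "\<dots> \<le> 2 / c0 * real n2 powr - s" using fin n by (intro weight) auto
      finally have "ell_norm p S1 ?x
        \<le> (20 / m) powr gelfand_gain p * (2 / c0 * real n1 powr - s) + 2 / c0 * real n2 powr - s" by simp
      then show "ell_norm p S f \<le> ?B" using split B by (simp add: algebra_simps)
    qed
  qed
qed

lemma err_std_lowerI:
  assumes "\<And>P. P \<subseteq> Omega \<Longrightarrow> finite P \<Longrightarrow> card P \<le> n \<Longrightarrow>
    \<exists>f\<in>F. N f \<le> B \<and> (\<forall>x\<in>P. f x = 0) \<and> \<eta> \<le> ell_norm p Omega f"
    and B: "0 < B"
  shows "ereal (\<eta> / B) \<le> err_std n"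
proof (rule ccontr)
  assume "\<not> ?thesis"
  then have less: "err_std n < ereal (\<eta> / B)" by simp
  obtain Ls where Ls: "length Ls = n" "set Ls \<subseteq> Lambda_std (space (count_space Omega))"
    and ker: "\<And>f. f \<in> F \<Longrightarrow> N f \<le> 1 \<Longrightarrow> \<forall>L\<in>set Ls. L f = 0 \<Longrightarrow>
      ell_norm p Omega f < \<eta> / B"
    using kernel_bound_of_minimal_error[OF p admissible Lambda_std_subset[OF p admissible] less] by blast
  have "\<forall>L\<in>set Ls. \<exists>x\<in>Omega. L = (\<lambda>f. f x)" using Ls(2) by (auto simp: Lambda_std_def)
  then obtain pt where pt: "\<And>L. L \<in> set Ls \<Longrightarrow> pt L \<in> Omega \<and> L = (\<lambda>f. f (pt L))" by metis
  have "card (pt ` set Ls) \<le> n" using Ls(1) by (metis List.finite_set card_image_le card_length order_trans)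
  then obtain f where f: "f \<in> F" "N f \<le> B" "\<forall>x\<in>pt ` set Ls. f x = 0" "\<eta> \<le> ell_norm p Omega f"
    using assms(1)[of "pt ` set Ls"] pt by auto
  define h where "h = (\<lambda>x. (1 / B) * f x)"
  have "ell_norm p Omega h < \<eta> / B"
  proof (rule ker)
    show "h \<in> F" unfolding h_def by (rule F_scale(1)[OF f(1)])
    show "N h \<le> 1" unfolding h_def N_scale[OF f(1)] using f(2) B by simp
    show "\<forall>L\<in>set Ls. L h = 0"
    proof
      fix L assume L: "L \<in> set Ls"
      have "L h = h (pt L)" using pt[OF L] by metis
      then show "L h = 0" using f(3) L by (simp add: h_def)
    qed
  qed
  then have "ell_norm p Omega f / B < \<eta> / B"
    unfolding h_def using lp_scale(2)[OF p F_embedding(1)[OF f(1)], of "1 / B"] B by simp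
  then show False using f(4) B by (simp add: divide_strict_right_mono divide_less_cancel)
qed

lemma finite_preimage_a:
  assumes "finite P"
  shows "finite {i. a i \<in> P}" "card {i. a i \<in> P} \<le> card P"
proof -
  have "inj_on a {i. a i \<in> P}" using inj(1) by (auto intro: inj_on_subset)
  moreover have "a ` {i. a i \<in> P} \<subseteq> P" by auto
  ultimately show "finite {i. a i \<in> P}" "card {i. a i \<in> P} \<le> card P"
    using assms by (auto intro: card_inj_on_le inj_on_finite)
qed

lemma lp_norm_Omega_ge:
  assumes "f \<in> F" "finite S"
  shows "ell_norm p S (\<lambda>i. f (a i)) \<le> ell_norm p Omega f"
proof -
  have "ell_norm p S (\<lambda>i. f (a i)) = ell_norm p (a ` S) f"
    by (rule lp_norm_reindex_finite[symmetric, OF p assms(2)]) (use inj in \<open>auto intro: inj_on_subset\<close>)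
  also have "\<dots> \<le> ell_norm p Omega f"
    by (rule lp_count_subset(2)[OF p F_embedding(1)[OF assms(1)]]) (auto simp: Omega_def)
  finally show ?thesis .
qed

text \<open>
  Some unit vector among \<open>a 0, \<dots>, a n\<close> vanishes at the given points.
\<close>
lemma err_std_lower_point:
  assumes W: "\<And>i. i \<le> n \<Longrightarrow> w i \<le> W"
  shows "ereal (1 / W) \<le> err_std n"
proof (rule err_std_lowerI)
  show "0 < W" using W[of 0] w_pos[of 0] by simp
  fix P assume P: "P \<subseteq> Omega" "finite P" "card P \<le> n"
  have "\<not> {..n} \<subseteq> {i. a i \<in> P}"
  proof
    assume "{..n} \<subseteq> {i. a i \<in> P}"
    then have "card {..n} \<le> card {i. a i \<in> P}" by (rule card_mono[OF finite_preimage_a(1)[OF P(2)]])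
    then show False using finite_preimage_a(2)[OF P(2)] P(3) by simp
  qed
  then obtain i where i: "i \<le> n" "a i \<notin> P" by auto
  define f where "f = (\<lambda>x. if x = a i then 1 else 0 :: real)"
  have fa: "f (a j) = (if j = i then 1 else 0)" for j using inj(1) by (auto simp: f_def inj_def)
  have fb: "f (b j) = 0" for j using disj[of i j] by (auto simp: f_def)
  have R: "rest 0 f = (\<lambda>j. if j = i then w i else 0)" by (auto simp: rest_def fa)
  have Rl: "rest 0 f \<in> lp_space 1 nat_count" by (rule lp_space_finite_support[of 1 "{i}"]) (auto simp: R)
  have W0: "weighted_b f = (\<lambda>j. 0)" by (simp add: weighted_b_def fb)
  have f: "f \<in> F" by (rule F_intro[OF _ Rl]) (auto simp: f_def Omega_def W0[unfolded f_def] lp_zero p)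
  have "lp_norm 1 nat_count (rest 0 f) \<le> w i"
  proof (rule lp_count_leI(2))
    fix S :: "nat set" assume "finite S"
    moreover have "(\<Sum>j\<in>S. \<bar>if j = i then w i else 0\<bar>) = (\<Sum>j\<in>S. if j = i then w i else 0)"
      using w_pos[of i] by (intro sum.cong) auto
    ultimately show "ell_norm 1 S (rest 0 f) \<le> w i"
      using w_pos[of i] by (simp add: lp1_norm_finite R)
  qed (use w_pos[of i] in auto)
  then have "N f \<le> W" using coefI[OF Rl] W[OF i(1)] by (simp add: N_def W0 lp_zero p)
  moreover have "1 \<le> ell_norm p Omega f"
    using lp_norm_Omega_ge[OF f, of "{i}"] by (simp add: lp_norm_singleton[OF p] fa)
  moreover have "\<forall>x\<in>P. f x = 0" using i(2) by (auto simp: f_def)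
  ultimately show "\<exists>f\<in>F. N f \<le> W \<and> (\<forall>x\<in>P. f x = 0) \<and> 1 \<le> ell_norm p Omega f"
    using f by blast
qed

text \<open>
  The function is \<open>g\<close>, set to \<open>0\<close> at the given points. It has \<open>c = 1\<close>, so these changes belong to \<open>u\<close>, and their
  norm is the sum of \<open>w i * g i\<close> over the points.
\<close>
lemma err_std_lower_line:
  assumes cost: "\<And>Q. finite Q \<Longrightarrow> card Q \<le> n \<Longrightarrow> (\<Sum>i\<in>Q. w i * g i) \<le> B" and B: "0 \<le> B"
    and large: "\<And>Q. finite Q \<Longrightarrow> card Q \<le> n \<Longrightarrow> \<exists>S. finite S \<and> S \<inter> Q = {} \<and> \<eta> \<le> ell_norm p S g"
  shows "ereal (\<eta> / (1 + B)) \<le> err_std n"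
proof (rule err_std_lowerI)
  show "0 < 1 + B" using B by simp
  fix P assume P: "P \<subseteq> Omega" "finite P" "card P \<le> n"
  define Q where "Q = {i. a i \<in> P}"
  have Q: "finite Q" "card Q \<le> n" using finite_preimage_a[OF P(2)] P(3) by (auto simp: Q_def)
  define f where "f z = (if z \<in> range a \<and> z \<notin> P then g (inv_into UNIV a z) else 0)" for z
  have fa: "f (a i) = (if i \<in> Q then 0 else g i)" for i using inj(1) by (auto simp: f_def Q_def)
  have fb: "f (b i) = 0" for i using disj by (auto simp: f_def dest: sym)
  have R: "rest 1 f = (\<lambda>i. if i \<in> Q then - (w i * g i) else 0)" by (auto simp: rest_def fa)
  have Rl: "rest 1 f \<in> lp_space 1 nat_count" by (rule lp_space_finite_support[OF _ Q(1)]) (auto simp: R)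
  have W0: "weighted_b f = (\<lambda>j. 0)" by (simp add: weighted_b_def fb)
  have "weighted_b f \<in> lp_space p nat_count" by (simp add: W0 lp_zero p)
  then have f: "f \<in> F" by (rule F_intro[OF _ Rl, rotated]) (auto simp: f_def Omega_def)
  have "lp_norm 1 nat_count (rest 1 f) \<le> B"
  proof (rule lp_count_leI(2))
    fix S :: "nat set" assume S: "finite S"
    have "(\<Sum>j\<in>S. \<bar>rest 1 f j\<bar>) = (\<Sum>j\<in>S \<inter> Q. w j * g j)"
      using S w_pos g(1) by (auto simp: R sum.inter_restrict abs_mult less_imp_le intro!: sum.cong)
    also have "\<dots> \<le> B"
      using Q card_mono[OF Q(1), of "S \<inter> Q"] by (intro cost) auto
    finally show "ell_norm 1 S (rest 1 f) \<le> B" using S by (simp add: lp1_norm_finite)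
  qed (use B in auto)
  then have "N f \<le> 1 + B" using coefI[OF Rl] by (simp add: N_def W0 lp_zero p)
  moreover obtain S where S: "finite S" "S \<inter> Q = {}" "\<eta> \<le> ell_norm p S g"
    using large[OF Q] by blast
  have "ell_norm p S g \<le> ell_norm p S (\<lambda>i. f (a i))"
    by (rule lp_mono(2)[OF p lp_space_finite[OF S(1)]]) (use S(2) in \<open>auto simp: fa\<close>)
  then have "\<eta> \<le> ell_norm p Omega f"
    using S(3) lp_norm_Omega_ge[OF f S(1)] by linarith
  moreover have "\<forall>x\<in>P. f x = 0" by (auto simp: f_def)
  ultimately show "\<exists>f\<in>F. N f \<le> 1 + B \<and> (\<forall>x\<in>P. f x = 0) \<and> \<eta> \<le> ell_norm p Omega f"
    using f by blast
qed

end

section \<open>Rates in the space with a hidden line\<close>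

text \<open>
  For an upper bound of a rate, large errors at infinitely many \<open>n\<close> suffice. This permits the sparse blocks
  used below.
\<close>
lemma rate_le_frequently:
  assumes "0 \<le> \<rho>"
    and freq: "\<And>\<beta>. \<rho> < \<beta> \<Longrightarrow> \<exists>\<epsilon>>0. \<exists>\<^sub>F n in sequentially. ereal \<epsilon> \<le> c n * ereal (real n powr \<beta>)"
  shows "rate c \<le> ereal \<rho>"
proof (rule rate_leI[OF assms(1)])
  fix \<beta> assume "\<rho> < \<beta>"
  then obtain \<epsilon> where e: "0 < \<epsilon>" "\<exists>\<^sub>F n in sequentially. ereal \<epsilon> \<le> c n * ereal (real n powr \<beta>)"
    using freq by blast
  show "\<not> (\<lambda>n. c n * ereal (real n powr \<beta>)) \<longlonglongrightarrow> 0"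
  proof
    assume "(\<lambda>n. c n * ereal (real n powr \<beta>)) \<longlonglongrightarrow> 0"
    then have "\<forall>\<^sub>F n in sequentially. c n * ereal (real n powr \<beta>) < ereal \<epsilon>"
      using e(1) by (intro order_tendstoD(2)) auto
    then show False using e(2) by (auto simp: frequently_def not_le)
  qed
qed

lemma rate_le_power:
  assumes \<rho>: "0 \<le> \<rho>" and low: "\<And>n. ereal ((real n + 1) powr - \<rho>) \<le> c n"
  shows "rate c \<le> ereal \<rho>"
proof (rule rate_le_frequently[OF \<rho>])
  fix \<beta> assume b: "\<rho> < \<beta>"
  have "ereal (2 powr - \<rho>) \<le> c n * ereal (real n powr \<beta>)" if n: "1 \<le> n" for n
  proof -
    have "2 powr - \<rho> = (2 * real n) powr - \<rho> * real n powr \<rho>"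
      using n by (simp add: powr_mult flip: powr_add mult.assoc)
    also have "\<dots> \<le> (real n + 1) powr - \<rho> * real n powr \<beta>"
      using n b \<rho> by (intro mult_mono powr_mono powr_mono2') auto
    finally have "ereal (2 powr - \<rho>) \<le> ereal ((real n + 1) powr - \<rho>) * ereal (real n powr \<beta>)" by simp
    also have "\<dots> \<le> c n * ereal (real n powr \<beta>)" by (intro ereal_mult_right_mono low) simp
    finally show ?thesis .
  qed
  then have "\<forall>\<^sub>F n in sequentially. ereal (2 powr - \<rho>) \<le> c n * ereal (real n powr \<beta>)"
    by (auto intro: eventually_sequentiallyI)
  then show "\<exists>\<epsilon>>0. \<exists>\<^sub>F n in sequentially. ereal \<epsilon> \<le> c n * ereal (real n powr \<beta>)"
    by (intro exI[of _ "2 powr - \<rho>"] conjI eventually_frequently) auto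
qed

lemma gelfand_gain_bounds:
  assumes "1 \<le> p"
  shows "0 \<le> gelfand_gain p" "gelfand_gain p \<le> 1 / 2"
proof -
  consider "\<not> p \<le> 2" | q where "p = ereal q" "1 \<le> q" "q \<le> 2"
    using assms by (cases p) force+
  then have "0 \<le> gelfand_gain p \<and> gelfand_gain p \<le> 1 / 2"
  proof cases
    case (2 q)
    then have "1 / 2 \<le> 1 / q" "1 / q \<le> 1" by (auto simp: field_simps)
    then show ?thesis using 2 by (simp add: gelfand_gain_def)
  qed (simp add: gelfand_gain_def)
  then show "0 \<le> gelfand_gain p" "gelfand_gain p \<le> 1 / 2" by auto
qed

text \<open>
  With about \<open>n\<close> functionals one can afford \<open>m = n powr (1 - \<delta>)\<close> in the construction of a flat
  kernel, for any polynomial number \<open>n ^ L\<close> of coordinates.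
\<close>
lemma eventually_flat_kernel_condition:
  assumes \<delta>: "0 < \<delta>" "\<delta> < 1"
  shows "\<forall>\<^sub>F n in sequentially. real (2 * n ^ L) ^ nat \<lfloor>real n powr (1 - \<delta>)\<rfloor> * (10 / 11) ^ n < 1"
proof -
  define c where "c = ln (11 / 10 :: real)"
  have c: "0 < c" by (simp add: c_def)
  have "\<forall>\<^sub>F x in at_top. (x :: real) powr (1 - \<delta>) * (ln 2 + real L * ln x) < c * x"
    using \<delta> c by real_asymp
  then have "\<forall>\<^sub>F n in sequentially. real n powr (1 - \<delta>) * (ln 2 + real L * ln (real n)) < c * real n"
    using filterlim_real_sequentially by (rule eventually_compose_filterlim)
  then show ?thesis using eventually_ge_at_top[of 1]
  proof eventually_elim
    case (elim n)
    let ?m = "nat \<lfloor>real n powr (1 - \<delta>)\<rfloor>"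
    have m: "real ?m \<le> real n powr (1 - \<delta>)" by (simp add: of_nat_floor)
    have l0: "0 \<le> ln 2 + real L * ln (real n)" using elim by (intro add_nonneg_nonneg) auto
    have "real (2 * n ^ L) ^ ?m = exp (real ?m * ln (real (2 * n ^ L)))"
      using elim by (subst exp_of_nat_mult) simp
    also have "ln (real (2 * n ^ L)) = ln 2 + real L * ln (real n)"
      using elim by (simp add: ln_mult ln_realpow)
    also have "exp (real ?m * (ln 2 + real L * ln (real n))) < exp (c * real n)"
      using order_le_less_trans[OF mult_right_mono[OF m l0] elim(1)] by simp
    also have "\<dots> = (11 / 10) ^ n" by (simp add: c_def mult.commute exp_of_nat_mult)
    finally have "real (2 * n ^ L) ^ ?m * (10 / 11) ^ n < (11 / 10) ^ n * (10 / 11) ^ n"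
      by (intro mult_strict_right_mono) auto
    also have "(11 / 10) ^ n * (10 / 11) ^ n = (1 :: real)" unfolding power_mult_distrib[symmetric] by simp
    finally show ?case .
  qed
qed

context hidden_line_space
begin

text \<open>
  The exponents obtained from \<open>err_all_upper\<close> with \<open>m = n1 powr (1 - \<delta>)\<close> and \<open>n2 = n1 ^ L\<close> are \<open>r\<close>,
  \<open>s + \<kappa> * (1 - \<delta>)\<close> and \<open>L * s\<close>. All of them exceed a given \<open>\<beta> < r\<close> if \<open>s\<close> is close to \<open>\<sigma>\<close>, \<open>\<delta>\<close> is small and \<open>L\<close> is
  large. The last condition needs \<open>s > 0\<close>, which is possible because \<open>\<sigma>\<close> is positive.
\<close>
lemma rate_all_eq:
  assumes \<sigma>: "0 < \<sigma>" "r \<le> \<sigma> + gelfand_gain p"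
    and growth: "\<And>s. 0 \<le> s \<Longrightarrow> s < \<sigma> \<Longrightarrow> \<exists>c0>0. \<forall>i. c0 * (real i + 1) powr s \<le> w i"
  shows "rate_all p (count_space Omega) F N = ereal r"
proof (rule antisym)
  show "rate_all p (count_space Omega) F N \<le> ereal r"
    unfolding rate_all_def using r by (intro rate_le_power err_all_lower) simp
  show "ereal r \<le> rate_all p (count_space Omega) F N"
    unfolding rate_all_def
  proof (rule rate_geI[OF r])
    fix \<beta> assume \<beta>: "0 \<le> \<beta>" "\<beta> < r"
    define \<kappa> where "\<kappa> = gelfand_gain p"
    have \<kappa>: "0 \<le> \<kappa>" "\<kappa> \<le> 1 / 2" using gelfand_gain_bounds[OF p] by (auto simp: \<kappa>_def)
    obtain s where s: "max (\<beta> - \<kappa>) 0 < s" "s < \<sigma>"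
      using dense[of "max (\<beta> - \<kappa>) 0" \<sigma>] \<sigma> \<beta> by (auto simp: \<kappa>_def)
    define \<delta> where "\<delta> = min (1 / 2) (s + \<kappa> - \<beta>)"
    have \<delta>: "0 < \<delta>" "\<delta> < 1" using s by (auto simp: \<delta>_def)
    have "\<kappa> * \<delta> \<le> 1 / 2 * \<delta>" using \<kappa> \<delta> by (intro mult_right_mono) auto
    then have "\<kappa> * \<delta> < \<delta>" using \<delta> by linarith
    moreover have "\<delta> \<le> s + \<kappa> - \<beta>" by (simp add: \<delta>_def)
    ultimately have exp0: "\<beta> < s + \<kappa> * (1 - \<delta>)" by (simp add: right_diff_distrib)
    define \<theta> where "\<theta> = 1 - \<delta>"
    have \<theta>: "0 < \<theta>" using \<delta> by (simp add: \<theta>_def)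
    have exp1: "\<beta> < s + \<kappa> * \<theta>" using exp0 by (simp add: \<theta>_def)
    obtain L0 :: nat where L0: "\<beta> / s < L0" using reals_Archimedean2 by blast
    \<comment> \<open>The successor ensures \<open>n1 \<le> n1 ^ L\<close> also for \<open>\<beta> = 0\<close>.\<close>
    define L where "L = Suc L0"
    have L: "\<beta> < real L * s" "1 \<le> L"
    proof -
      have "\<beta> < real L0 * s" using L0 s by (simp add: pos_divide_less_eq)
      then show "\<beta> < real L * s" using s by (simp add: L_def algebra_simps)
    qed (simp add: L_def)
    define \<gamma> where "\<gamma> = min r (min (s + \<kappa> * \<theta>) (real L * s))"
    have \<gamma>: "\<beta> < \<gamma>" "0 < \<gamma>" using \<beta> exp1 L(1) by (auto simp: \<gamma>_def)
    obtain c0 where c0: "0 < c0" "\<And>i. c0 * (real i + 1) powr s \<le> w i" using growth[of s] s by auto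
    define C where "C = 2 / c0 * (40 powr \<kappa> + 1) + 2"
    have C: "0 \<le> C" using c0 by (auto simp: C_def intro!: add_nonneg_nonneg mult_nonneg_nonneg)
    have big: "\<forall>\<^sub>F n in sequentially. 20 \<le> real n powr \<theta> / 2"
    proof -
      have "\<forall>\<^sub>F x in at_top. 20 \<le> (x :: real) powr \<theta> / 2" using \<theta> by real_asymp
      then show ?thesis using filterlim_real_sequentially by (rule eventually_compose_filterlim)
    qed
    have ev: "\<forall>\<^sub>F k in sequentially. \<forall>n. 3 * k + 1 \<le> n \<longrightarrow> err_all n \<le> ereal (C * real k powr - \<gamma>)"
      using eventually_flat_kernel_condition[OF \<delta>, of L, folded \<theta>_def] big eventually_ge_at_top[of 1]
    proof eventually_elim
      case (elim k)
      define m where "m = nat \<lfloor>real k powr \<theta>\<rfloor>"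
      have m: "real k powr \<theta> / 2 \<le> real m" using elim(2) unfolding m_def by linarith
      then have m20: "20 \<le> m" using elim(2) by linarith
      have k: "1 \<le> real k" using elim(3) by simp
      have kL: "k \<le> k ^ L" using elim(3) L(2) by (simp add: self_le_power)
      have "err_all n \<le> ereal (C * real k powr - \<gamma>)" if n: "3 * k + 1 \<le> n" for n
      proof -
        have "err_all n \<le> ereal (2 / c0 * (real k powr - s * (20 / m) powr \<kappa> + real (k ^ L) powr - s) + 2 * real k powr - r)"
          unfolding \<kappa>_def
          by (rule err_all_upper[OF c0(1) _ c0(2) n elim(3) kL m20]) (use s elim(1) in \<open>auto simp: m_def\<close>)
        also have "\<dots> \<le> ereal (2 / c0 * (40 powr \<kappa> * real k powr - \<gamma> + real k powr - \<gamma>) + 2 * real k powr - \<gamma>)"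
        proof -
          have "20 / real m \<le> 20 / (real k powr \<theta> / 2)" using m m20 k by (intro divide_left_mono mult_pos_pos) auto
          also have "\<dots> = 40 * real k powr (- \<theta>)" unfolding powr_minus_divide by simp
          finally have "(20 / real m) powr \<kappa> \<le> (40 * real k powr (- \<theta>)) powr \<kappa>"
            using \<kappa> by (intro powr_mono2) auto
          also have "\<dots> = 40 powr \<kappa> * real k powr (- (\<kappa> * \<theta>))"
            unfolding powr_mult powr_powr by (simp add: mult.commute)
          finally have "real k powr - s * (20 / m) powr \<kappa> \<le> real k powr - s * (40 powr \<kappa> * real k powr (- (\<kappa> * \<theta>)))"
            by (intro mult_left_mono) auto
          also have "\<dots> = 40 powr \<kappa> * real k powr (- (s + \<kappa> * \<theta>))"
            by (simp add: powr_add[symmetric])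
          also have "\<dots> \<le> 40 powr \<kappa> * real k powr - \<gamma>"
            using k by (intro mult_left_mono powr_mono) (auto simp: \<gamma>_def)
          finally have 1: "real k powr - s * (20 / m) powr \<kappa> \<le> 40 powr \<kappa> * real k powr - \<gamma>" .
          have "real (k ^ L) powr - s = real k powr (- (real L * s))"
            using k by (simp add: powr_powr flip: powr_realpow)
          also have "\<dots> \<le> real k powr - \<gamma>" using k by (intro powr_mono) (auto simp: \<gamma>_def)
          finally have 2: "real (k ^ L) powr - s \<le> real k powr - \<gamma>" .
          have 3: "real k powr - r \<le> real k powr - \<gamma>" using k by (intro powr_mono) (auto simp: \<gamma>_def)
          show ?thesis unfolding ereal_less_eq
            using 1 2 3 c0(1) by (intro add_mono mult_left_mono) auto
        qed
        also have "2 / c0 * (40 powr \<kappa> * real k powr - \<gamma> + real k powr - \<gamma>) + 2 * real k powr - \<gamma>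
            = C * real k powr - \<gamma>" by (simp add: C_def algebra_simps)
        finally show ?thesis .
      qed
      then show ?case by blast
    qed
    \<comment> \<open>With \<open>n1 = (n - 1) div 3\<close>, the number \<open>3 * n1 + 1\<close> of functionals is at most \<open>n\<close>.\<close>
    have "filterlim (\<lambda>n. (n - 1) div 3 :: nat) sequentially sequentially"
      unfolding filterlim_at_top
    proof
      fix Z :: nat
      have "Z \<le> (n - 1) div 3" if "3 * Z + 1 \<le> n" for n using that by linarith
      then show "\<forall>\<^sub>F n in sequentially. Z \<le> (n - 1) div 3" by (rule eventually_sequentiallyI)
    qed
    from eventually_compose_filterlim[OF ev this]
    have evn: "\<forall>\<^sub>F n in sequentially. err_all n \<le> ereal (C * 6 powr \<gamma> * real n powr - \<gamma>)"
      using eventually_ge_at_top[of 6]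
    proof eventually_elim
      case (elim n)
      have "3 * ((n - 1) div 3) + 1 \<le> n" using elim(2) by linarith
      then have "err_all n \<le> ereal (C * real ((n - 1) div 3) powr - \<gamma>)" using elim(1) by blast
      also have "\<dots> \<le> ereal (C * (real n / 6) powr - \<gamma>)"
      proof -
        have "n \<le> 6 * ((n - 1) div 3)" using elim(2) by linarith
        then have "real n \<le> real (6 * ((n - 1) div 3))" by (rule of_nat_mono)
        then have "real n / 6 \<le> real ((n - 1) div 3)" by simp
        then show ?thesis unfolding ereal_less_eq
          using C \<gamma> elim(2) by (intro mult_left_mono powr_mono2') auto
      qed
      also have "C * (real n / 6) powr - \<gamma> = C * 6 powr \<gamma> * real n powr - \<gamma>"
        by (simp add: powr_divide powr_minus field_simps)
      finally show ?case .
    qed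
    show "(\<lambda>n. err_all n * ereal (real n powr \<beta>)) \<longlonglongrightarrow> 0"
    proof (rule tendsto_zero_ereal_bound[OF minimal_error_nonneg[OF p admissible] evn])
      have "((\<lambda>x :: real. C * 6 powr \<gamma> * x powr - \<gamma> * x powr \<beta>) \<longlongrightarrow> 0) at_top" using \<gamma>(1) by real_asymp
      then show "(\<lambda>n. C * 6 powr \<gamma> * real n powr - \<gamma> * real n powr \<beta>) \<longlonglongrightarrow> 0"
        using filterlim_real_sequentially by (rule filterlim_compose)
    qed
  qed
qed

end

section \<open>Values of the power function\<close>

lemma power_function_le:
  fixes M :: "'a measure"
  assumes "admissible_space p M F N" "rate_all p M F N = ereal r"
  shows "power_function TYPE('a) r p \<le> rate_std p M F N / ereal r"
  unfolding power_function_def using assms by (intro Inf_lower) auto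

lemma power_function_nonneg: "0 < r \<Longrightarrow> 0 \<le> power_function TYPE('a) r p"
  unfolding power_function_def
proof (rule Inf_greatest, clarify)
  fix M :: "'a measure" and F N
  assume "0 < r"
  then have "0 / ereal r \<le> rate_std p M F N / ereal r"
    by (intro ereal_divide_right_mono) (simp_all add: rate_std_def rate_nonneg)
  then show "0 \<le> rate_std p M F N / ereal r" by simp
qed

lemma disjoint_enumerations:
  assumes "infinite (UNIV :: 'a set)"
  obtains a b :: "nat \<Rightarrow> 'a" where "inj a" "inj b" "\<forall>i j. a i \<noteq> b j"
proof -
  obtain h :: "nat \<Rightarrow> 'a" where h: "inj h"
    using infinite_countable_subset[OF assms] by blast
  show ?thesis
  proof (rule that[of "\<lambda>i. h (2 * i)" "\<lambda>i. h (2 * i + 1)"])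
    have "2 * i \<noteq> 2 * j + 1" for i j :: nat by presburger
    then show "\<forall>i j. h (2 * i) \<noteq> h (2 * j + 1)" by (simp add: inj_eq[OF h])
  qed (auto intro!: injI simp: inj_eq[OF h])
qed

lemma power_sequence_in_lp:
  assumes p: "1 \<le> p"
  shows "(\<lambda>i. (real i + 1) powr (- 2 / real_of_ereal p)) \<in> lp_space p nat_count"
proof (cases "p = \<infinity>")
  case True
  show ?thesis unfolding True by (rule lp_inf_leI[of _ _ 1]) auto
next
  case False
  define q where "q = real_of_ereal p"
  have q: "1 \<le> q" using False p unfolding q_def by (cases p) auto
  have "summable (\<lambda>n. inverse (real n ^ 2))" by (rule inverse_power_summable) simp
  then have "summable (\<lambda>n. inverse (real (Suc n) ^ 2))" by (subst summable_Suc_iff)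
  moreover have e: "\<bar>(real n + 1) powr (- 2 / q)\<bar> powr q = inverse (real (Suc n) ^ 2)" for n
  proof -
    have "\<bar>(real n + 1) powr (- 2 / q)\<bar> powr q = (real n + 1) powr (- 2)"
      using q by (simp add: powr_powr)
    also have "\<dots> = inverse (real (Suc n) ^ 2)"
      by (simp add: powr_minus powr_numeral add.commute)
    finally show ?thesis .
  qed
  ultimately have "summable (\<lambda>n. \<bar>(real n + 1) powr (- 2 / q)\<bar> powr q)" by simp
  then have "integrable nat_count (\<lambda>n. \<bar>(real n + 1) powr (- 2 / q)\<bar> powr q)"
    by (simp add: integrable_count_space_nat_iff)
  then show ?thesis using False by (simp add: lp_space_def q_def)
qed

lemma harmonic_minorant_unbounded:
  fixes f :: "nat \<Rightarrow> real"
  assumes "\<And>i. 1 / (real i + 1) \<le> f i"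
  shows "\<exists>n. B < (\<Sum>i<n. f i)"
proof (rule ccontr)
  assume "\<not> ?thesis"
  then have B: "(\<Sum>i<n. f i) \<le> B" for n by (simp add: not_less)
  have "(\<Sum>i<n. inverse (real (Suc i))) \<le> (\<Sum>i<n. f i)" for n
    using assms by (intro sum_mono) (simp add: inverse_eq_divide add.commute)
  then have "(\<Sum>i<n. inverse (real (Suc i))) \<le> B" for n using B by (rule order_trans)
  then have "summable (\<lambda>i. inverse (real (Suc i)))"
    by (intro summableI_nonneg_bounded) auto
  then show False using not_summable_harmonic[where 'a = real] summable_Suc_iff[of "\<lambda>n. inverse (real n)"] by simp
qed

text \<open>
  The weights are \<open>w i = (i + 1) powr (r - \<kappa>)\<close>, and the points \<open>a i\<close> themselves defeat the function
  values. As \<open>r > 1\<close>, the line \<open>g i = (i + 1) powr (- 2 / p)\<close> has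
  \<open>w i * g i \<ge> 1 / (i + 1)\<close>, also for \<open>p = \<infinity>\<close>, where \<open>real_of_ereal p = 0\<close> and \<open>g\<close> is constant.
\<close>
lemma power_function_le_gain:
  assumes inf: "infinite (UNIV :: 'a set)" and p: "1 \<le> p" and r: "1 < r"
  shows "power_function TYPE('a) r p \<le> ereal (1 - gelfand_gain p / r)"
proof -
  obtain a b :: "nat \<Rightarrow> 'a" where ab: "inj a" "inj b" "\<forall>i j. a i \<noteq> b j"
    by (rule disjoint_enumerations[OF inf])
  define \<kappa> where "\<kappa> = gelfand_gain p"
  have \<kappa>: "0 \<le> \<kappa>" "\<kappa> \<le> 1 / 2" using gelfand_gain_bounds[OF p] by (auto simp: \<kappa>_def)
  define \<rho> where "\<rho> = r - \<kappa>"
  have \<rho>: "0 < \<rho>" using \<kappa> r by (simp add: \<rho>_def)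
  define w where "w i = (real i + 1) powr \<rho>" for i :: nat
  define g where "g i = (real i + 1) powr (- 2 / real_of_ereal p)" for i :: nat
  have ex: "- 1 \<le> \<rho> - 2 / real_of_ereal p"
  proof -
    consider "p = \<infinity>" | q where "p = ereal q" "2 < q" | q where "p = ereal q" "1 \<le> q" "q \<le> 2"
      using p by (cases p) force+
    then show ?thesis
    proof cases
      case 1 then show ?thesis using \<rho> by simp
    next
      case (2 q)
      then have "2 / q \<le> 1" by simp
      then show ?thesis using \<rho> unfolding 2(1) real_of_ereal.simps by linarith
    next
      case (3 q)
      then have "\<kappa> = 1 - 1 / q" "1 / q \<le> 1" by (auto simp: \<kappa>_def gelfand_gain_def)
      moreover have "2 / q = 2 * (1 / q)" by simp
      ultimately show ?thesis using r unfolding 3(1) real_of_ereal.simps \<rho>_def by linarith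
    qed
  qed
  have wg: "1 / (real i + 1) \<le> w i * g i" for i
  proof -
    have "1 / (real i + 1) = (real i + 1) powr - 1" by (simp add: powr_minus_divide)
    also have "\<dots> \<le> (real i + 1) powr (\<rho> - 2 / real_of_ereal p)" using ex by (intro powr_mono) auto
    also have "\<dots> = w i * g i" by (simp add: w_def g_def flip: powr_add)
    finally show ?thesis .
  qed
  interpret E: hidden_line_space a b p r w g 1
  proof
    show "1 \<le> w i" for i using \<rho> by (simp add: w_def ge_one_powr_ge_zero)
    show "g \<in> lp_space p nat_count" using power_sequence_in_lp[OF p] by (simp add: g_def[abs_def])
    show "\<exists>n. B < (\<Sum>i<n. w i * g i)" for B by (rule harmonic_minorant_unbounded) (rule wg)
  qed (use ab p r in \<open>auto simp: g_def\<close>)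
  have "rate_all p (count_space E.Omega) E.F E.N = ereal r"
  proof (rule E.rate_all_eq[OF \<rho>])
    show "\<exists>c0>0. \<forall>i. c0 * (real i + 1) powr s \<le> w i" if "s < \<rho>" for s
      using that by (intro exI[of _ 1]) (auto simp: w_def intro!: powr_mono)
  qed (simp add: \<rho>_def \<kappa>_def)
  then have "power_function TYPE('a) r p \<le> rate_std p (count_space E.Omega) E.F E.N / ereal r"
    by (rule power_function_le[OF E.admissible])
  also have "\<dots> \<le> ereal \<rho> / ereal r"
  proof (intro ereal_divide_right_mono)
    show "rate_std p (count_space E.Omega) E.F E.N \<le> ereal \<rho>"
      unfolding rate_std_def
    proof (rule rate_le_power)
      fix n
      have "ereal (1 / (real n + 1) powr \<rho>) \<le> E.err_std n"
        using \<rho> by (intro E.err_std_lower_point) (auto simp: w_def intro!: powr_mono2)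
      then show "ereal ((real n + 1) powr - \<rho>) \<le> E.err_std n" by (simp add: powr_minus_divide)
    qed (use \<rho> in simp)
  qed (use r in simp)
  also have "\<dots> = ereal (1 - gelfand_gain p / r)" using r by (simp add: \<rho>_def \<kappa>_def diff_divide_distrib)
  finally show ?thesis .
qed

text \<open>
  The \<open>j\<close>-th block ends at \<open>2 ^ tower j\<close>, and \<open>2 ^ gap j\<close> points will be sampled against it. The number
  \<open>gap (Suc j)\<close> lies strictly between the exponents of two consecutive blocks in the sense that
  \<open>gap (Suc j) / tower (Suc j)\<close> and \<open>tower j / gap (Suc j)\<close> both tend to \<open>0\<close>. Thus \<open>2 ^ gap (Suc j)\<close> is
  smaller than every power of the block size, and larger than every power of the size of the preceding block.
\<close>
primrec tower :: "nat \<Rightarrow> nat" where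
  "tower 0 = 1"
| "tower (Suc j) = (j + 2)\<^sup>2 * tower j"

primrec gap :: "nat \<Rightarrow> nat" where
  "gap 0 = 0"
| "gap (Suc j) = (j + 2) * tower j"

definition level :: "nat \<Rightarrow> nat" where
  "level i = (LEAST j. i < 2 ^ tower j)"

lemma tower_gap: "tower (Suc j) = (j + 2) * gap (Suc j)"
  by (simp only: tower.simps gap.simps power2_eq_square mult.assoc)

lemma tower_ge: "j + 1 \<le> tower j"
proof (induction j)
  case (Suc j)
  have "(j + 2) * 1 \<le> (j + 2)\<^sup>2 * tower j" using Suc by (intro mult_mono) (auto simp: power2_eq_square)
  then show ?case by simp
qed simp

lemma gap_le_tower: "(j + 1) * gap j \<le> tower j"
proof (cases j)
  case (Suc i)
  show ?thesis unfolding Suc tower_gap by simp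
qed simp

lemma tower_le_gap: "tower j \<le> gap (Suc j)"
  by simp

lemma tower_mono: "i \<le> j \<Longrightarrow> tower i \<le> tower j"
  by (rule lift_Suc_mono_le[of tower]) auto

lemma gap_ge: "j + 2 \<le> gap (Suc j)"
  using mult_le_mono2[of 1 "tower j" "j + 2"] tower_ge[of j] by simp

declare tower.simps(2) [simp del] gap.simps(2) [simp del]

lemma gap_mono: "i \<le> j \<Longrightarrow> gap i \<le> gap j"
proof (rule lift_Suc_mono_le[of gap])
  show "gap j \<le> gap (Suc j)" for j
    using gap_le_tower[of j] tower_le_gap[of j] by simp
qed

lemma level_less: "i < 2 ^ tower (level i)"
proof -
  have "i < 2 ^ i" by simp
  also have "(2 :: nat) ^ i \<le> 2 ^ tower i" using tower_ge[of i] by (intro power_increasing) auto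
  finally show ?thesis unfolding level_def by (rule LeastI)
qed

lemma level_le: "i < 2 ^ tower j \<Longrightarrow> level i \<le> j"
  unfolding level_def by (rule Least_le)

lemma level_gt:
  assumes "2 ^ tower j \<le> i" shows "j < level i"
proof (rule ccontr)
  assume "\<not> ?thesis"
  then have "(2 :: nat) ^ tower (level i) \<le> 2 ^ tower j" by (intro power_increasing tower_mono) auto
  then show False using level_less[of i] assms by linarith
qed

lemma level_eq: "2 ^ tower j \<le> i \<Longrightarrow> i < 2 ^ tower (Suc j) \<Longrightarrow> level i = Suc j"
  using level_gt[of j i] level_le[of i "Suc j"] by simp

text \<open>
  With \<open>T = 2 ^ tower j\<close> on the \<open>j\<close>-th block, these are \<open>T powr (1 / q)\<close> and \<open>T powr (- 1 / q)\<close> up to small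
  factors. The factor \<open>2 powr - j\<close> makes the line an element of \<open>\<ell>\<^sub>q\<close>. The factor \<open>2 powr - gap j\<close> makes the
  product so small that \<open>2 ^ gap j\<close> sampled points of the block cost at most \<open>1\<close>.
\<close>
definition sparse_weight :: "real \<Rightarrow> nat \<Rightarrow> real" where
  "sparse_weight q i = 2 powr (real (tower (level i)) / q - real (gap (level i)))"
definition sparse_line :: "real \<Rightarrow> nat \<Rightarrow> real" where
  "sparse_line q i = 2 powr (- real (tower (level i)) / q - real (level i))"

lemma sparse_product: "sparse_weight q i * sparse_line q i = 2 powr (- real (gap (level i)) - real (level i))"
  by (simp add: sparse_weight_def sparse_line_def flip: powr_add)

text \<open>
  The loss \<open>2 powr gap j\<close> is at most \<open>T powr d\<close> for every \<open>d > 0\<close> once \<open>j + 1 \<ge> 1 / d\<close>; the finitely many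
  other blocks are absorbed by the constant.
\<close>
lemma sparse_weight_growth:
  assumes q: "1 \<le> q" and s: "0 \<le> s" "s < 1 / q"
  shows "\<exists>c0>0. \<forall>i. c0 * (real i + 1) powr s \<le> sparse_weight q i"
proof -
  define d where "d = 1 / q - s"
  have d: "0 < d" using s by (simp add: d_def)
  obtain J :: nat where J: "1 / d < J" using reals_Archimedean2 by blast
  define c0 where "c0 = 2 powr (- real (tower J))"
  have "c0 * (real i + 1) powr s \<le> sparse_weight q i" for i
  proof -
    define j where "j = level i"
    have "i + 1 \<le> 2 ^ tower j" using level_less[of i] by (simp add: j_def)
    then have "real (i + 1) \<le> real (2 ^ tower j)" by (rule of_nat_mono)
    then have "real i + 1 \<le> 2 powr real (tower j)" by (simp add: powr_realpow)
    then have "(real i + 1) powr s \<le> (2 powr real (tower j)) powr s" using s by (intro powr_mono2) auto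
    then have "c0 * (real i + 1) powr s \<le> c0 * 2 powr (real (tower j) * s)"
      by (intro mult_left_mono) (auto simp: c0_def powr_powr)
    also have "\<dots> = 2 powr (real (tower j) * s - real (tower J))"
      by (simp add: c0_def flip: powr_add)
    also have "\<dots> \<le> 2 powr (real (tower j) / q - real (gap j))"
    proof (rule powr_mono)
      have "real (gap j) \<le> real (tower J) + real (tower j) * d"
      proof (cases "J \<le> j")
        case True
        then have "1 / d \<le> real (j + 1)" using J by linarith
        then have "1 \<le> d * real (j + 1)" using d by (simp add: pos_divide_le_eq mult.commute)
        then have "real (gap j) * 1 \<le> real (gap j) * (d * real (j + 1))" by (intro mult_left_mono) auto
        also have "\<dots> = d * real ((j + 1) * gap j)" by (simp add: algebra_simps)
        also have "\<dots> \<le> d * real (tower j)" using d gap_le_tower[of j] by (intro mult_left_mono of_nat_mono) auto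
        finally show ?thesis by (simp add: mult.commute)
      next
        case False
        have "gap j \<le> (j + 1) * gap j" by simp
        also have "\<dots> \<le> tower j" by (rule gap_le_tower)
        also have "\<dots> \<le> tower J" using False by (intro tower_mono) simp
        finally have "real (gap j) \<le> real (tower J)" by (rule of_nat_mono)
        moreover have "0 \<le> real (tower j) * d" using d by simp
        ultimately show ?thesis by linarith
      qed
      then show "real (tower j) * s - real (tower J) \<le> real (tower j) / q - real (gap j)"
        by (simp add: d_def algebra_simps)
    qed simp
    finally show ?thesis by (simp add: sparse_weight_def j_def)
  qed
  then show ?thesis by (intro exI[of _ c0]) (auto simp: c0_def)
qed

lemma sparse_line_in_lp:
  assumes q: "1 \<le> q"
  shows "sparse_line q \<in> lp_space (ereal q) nat_count"
proof (rule lp_count_leI(1))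
  show "1 \<le> ereal q" using q by simp
  show "0 \<le> (2 :: real) powr (1 / q)" by simp
  fix S :: "nat set" assume S: "finite S"
  have pt: "\<bar>sparse_line q i\<bar> powr q \<le> 2 powr (- real (tower (level i)) - real (level i))" for i
  proof -
    have "(- real (tower (level i)) / q - real (level i)) * q \<le> - real (tower (level i)) - real (level i)"
    proof -
      have "real (level i) * 1 \<le> real (level i) * q" using q by (intro mult_left_mono) auto
      then show ?thesis using q by (simp add: left_diff_distrib)
    qed
    then show ?thesis by (simp add: sparse_line_def powr_powr)
  qed
  define J where "J = Suc (Max (insert 0 (level ` S)))"
  have J: "level i < J" if "i \<in> S" for i
    using S that unfolding J_def by (simp add: less_Suc_eq_le)
  have "(\<Sum>i\<in>S. \<bar>sparse_line q i\<bar> powr q) \<le> (\<Sum>i\<in>S. 2 powr (- real (tower (level i)) - real (level i)))"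
    by (intro sum_mono pt)
  also have "\<dots> = (\<Sum>j<J. \<Sum>i\<in>{i \<in> S. level i = j}. 2 powr (- real (tower (level i)) - real (level i)))"
    using S J by (intro sum.group[symmetric]) auto
  also have "\<dots> \<le> (\<Sum>j<J. (1 / 2) ^ j)"
  proof (intro sum_mono)
    fix j
    have "card {i \<in> S. level i = j} \<le> card {..<(2 :: nat) ^ tower j}"
      using level_less by (intro card_mono) auto
    then have "real (card {i \<in> S. level i = j}) \<le> 2 powr real (tower j)"
      by (simp add: powr_realpow)
    then have "real (card {i \<in> S. level i = j}) * 2 powr (- real (tower j) - real j)
        \<le> 2 powr real (tower j) * 2 powr (- real (tower j) - real j)"
      by (intro mult_right_mono) auto
    also have "\<dots> = 2 powr (- real j)" by (simp flip: powr_add)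
    also have "\<dots> = (1 / 2) ^ j"
      by (simp add: powr_minus powr_realpow power_one_over inverse_eq_divide)
    finally show "(\<Sum>i\<in>{i \<in> S. level i = j}. 2 powr (- real (tower (level i)) - real (level i))) \<le> (1 / 2) ^ j"
      by simp
  qed
  also have "\<dots> = 2 - 2 * (1 / 2) ^ J" by (induction J) auto
  also have "\<dots> \<le> 2" by simp
  finally have "(\<Sum>i\<in>S. \<bar>sparse_line q i\<bar> powr q) powr (1 / q) \<le> 2 powr (1 / q)"
    using q by (intro powr_mono2) (auto intro: sum_nonneg)
  then show "ell_norm (ereal q) S (sparse_line q) \<le> 2 powr (1 / q)"
    using S by (simp add: lp_norm_finite)
qed

lemma tower_block_large: "2 ^ (tower (Suc j) - 1) \<le> (2 :: nat) ^ tower (Suc j) - 2 ^ tower j"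
proof -
  have "2 * tower j \<le> tower (Suc j)" by (simp add: tower.simps(2) power2_eq_square)
  then have "tower j \<le> tower (Suc j) - 1" using tower_ge[of j] by linarith
  then have "(2 :: nat) ^ tower j \<le> 2 ^ (tower (Suc j) - 1)" by (intro power_increasing) auto
  moreover have "(2 :: nat) ^ tower (Suc j) = 2 * 2 ^ (tower (Suc j) - 1)"
  proof -
    have "tower (Suc j) = Suc (tower (Suc j) - 1)" using tower_ge[of "Suc j"] by linarith
    then show ?thesis by (metis power_Suc)
  qed
  ultimately show ?thesis by linarith
qed

lemma sparse_product_unbounded: "\<exists>n. B < (\<Sum>i<n. sparse_weight q i * sparse_line q i)"
proof -
  obtain j :: nat where j: "B < 2 ^ j" using real_arch_pow[of 2 B] by auto
  let ?I = "{(2 :: nat) ^ tower j..<2 ^ tower (Suc j)}"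
  let ?t = "tower (Suc j)" and ?e = "gap (Suc j)"
  have pos: "0 \<le> sparse_weight q i * sparse_line q i" for i by (simp add: sparse_product)
  have eq: "sparse_weight q i * sparse_line q i = 2 powr (- real ?e - real (Suc j))" if "i \<in> ?I" for i
    using that level_eq[of j i] by (simp add: sparse_product)
  have ge: "j \<le> ?t - 1 - ?e - Suc j" "?e + Suc j \<le> ?t - 1"
  proof -
    have "j + 2 \<le> ?e" by (rule gap_ge)
    then have "(j + 1) * (j + 2) \<le> (j + 1) * ?e" by (rule mult_le_mono2)
    moreover have "?t = (j + 1) * ?e + ?e" unfolding tower_gap by simp
    ultimately have "?e + (j + 1) * (j + 2) \<le> ?t" by linarith
    moreover have "2 * j + 2 \<le> (j + 1) * (j + 2)" by (simp add: algebra_simps)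
    ultimately show "j \<le> ?t - 1 - ?e - Suc j" "?e + Suc j \<le> ?t - 1" by linarith+
  qed
  have "B < 2 powr real j" using j by (simp add: powr_realpow)
  also have "\<dots> \<le> 2 powr (real (?t - 1) + (- real ?e - real (Suc j)))"
    using ge by (intro powr_mono) auto
  also have "\<dots> = real (2 ^ (?t - 1)) * 2 powr (- real ?e - real (Suc j))"
    by (simp add: powr_add powr_realpow)
  also have "\<dots> \<le> real (card ?I) * 2 powr (- real ?e - real (Suc j))"
    using tower_block_large[of j] by (intro mult_right_mono of_nat_mono) auto
  also have "\<dots> = (\<Sum>i\<in>?I. sparse_weight q i * sparse_line q i)"
    using eq by simp
  also have "\<dots> \<le> (\<Sum>i<2 ^ ?t. sparse_weight q i * sparse_line q i)"
    using pos by (intro sum_mono2) auto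
  finally show ?thesis by blast
qed

text \<open>
  Points of earlier blocks are so few that each may cost \<open>1\<close>. All other points, also those of later
  blocks, cost at most \<open>2 powr - gap (Suc j)\<close> each.
\<close>
lemma sparse_cost:
  assumes Q: "finite Q" "card Q \<le> 2 ^ gap (Suc j)"
  shows "(\<Sum>i\<in>Q. sparse_weight q i * sparse_line q i) \<le> 2 ^ tower j + 1"
proof -
  let ?h = "\<lambda>i. sparse_weight q i * sparse_line q i"
  let ?Q1 = "Q \<inter> {..<2 ^ tower j}" and ?Q2 = "Q - {..<2 ^ tower j}"
  have "(\<Sum>i\<in>Q. ?h i) = (\<Sum>i\<in>?Q1. ?h i) + (\<Sum>i\<in>?Q2. ?h i)"
    using Q(1) by (subst sum.union_disjoint[symmetric]) (auto intro!: sum.cong)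
  also have "(\<Sum>i\<in>?Q1. ?h i) \<le> (\<Sum>i\<in>?Q1. 1)"
  proof (intro sum_mono)
    fix i
    have "(2 :: real) powr (- real (gap (level i)) - real (level i)) \<le> 2 powr 0" by (intro powr_mono) auto
    then show "?h i \<le> 1" by (simp add: sparse_product)
  qed
  also have "(\<Sum>i\<in>?Q1. 1) \<le> (2 :: real) ^ tower j"
  proof -
    have "card ?Q1 \<le> card {..<(2 :: nat) ^ tower j}" by (intro card_mono) auto
    then have "real (card ?Q1) \<le> real (2 ^ tower j)" by (intro of_nat_mono) simp
    then show ?thesis by simp
  qed
  also have "(\<Sum>i\<in>?Q2. ?h i) \<le> (\<Sum>i\<in>?Q2. 2 powr - real (gap (Suc j)))"
  proof (intro sum_mono)
    fix i assume "i \<in> ?Q2"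
    then have "Suc j \<le> level i" using level_gt[of j i] by auto
    then have "real (gap (Suc j)) \<le> real (gap (level i))" by (intro of_nat_mono gap_mono)
    then show "?h i \<le> 2 powr - real (gap (Suc j))"
      unfolding sparse_product by (intro powr_mono) auto
  qed
  also have "\<dots> = real (card ?Q2) * 2 powr - real (gap (Suc j))" by simp
  also have "\<dots> \<le> real (2 ^ gap (Suc j)) * 2 powr - real (gap (Suc j))"
    using Q card_mono[of Q ?Q2] by (intro mult_right_mono of_nat_mono) auto
  also have "\<dots> = 1" by (simp add: powr_minus powr_realpow)
  finally show ?thesis by simp
qed

lemma sparse_line_large:
  assumes q: "1 \<le> q" and Q: "finite Q" "card Q \<le> 2 ^ gap (Suc j)"
  shows "\<exists>S. finite S \<and> S \<inter> Q = {} \<and> 2 powr (- real (j + 3)) \<le> ell_norm (ereal q) S (sparse_line q)"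
proof -
  let ?t = "tower (Suc j)"
  define S where "S = {(2 :: nat) ^ tower j..<2 ^ ?t} - Q"
  have e2: "2 \<le> gap (Suc j)" using gap_ge[of j] by linarith
  have "2 * gap (Suc j) \<le> ?t" unfolding tower_gap by simp
  then have et: "gap (Suc j) \<le> ?t - 2" "2 \<le> ?t" using e2 by linarith+
  have "2 ^ (?t - 1) \<le> card {(2 :: nat) ^ tower j..<2 ^ ?t}" using tower_block_large[of j] by simp
  moreover have "card {(2 :: nat) ^ tower j..<2 ^ ?t} - card Q \<le> card S"
    unfolding S_def by (rule diff_card_le_card_Diff[OF Q(1)])
  moreover have "(2 :: nat) ^ gap (Suc j) \<le> 2 ^ (?t - 2)" using et by (intro power_increasing) auto
  moreover have "(2 :: nat) ^ (?t - 1) = 2 * 2 ^ (?t - 2)"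
  proof -
    have "?t - 1 = Suc (?t - 2)" using et by linarith
    then show ?thesis by (simp only: power_Suc)
  qed
  ultimately have "2 ^ (?t - 2) \<le> card S" using Q(2) by linarith
  then have "real (2 ^ (?t - 2)) \<le> real (card S)" by (rule of_nat_mono)
  moreover have "real (2 ^ (?t - 2)) = 2 powr (real ?t - 2)"
    using et by (simp add: powr_realpow[symmetric] of_nat_diff)
  ultimately have cS: "2 powr (real ?t - 2) \<le> real (card S)" by linarith
  have gS: "sparse_line q i = 2 powr (- real ?t / q - real (Suc j))" if "i \<in> S" for i
    using that level_eq[of j i] by (simp add: sparse_line_def S_def)
  have "ell_norm (ereal q) S (sparse_line q)
      = (real (card S) * (2 powr (- real ?t / q - real (Suc j))) powr q) powr (1 / q)"
    using gS by (simp add: lp_norm_finite S_def)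
  also have "\<dots> = real (card S) powr (1 / q) * 2 powr (- real ?t / q - real (Suc j))"
    using q by (simp add: powr_mult powr_powr)
  also have "\<dots> \<ge> (2 powr (real ?t - 2)) powr (1 / q) * 2 powr (- real ?t / q - real (Suc j))"
    using cS q by (intro mult_right_mono powr_mono2) auto
  also have "(2 powr (real ?t - 2)) powr (1 / q) * 2 powr (- real ?t / q - real (Suc j))
      = 2 powr ((real ?t - 2) * (1 / q) + (- real ?t / q - real (Suc j)))"
    by (simp only: powr_powr powr_add)
  also have "(real ?t - 2) * (1 / q) + (- real ?t / q - real (Suc j)) = - 2 / q - real (Suc j)"
    by (simp add: left_diff_distrib diff_divide_distrib)
  also have "2 powr (- real (j + 3)) \<le> 2 powr (- 2 / q - real (Suc j))"
    using q by (intro powr_mono) (auto simp: field_simps)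
  finally show ?thesis by (intro exI[of _ S]) (auto simp: S_def)
qed

text \<open>
  At \<open>n = 2 ^ gap (Suc j)\<close> the error of function values is at least \<open>2 powr - (j + tower j)\<close> up to a constant, and
  \<open>gap (Suc j) = (j + 2) * tower j\<close>, so that the error is larger than any negative power of \<open>n\<close> for large \<open>j\<close>.
\<close>
lemma power_function_zero:
  assumes inf: "infinite (UNIV :: 'a set)" and q: "1 \<le> q" and r: "0 < r" "r \<le> 1 / q + gelfand_gain (ereal q)"
  shows "power_function TYPE('a) r (ereal q) = 0"
proof (rule antisym)
  obtain a b :: "nat \<Rightarrow> 'a" where ab: "inj a" "inj b" "\<forall>i j. a i \<noteq> b j"
    by (rule disjoint_enumerations[OF inf])
  obtain w0 where w0: "0 < w0" "\<And>i. w0 * (real i + 1) powr 0 \<le> sparse_weight q i"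
    using sparse_weight_growth[OF q, of 0] q by auto
  interpret E: hidden_line_space a b "ereal q" r "sparse_weight q" "sparse_line q" w0
  proof
    show "w0 \<le> sparse_weight q i" for i using w0(2)[of i] by simp
    show "sparse_line q \<in> lp_space (ereal q) nat_count" by (rule sparse_line_in_lp[OF q])
    show "\<exists>n. B < (\<Sum>i<n. sparse_weight q i * sparse_line q i)" for B by (rule sparse_product_unbounded)
  qed (use ab q r w0 in \<open>auto simp: sparse_line_def\<close>)
  have "rate_all (ereal q) (count_space E.Omega) E.F E.N = ereal r"
    by (rule E.rate_all_eq[of "1 / q"]) (use q r sparse_weight_growth[OF q] in auto)
  then have "power_function TYPE('a) r (ereal q) \<le> rate_std (ereal q) (count_space E.Omega) E.F E.N / ereal r"
    by (rule power_function_le[OF E.admissible])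
  also have "\<dots> \<le> ereal 0 / ereal r"
  proof (intro ereal_divide_right_mono)
    show "rate_std (ereal q) (count_space E.Omega) E.F E.N \<le> ereal 0"
      unfolding rate_std_def
    proof (rule rate_le_frequently)
      fix \<beta> :: real assume \<beta>: "0 < \<beta>"
      \<comment> \<open>\<open>7 * tower j\<close> is enough to compensate for \<open>tower j + j + 5\<close>, as \<open>j + 1 \<le> tower j\<close>.\<close>
      obtain J :: nat where J: "7 / \<beta> < J" using reals_Archimedean2 by blast
      have main: "ereal 1 \<le> E.err_std (2 ^ gap (Suc j)) * ereal (real (2 ^ gap (Suc j)) powr \<beta>)" if j: "J \<le> j" for j
      proof -
        have "ereal (2 powr (- real (j + 3)) / (1 + (2 ^ tower j + 1))) \<le> E.err_std (2 ^ gap (Suc j))"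
          by (rule E.err_std_lower_line[OF sparse_cost _ sparse_line_large[OF q]]) auto
        moreover have "2 powr (- real (j + 3) - (real (tower j) + 2)) \<le> 2 powr (- real (j + 3)) / (1 + (2 ^ tower j + 1))"
        proof -
          have "(1 :: real) \<le> 2 ^ tower j" by simp
          then have "1 + (2 ^ tower j + 1) \<le> 4 * (2 :: real) ^ tower j" by linarith
          also have "\<dots> = 2 powr (real (tower j) + 2)" by (simp add: powr_add powr_realpow)
          finally show ?thesis unfolding powr_diff by (intro divide_left_mono) (auto intro!: mult_pos_pos add_pos_pos)
        qed
        ultimately have low: "ereal (2 powr (- real (j + 3) - (real (tower j) + 2))) \<le> E.err_std (2 ^ gap (Suc j))"
          by (meson ereal_less_eq(3) order_trans)
        have "1 \<le> 2 powr (- real (j + 3) - (real (tower j) + 2) + real (gap (Suc j)) * \<beta>)"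
        proof (rule ge_one_powr_ge_zero)
          have "7 / \<beta> \<le> real (j + 2)" using J j by linarith
          then have "7 \<le> real (j + 2) * \<beta>" using \<beta> by (simp add: pos_divide_le_eq)
          then have "real (tower j) * 7 \<le> real (tower j) * (real (j + 2) * \<beta>)" by (intro mult_left_mono) auto
          then have "7 * real (tower j) \<le> real (gap (Suc j)) * \<beta>"
            by (simp add: gap.simps(2) algebra_simps)
          moreover have "real (j + 1) \<le> real (tower j)" using tower_ge[of j] by (rule of_nat_mono)
          ultimately show "0 \<le> - real (j + 3) - (real (tower j) + 2) + real (gap (Suc j)) * \<beta>" by simp
        qed simp
        also have "\<dots> = 2 powr (- real (j + 3) - (real (tower j) + 2)) * real (2 ^ gap (Suc j)) powr \<beta>"
          by (simp add: powr_add powr_powr flip: powr_realpow)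
        finally have "ereal 1 \<le> ereal (2 powr (- real (j + 3) - (real (tower j) + 2))) * ereal (real (2 ^ gap (Suc j)) powr \<beta>)"
          by simp
        also have "\<dots> \<le> E.err_std (2 ^ gap (Suc j)) * ereal (real (2 ^ gap (Suc j)) powr \<beta>)"
          by (intro ereal_mult_right_mono low) simp
        finally show ?thesis .
      qed
      have "\<exists>\<^sub>F n in sequentially. ereal 1 \<le> E.err_std n * ereal (real n powr \<beta>)"
        unfolding frequently_sequentially
      proof
        fix n0
        let ?j = "max J n0"
        have "n0 \<le> ?j + 1" by simp
        also have "\<dots> \<le> tower ?j" by (rule tower_ge)
        also have "\<dots> \<le> gap (Suc ?j)" by (rule tower_le_gap)
        also have "\<dots> < 2 ^ gap (Suc ?j)" by (rule less_exp)
        finally show "\<exists>n\<ge>n0. ereal 1 \<le> E.err_std n * ereal (real n powr \<beta>)"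
          using main[of ?j] by (intro exI[of _ "2 ^ gap (Suc ?j)"]) simp
      qed
      then show "\<exists>\<epsilon>>0. \<exists>\<^sub>F n in sequentially. ereal \<epsilon> \<le> E.err_std n * ereal (real n powr \<beta>)"
        by (intro exI[of _ 1]) simp
    qed simp
  qed (use r in simp)
  also have "\<dots> = 0" using r by simp
  finally show "power_function TYPE('a) r (ereal q) \<le> 0" .
  show "0 \<le> power_function TYPE('a) r (ereal q)" by (rule power_function_nonneg[OF r(1)])
qed

lemma power_function_inf_ge:
  assumes r: "1 < r"
  shows "ereal (1 - 1 / r) \<le> power_function TYPE('a) r \<infinity>"
  unfolding power_function_def
proof (rule Inf_greatest, clarify)
  fix M :: "'a measure" and F N
  assume "admissible_space \<infinity> M F N" "rate_all \<infinity> M F N = ereal r"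
  then have "ereal (r - 1) / ereal r \<le> rate_std \<infinity> M F N / ereal r"
    using r by (intro ereal_divide_right_mono rate_std_ge) auto
  then show "ereal (1 - 1 / r) \<le> rate_std \<infinity> M F N / ereal r"
    using r by (simp add: diff_divide_distrib)
qed

theorem theorem5:
  assumes "infinite (UNIV :: 'a set)"
  shows
    "(\<forall>r p :: real. 0 < r \<and> r \<le> 1 \<and> 1 \<le> p \<and> p \<le> 2 \<longrightarrow>
        power_function TYPE('a) r (ereal p) = 0) \<and>
     (\<forall>r p :: real. 2 < p \<and> 0 < r \<and> r \<le> 1 / 2 + 1 / p \<longrightarrow>
        power_function TYPE('a) r (ereal p) = 0) \<and>
     (\<forall>r p :: real. 1 < r \<and> 1 \<le> p \<and> p \<le> 2 \<longrightarrow>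
        power_function TYPE('a) r (ereal p) \<le> ereal (1 - (1 / r) * (1 - 1 / p))) \<and>
     (\<forall>r p :: real. 1 < r \<and> 2 \<le> p \<longrightarrow>
        power_function TYPE('a) r (ereal p) \<le> ereal (1 - 1 / (2 * r))) \<and>
     (\<forall>r :: real. 1 < r \<longrightarrow>
        ereal (1 - 1 / r) \<le> power_function TYPE('a) r \<infinity> \<and>
        power_function TYPE('a) r \<infinity> \<le> ereal (1 - 1 / (2 * r)))"
proof (intro conjI allI impI)
  have small: "gelfand_gain (ereal p) = 1 - 1 / p" if "p \<le> 2" for p :: real
    using that by (simp add: gelfand_gain_def)
  have large: "gelfand_gain (ereal p) = 1 / 2" if "2 \<le> p" for p :: real
    using that by (cases "p = 2") (auto simp: gelfand_gain_def)
  have inf: "gelfand_gain \<infinity> = 1 / 2" by (simp add: gelfand_gain_def)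
  fix r p :: real
  show "power_function TYPE('a) r (ereal p) = 0" if "0 < r \<and> r \<le> 1 \<and> 1 \<le> p \<and> p \<le> 2"
    by (rule power_function_zero[OF assms]) (use that small in auto)
  show "power_function TYPE('a) r (ereal p) = 0" if "2 < p \<and> 0 < r \<and> r \<le> 1 / 2 + 1 / p"
    by (rule power_function_zero[OF assms]) (use that in \<open>auto simp: large\<close>)
  show "power_function TYPE('a) r (ereal p) \<le> ereal (1 - (1 / r) * (1 - 1 / p))"
    if "1 < r \<and> 1 \<le> p \<and> p \<le> 2"
    using power_function_le_gain[OF assms, of "ereal p" r] that small[of p] by simp
  show "power_function TYPE('a) r (ereal p) \<le> ereal (1 - 1 / (2 * r))" if "1 < r \<and> 2 \<le> p"
    using power_function_le_gain[OF assms, of "ereal p" r] that large[of p] by simp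
  show "ereal (1 - 1 / r) \<le> power_function TYPE('a) r \<infinity>" if "1 < r"
    by (rule power_function_inf_ge[OF that])
  show "power_function TYPE('a) r \<infinity> \<le> ereal (1 - 1 / (2 * r))" if "1 < r"
    using power_function_le_gain[OF assms, of \<infinity> r] that inf by simp
qed

end
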